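(* For every $\alpha>0$ there exist a bounded pseudoconvex domain $D\subset\mathbb C^3$ with $C^\infty$-smooth boundary, a point $P\in\partial D$, and a decreasing sequence $(\delta_\nu)_\nu$ of positive numbers with $\delta_\nu\to0$ and $P_{\delta_\nu}:=P-\delta_\nu n\in D$ for all $\nu$, such that $$\kappa_D(P_{\delta_\nu};n)\le\frac{1}{\delta_\nu(-\log\delta_\nu)^{\alpha}}\quad\text{for all }\nu,$$ where $n$ denotes the unit outward normal vector to $\partial D$ at $P$.
   Context: For a domain $D\subset\mathbb C^m$, $z\in D$ and $X\in\mathbb C^m$, the Kobayashi–Royden (pseudo)metric is $\kappa_D(z;X):=\inf\{\alpha>0:\ \text{there is } f\in\mathcal O(\mathbb D,D)\text{ with } f(0)=z,\ \alpha f'(0)=X\}$, where $\mathbb D$ is the open unit disc in $\mathbb C$ and $\mathcal O(\mathbb D,D)$ is the set of holomorphic maps $\mathbb D\to D$. *)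

theory Defs
  imports "HOL-Analysis.Analysis"
begin

text \<open>Points of C^m are modelled as vectors of type complex^'m; the norm is the
standard Hermitian (Euclidean) norm and the real inner product is the one of R^(2m).\<close>

definition is_domain :: "(complex^'m) set \<Rightarrow> bool" where
  "is_domain D \<longleftrightarrow> open D \<and> connected D \<and> D \<noteq> {}"

text \<open>C-infinity smoothness (as a function of the underlying real variables) on an open set U:
  there is a family F of all iterated directional derivatives, F [] = f and
  F (v # vs) is the derivative of F vs in direction v; each F vs is differentiable on U.\<close>
definition C_infinity_on :: "'a::euclidean_space set \<Rightarrow> ('a \<Rightarrow> real) \<Rightarrow> bool" where
  "C_infinity_on U f \<longleftrightarrow>
     (\<exists>F :: 'a list \<Rightarrow> 'a \<Rightarrow> real. F [] = f \<and>
        (\<forall>vs. \<forall>x\<in>U. \<exists>L. (F vs has_derivative L) (at x) \<and> (\<forall>v. L v = F (v # vs) x)))"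

definition smooth_boundary :: "(complex^'m) set \<Rightarrow> bool" where
  "smooth_boundary D \<longleftrightarrow>
     (\<exists>U r. open U \<and> frontier D \<subseteq> U \<and> C_infinity_on U r \<and>
        (\<forall>z\<in>U. z \<in> D \<longleftrightarrow> r z < 0) \<and>
        (\<forall>z\<in>frontier D. \<exists>L. (r has_derivative L) (at z) \<and> L \<noteq> (\<lambda>_. 0)))"

text \<open>Hartogs pseudoconvexity: -log of the boundary distance is plurisubharmonic on D,
  i.e. (it is continuous and) satisfies the sub-mean-value inequality on every closed
  analytic disc {a + \<lambda> b : |\<lambda>| \<le> 1} contained in D.\<close>
definition bdist :: "(complex^'m) set \<Rightarrow> complex^'m \<Rightarrow> real" where
  "bdist D z = infdist z (- D)"

definition pseudoconvex :: "(complex^'m) set \<Rightarrow> bool" where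
  "pseudoconvex D \<longleftrightarrow> is_domain D \<and>
     (\<forall>a b. (\<forall>w::complex. cmod w \<le> 1 \<longrightarrow> a + w *s b \<in> D) \<longrightarrow>
        - ln (bdist D a) \<le>
          (1 / (2 * pi)) * integral {0..2*pi} (\<lambda>t. - ln (bdist D (a + cis t *s b))))"

definition outward_unit_normal :: "(complex^'m) set \<Rightarrow> complex^'m \<Rightarrow> complex^'m \<Rightarrow> bool" where
  "outward_unit_normal D P n \<longleftrightarrow>
     (\<exists>U r g. open U \<and> P \<in> U \<and> (\<forall>z\<in>U. z \<in> D \<longleftrightarrow> r z < 0) \<and>
        (r has_derivative (\<lambda>h. inner g h)) (at P) \<and> g \<noteq> 0 \<and> n = (1 / norm g) *\<^sub>R g)"

definition holo_disc :: "(complex \<Rightarrow> complex^'m) \<Rightarrow> (complex^'m) set \<Rightarrow> bool" where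
  "holo_disc f D \<longleftrightarrow> (\<forall>i. (\<lambda>w. f w $ i) holomorphic_on ball 0 1) \<and> f ` ball 0 1 \<subseteq> D"

definition disc_deriv0 :: "(complex \<Rightarrow> complex^'m) \<Rightarrow> complex^'m" where
  "disc_deriv0 f = (\<chi> i. deriv (\<lambda>w. f w $ i) 0)"

definition kobayashi_royden :: "(complex^'m) set \<Rightarrow> complex^'m \<Rightarrow> complex^'m \<Rightarrow> real" where
  "kobayashi_royden D z X =
     Inf {\<alpha>::real. \<alpha> > 0 \<and> (\<exists>f. holo_disc f D \<and> f 0 = z \<and> \<alpha> *\<^sub>R disc_deriv0 f = X)}"

end

theory Submission
  imports Defs "HOL-Complex_Analysis.Conformal_Mappings"
begin

text \<open>Write points of C^3 as (w, z1, z2). The domain is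
  Re w + |w|^2 + chi(z) + rho(z) < 0 with P = 0, where chi vanishes for small z and makes the
  domain bounded. The normal speed of a disc (w(z), g(z)) through a point at depth delta below P can
  exceed delta by far only if rho is negative along g; since g'(0) = 0, rho has to see a parameter
  that is not a holomorphic function of z. Along the cusp g(s) = (s^2, s^3) the quotient
  z2/z1 = s is such a parameter. The function S_T is plurisubharmonic, vanishes near 0 and satisfies
  S_T(s^2, s^3) <= - Re s + 27 ln T + 16 for |s| <= T, while its derivatives grow only polynomially
  in T. With L = ln (1/delta), T = L^m and m >= alpha + 1, the rescaled function delta L^alpha S_T / T lets the disc
  w = - delta + delta L^alpha s stay in the domain at a cost (27 ln T + 16) L^alpha / T that is
  small compared with 1. As delta decays faster than any power of L, the sum rho over a rapidly
  increasing sequence of L is smooth; the terms with smaller L vanish on the disc and those with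
  larger L are negligible.\<close>

text \<open>The velocity of the disc is normal, so its z-part is O(s^2) and every smooth function of
  z has zero linear term along it at the centre. Hence nothing can compensate the term Re s of w
  near s = 0; the compensation - Re s has to be switched on away from the centre. The maximum of -
  Re s and 0 is useless for this, since it is 0 exactly where a negative value is wanted. Adding 27
  ln (|s|/4) makes the function at most 0 for |s| <= 2 and at least 1 for 8 < |s| < 16. So the
  maximum with 0 is 0 inside, returns the function itself on the annulus, and need not be taken any
  more outside, where the function may become very negative. The price is of order ln T against a
  gain of order T, which is why every power of L can be reached. Away from the cusp the quotient s =
  z2/z1 must disappear again. A multiple of |z2^2 - z1^3|^2 - 1 is very negative on the cusp and
  dominates at some distance from it, so a second smooth maximum removes the quotient there.\<close>

section \<open>Smooth families with polynomially bounded derivatives\<close>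

text \<open>The families below carry a scale parameter T; all bounds are uniform over the (possibly unbounded)
  set U and polynomial in T and the point.\<close>
definition pbound :: "'a::euclidean_space set \<Rightarrow> (real \<Rightarrow> 'a \<Rightarrow> real) \<Rightarrow> bool" where
  "pbound U f \<longleftrightarrow> (\<exists>C N. \<forall>T\<ge>1. \<forall>x\<in>U. \<bar>f T x\<bar> \<le> C * (T + norm x) ^ N)"

text \<open>The lists encode iterated directional derivatives as in \<open>C_infinity_on\<close>.
  The family \<open>F\<close> is tied to \<open>f\<close> only on \<open>U\<close> and for
  \<open>T \<ge> 1\<close>, which leaves room for gluing pieces that live on different open
  sets.\<close>

definition tame :: "'a::euclidean_space set \<Rightarrow> (real \<Rightarrow> 'a \<Rightarrow> real) \<Rightarrow> bool" where
  "tame U f \<longleftrightarrow> (\<exists>F. (\<forall>T\<ge>1. \<forall>x\<in>U. F [] T x = f T x) \<and>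
     (\<forall>vs. \<forall>T\<ge>1. \<forall>x\<in>U. (F vs T has_derivative (\<lambda>v. F (v # vs) T x)) (at x)) \<and>
     (\<forall>vs. pbound U (F vs)))"

lemma pboundI:
  assumes "\<And>T x. T \<ge> 1 \<Longrightarrow> x \<in> U \<Longrightarrow> \<bar>f T x\<bar> \<le> C * (T + norm x) ^ N"
  shows "pbound U f"
  using assms unfolding pbound_def by blast

lemma pboundE:
  assumes "pbound U f"
  obtains C N where "C \<ge> 0" "\<And>T x. T \<ge> 1 \<Longrightarrow> x \<in> U \<Longrightarrow> \<bar>f T x\<bar> \<le> C * (T + norm x) ^ N"
proof -
  obtain C N where *: "\<And>T x. T \<ge> 1 \<Longrightarrow> x \<in> U \<Longrightarrow> \<bar>f T x\<bar> \<le> C * (T + norm x) ^ N"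
    using assms unfolding pbound_def by blast
  have "\<bar>f T x\<bar> \<le> \<bar>C\<bar> * (T + norm x) ^ N" if "T \<ge> 1" "x \<in> U" for T x
  proof -
    have "C * (T + norm x) ^ N \<le> \<bar>C\<bar> * (T + norm x) ^ N"
      using that by (intro mult_right_mono) auto
    with * that show ?thesis by fastforce
  qed
  then show thesis using that[of "\<bar>C\<bar>" N] by simp
qed

lemma pow_base_mono:
  fixes T :: real
  assumes "T \<ge> 1" "n \<le> m"
  shows "(T + norm x) ^ n \<le> (T + norm x) ^ m"
proof -
  have "1 \<le> T + norm x" using assms(1) norm_ge_zero[of x] by linarith
  then show ?thesis using assms(2) by (rule power_increasing[rotated])
qed

lemma pbound_add:
  assumes "pbound U f" "pbound U g"
  shows "pbound U (\<lambda>T x. f T x + g T x)"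
proof -
  obtain C N where 1: "C \<ge> 0" "\<And>T x. T \<ge> 1 \<Longrightarrow> x \<in> U \<Longrightarrow> \<bar>f T x\<bar> \<le> C * (T + norm x) ^ N"
    using assms(1) by (rule pboundE) blast
  obtain C' N' where 2: "C' \<ge> 0" "\<And>T x. T \<ge> 1 \<Longrightarrow> x \<in> U \<Longrightarrow> \<bar>g T x\<bar> \<le> C' * (T + norm x) ^ N'"
    using assms(2) by (rule pboundE) blast
  show ?thesis
  proof (rule pboundI[where C = "C + C'" and N = "max N N'"])
    fix T :: real and x assume T: "T \<ge> 1" and x: "x \<in> U"
    have "C * (T + norm x) ^ N \<le> C * (T + norm x) ^ max N N'"
      using 1(1) T by (intro mult_left_mono pow_base_mono) auto
    moreover have "C' * (T + norm x) ^ N' \<le> C' * (T + norm x) ^ max N N'"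
      using 2(1) T by (intro mult_left_mono pow_base_mono) auto
    ultimately show "\<bar>f T x + g T x\<bar> \<le> (C + C') * (T + norm x) ^ max N N'"
      using 1(2)[OF T x] 2(2)[OF T x] by (auto simp: algebra_simps)
  qed
qed

lemma pbound_mult:
  assumes "pbound U f" "pbound U g"
  shows "pbound U (\<lambda>T x. f T x * g T x)"
proof -
  obtain C N where 1: "C \<ge> 0" "\<And>T x. T \<ge> 1 \<Longrightarrow> x \<in> U \<Longrightarrow> \<bar>f T x\<bar> \<le> C * (T + norm x) ^ N"
    using assms(1) by (rule pboundE) blast
  obtain C' N' where 2: "C' \<ge> 0" "\<And>T x. T \<ge> 1 \<Longrightarrow> x \<in> U \<Longrightarrow> \<bar>g T x\<bar> \<le> C' * (T + norm x) ^ N'"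
    using assms(2) by (rule pboundE) blast
  show ?thesis
  proof (rule pboundI[where C = "C * C'" and N = "N + N'"])
    fix T :: real and x assume T: "T \<ge> 1" and x: "x \<in> U"
    have "\<bar>f T x\<bar> * \<bar>g T x\<bar> \<le> (C * (T + norm x) ^ N) * (C' * (T + norm x) ^ N')"
      using 1 2 T x by (intro mult_mono) auto
    then show "\<bar>f T x * g T x\<bar> \<le> C * C' * (T + norm x) ^ (N + N')"
      by (simp add: abs_mult power_add algebra_simps)
  qed
qed

lemma pbound_Un:
  assumes "pbound U f" "pbound V f"
  shows "pbound (U \<union> V) f"
proof -
  obtain C N where 1: "C \<ge> 0" "\<And>T x. T \<ge> 1 \<Longrightarrow> x \<in> U \<Longrightarrow> \<bar>f T x\<bar> \<le> C * (T + norm x) ^ N"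
    using assms(1) by (rule pboundE) blast
  obtain C' N' where 2: "C' \<ge> 0" "\<And>T x. T \<ge> 1 \<Longrightarrow> x \<in> V \<Longrightarrow> \<bar>f T x\<bar> \<le> C' * (T + norm x) ^ N'"
    using assms(2) by (rule pboundE) blast
  show ?thesis
  proof (rule pboundI[where C = "C + C'" and N = "max N N'"])
    fix T :: real and x assume T: "T \<ge> 1" and x: "x \<in> U \<union> V"
    have "C * (T + norm x) ^ N \<le> C * (T + norm x) ^ max N N'"
      using 1(1) T by (intro mult_left_mono pow_base_mono) auto
    moreover have "C' * (T + norm x) ^ N' \<le> C' * (T + norm x) ^ max N N'"
      using 2(1) T by (intro mult_left_mono pow_base_mono) auto
    moreover have "0 \<le> C * (T + norm x) ^ N" "0 \<le> C' * (T + norm x) ^ N'"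
      using 1(1) 2(1) T by auto
    ultimately show "\<bar>f T x\<bar> \<le> (C + C') * (T + norm x) ^ max N N'"
      using 1(2)[OF T] 2(2)[OF T] x by (fastforce simp: algebra_simps)
  qed
qed

lemma pbound_cong:
  assumes "\<And>T x. T \<ge> 1 \<Longrightarrow> x \<in> U \<Longrightarrow> f T x = g T x"
  shows "pbound U f \<longleftrightarrow> pbound U g"
  unfolding pbound_def by (simp add: assms)

text \<open>Iterating a choice of derivatives along the list of directions never leaves
  \<open>X\<close>. So one differentiation inside a class of polynomially bounded families replaces
  formulas for higher derivatives.\<close>

lemma tame_coinduct:
  assumes X: "\<And>g. g \<in> X \<Longrightarrow> pbound U g \<and>
      (\<exists>G. (\<forall>v. G v \<in> X) \<and> (\<forall>T\<ge>1. \<forall>x\<in>U. (g T has_derivative (\<lambda>v. G v T x)) (at x)))"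
    and f: "f \<in> X"
  shows "tame U f"
proof -
  obtain G where G: "\<And>g. g \<in> X \<Longrightarrow> (\<forall>v. G g v \<in> X) \<and>
      (\<forall>T\<ge>1. \<forall>x\<in>U. (g T has_derivative (\<lambda>v. G g v T x)) (at x))"
    using X by metis
  define F where "F = rec_list f (\<lambda>v vs g. G g v)"
  have F: "F [] = f" "F (v # vs) = G (F vs) v" for v vs
    unfolding F_def by simp_all
  have "F vs \<in> X" for vs
    by (induction vs) (use f G in \<open>auto simp: F\<close>)
  then show ?thesis
    unfolding tame_def using X G F by (intro exI[of _ F]) simp
qed

lemma tameE:
  assumes "tame U f"
  obtains F where "\<And>T x. T \<ge> 1 \<Longrightarrow> x \<in> U \<Longrightarrow> F [] T x = f T x"
     "\<And>vs T x. T \<ge> 1 \<Longrightarrow> x \<in> U \<Longrightarrow> (F vs T has_derivative (\<lambda>v. F (v # vs) T x)) (at x)"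
     "\<And>vs. pbound U (F vs)"
  using assms unfolding tame_def by metis

lemma tame_pbound:
  assumes "tame U f"
  shows "pbound U f"
proof -
  obtain F where "\<And>T x. T \<ge> 1 \<Longrightarrow> x \<in> U \<Longrightarrow> F [] T x = f T x"
     "\<And>vs T x. T \<ge> 1 \<Longrightarrow> x \<in> U \<Longrightarrow> (F vs T has_derivative (\<lambda>v. F (v # vs) T x)) (at x)"
     "\<And>vs. pbound U (F vs)"
    using assms by (rule tameE) blast
  then show ?thesis using pbound_cong[of U "F []" f] by simp
qed

lemma tame_derivative:
  assumes "tame U f" "open U"
  obtains G where "\<And>v. tame U (G v)"
    "\<And>T x. T \<ge> 1 \<Longrightarrow> x \<in> U \<Longrightarrow> (f T has_derivative (\<lambda>v. G v T x)) (at x)"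
proof -
  obtain F where F: "\<And>T x. T \<ge> 1 \<Longrightarrow> x \<in> U \<Longrightarrow> F [] T x = f T x"
     "\<And>vs T x. T \<ge> 1 \<Longrightarrow> x \<in> U \<Longrightarrow> (F vs T has_derivative (\<lambda>v. F (v # vs) T x)) (at x)"
     "\<And>vs. pbound U (F vs)"
    using assms(1) by (rule tameE) blast
  show thesis
  proof
    \<comment> \<open>The head of a list is the direction differentiated last, so \<open>v\<close>
      has to stand at the end.\<close>
    show "tame U (F [v])" for v
      unfolding tame_def
      by (intro exI[of _ "\<lambda>vs. F (vs @ [v])"]) (use F in auto)
    show "(f T has_derivative (\<lambda>v. F [v] T x)) (at x)" if "T \<ge> 1" "x \<in> U" for T x
      by (rule has_derivative_transform_within_open[OF F(2) assms(2)]) (use F(1) that in auto)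
  qed
qed

lemma tame_cong:
  assumes "\<And>T x. T \<ge> 1 \<Longrightarrow> x \<in> U \<Longrightarrow> f T x = g T x" and "tame U f"
  shows "tame U g"
  using assms unfolding tame_def by metis

text \<open>Derivatives at interior points are unique, so by induction on the list the two families
  agree on the overlap and can be merged.\<close>

lemma tame_Un:
  assumes "open U" "open V" "tame U f" "tame V f"
  shows "tame (U \<union> V) f"
proof -
  obtain F where F: "\<And>T x. T \<ge> 1 \<Longrightarrow> x \<in> U \<Longrightarrow> F [] T x = f T x"
     "\<And>vs T x. T \<ge> 1 \<Longrightarrow> x \<in> U \<Longrightarrow> (F vs T has_derivative (\<lambda>v. F (v # vs) T x)) (at x)"
     "\<And>vs. pbound U (F vs)"
    using assms(3) by (rule tameE) blast
  obtain G where G: "\<And>T x. T \<ge> 1 \<Longrightarrow> x \<in> V \<Longrightarrow> G [] T x = f T x"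
     "\<And>vs T x. T \<ge> 1 \<Longrightarrow> x \<in> V \<Longrightarrow> (G vs T has_derivative (\<lambda>v. G (v # vs) T x)) (at x)"
     "\<And>vs. pbound V (G vs)"
    using assms(4) by (rule tameE) blast
  have eq: "\<forall>T\<ge>1. \<forall>x\<in>U \<inter> V. F vs T x = G vs T x" for vs
  proof (induction vs)
    case Nil
    then show ?case using F(1) G(1) by auto
  next
    case (Cons v vs)
    show ?case
    proof (intro allI impI ballI)
      fix T :: real and x assume T: "1 \<le> T" and x: "x \<in> U \<inter> V"
      have "(G vs T has_derivative (\<lambda>v. F (v # vs) T x)) (at x)"
        by (rule has_derivative_transform_within_open[OF F(2) open_Int[OF assms(1,2)]])
           (use Cons T x in auto)
      then have "(\<lambda>v. F (v # vs) T x) = (\<lambda>v. G (v # vs) T x)"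
        using G(2) T x by (intro has_derivative_unique) auto
      then show "F (v # vs) T x = G (v # vs) T x" by metis
    qed
  qed
  define H where "H = (\<lambda>vs T x. if x \<in> U then F vs T x else G vs T x)"
  have HU: "H vs T x = F vs T x" if "x \<in> U" for vs T x
    using that by (simp add: H_def)
  have HV: "H vs T x = G vs T x" if "T \<ge> 1" "x \<in> V" for vs T x
    using that eq by (simp add: H_def)
  show ?thesis unfolding tame_def
  proof (intro exI[of _ H] conjI allI impI ballI)
    show "H [] T x = f T x" if "T \<ge> 1" "x \<in> U \<union> V" for T x
      using that F(1) G(1) by (auto simp: H_def)
    show "(H vs T has_derivative (\<lambda>v. H (v # vs) T x)) (at x)" if T: "T \<ge> 1" and x: "x \<in> U \<union> V" for vs T x
    proof (cases "x \<in> U")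
      case True
      have "(H vs T has_derivative (\<lambda>v. F (v # vs) T x)) (at x)"
        by (rule has_derivative_transform_within_open[OF F(2) assms(1)]) (use True T HU in auto)
      then show ?thesis using True HU by simp
    next
      case False
      have "(H vs T has_derivative (\<lambda>v. G (v # vs) T x)) (at x)"
        by (rule has_derivative_transform_within_open[OF G(2) assms(2)]) (use x False T HV in auto)
      then show ?thesis using x False T HV by simp
    qed
    show "pbound (U \<union> V) (H vs)" for vs
      using pbound_Un[of U "H vs" V] pbound_cong[of U "H vs" "F vs"] pbound_cong[of V "H vs" "G vs"]
        HU HV F(3) G(3) by auto
  qed
qed

text \<open>A function \<open>h 0\<close> of one variable with all its derivatives
  \<open>h n\<close>. Polynomial growth on \<open>V\<close> is what keeps \<open>pbound\<close>
  stable under composition.\<close>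

definition nice :: "real set \<Rightarrow> (nat \<Rightarrow> real \<Rightarrow> real) \<Rightarrow> bool" where
  "nice V h \<longleftrightarrow> (\<forall>n. \<forall>y\<in>V. (h n has_real_derivative h (Suc n) y) (at y)) \<and>
     (\<forall>n. \<exists>C N. \<forall>y\<in>V. \<bar>h n y\<bar> \<le> C * (1 + \<bar>y\<bar>) ^ N)"

lemma pbound_comp:
  assumes f: "pbound U f" and V: "\<And>T x. T \<ge> 1 \<Longrightarrow> x \<in> U \<Longrightarrow> f T x \<in> V" and h: "nice V h"
  shows "pbound U (\<lambda>T x. h n (f T x))"
proof -
  obtain C N where 1: "C \<ge> 0" "\<And>T x. T \<ge> 1 \<Longrightarrow> x \<in> U \<Longrightarrow> \<bar>f T x\<bar> \<le> C * (T + norm x) ^ N"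
    using f by (rule pboundE) blast
  obtain K M where 2: "\<And>y. y \<in> V \<Longrightarrow> \<bar>h n y\<bar> \<le> K * (1 + \<bar>y\<bar>) ^ M"
    using h unfolding nice_def by metis
  show ?thesis
  proof (rule pboundI[where C = "\<bar>K\<bar> * (1 + C) ^ M" and N = "N * M"])
    fix T :: real and x assume T: "T \<ge> 1" and x: "x \<in> U"
    have "1 \<le> T + norm x" using T norm_ge_zero[of x] by linarith
    then have "1 \<le> (T + norm x) ^ N" by (rule one_le_power)
    then have "1 + \<bar>f T x\<bar> \<le> (1 + C) * (T + norm x) ^ N"
      using 1(2)[OF T x] by (simp add: algebra_simps)
    then have *: "(1 + \<bar>f T x\<bar>) ^ M \<le> ((1 + C) * (T + norm x) ^ N) ^ M"
      by (intro power_mono) auto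
    have "\<bar>h n (f T x)\<bar> \<le> K * (1 + \<bar>f T x\<bar>) ^ M" using 2 V T x by blast
    also have "\<dots> \<le> \<bar>K\<bar> * (1 + \<bar>f T x\<bar>) ^ M" by (intro mult_right_mono) auto
    also have "\<dots> \<le> \<bar>K\<bar> * ((1 + C) * (T + norm x) ^ N) ^ M" using * by (intro mult_left_mono) auto
    finally show "\<bar>h n (f T x)\<bar> \<le> \<bar>K\<bar> * (1 + C) ^ M * (T + norm x) ^ (N * M)"
      by (simp add: power_mult_distrib power_mult mult.assoc)
  qed
qed

text \<open>The class to which \<open>tame_coinduct\<close> is applied: the sum, Leibniz and chain
  rules express a derivative of a member by members again. The index \<open>n\<close> in
  \<open>comp\<close> occurs because differentiating \<open>h n\<close> produces
  \<open>h (Suc n)\<close>.\<close>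

inductive_set talg :: "'a::euclidean_space set \<Rightarrow> (real \<Rightarrow> 'a \<Rightarrow> real) set" for U where
  base: "tame U f \<Longrightarrow> f \<in> talg U"
| add: "f \<in> talg U \<Longrightarrow> g \<in> talg U \<Longrightarrow> (\<lambda>T x. f T x + g T x) \<in> talg U"
| mult: "f \<in> talg U \<Longrightarrow> g \<in> talg U \<Longrightarrow> (\<lambda>T x. f T x * g T x) \<in> talg U"
| comp: "f \<in> talg U \<Longrightarrow> (\<And>T x. T \<ge> 1 \<Longrightarrow> x \<in> U \<Longrightarrow> f T x \<in> V) \<Longrightarrow> nice V h \<Longrightarrow>
     (\<lambda>T x. h n (f T x)) \<in> talg U"

lemma talg_tame:
  assumes "open U" "f \<in> talg U"
  shows "tame U f"
proof (rule tame_coinduct[where X = "talg U"])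
  show "f \<in> talg U" by fact
  fix g assume "g \<in> talg U"
  then show "pbound U g \<and> (\<exists>G. (\<forall>v. G v \<in> talg U) \<and>
      (\<forall>T\<ge>1. \<forall>x\<in>U. (g T has_derivative (\<lambda>v. G v T x)) (at x)))"
  proof induction
    case (base f)
    obtain G where "\<And>v. tame U (G v)"
      "\<And>T x. T \<ge> 1 \<Longrightarrow> x \<in> U \<Longrightarrow> (f T has_derivative (\<lambda>v. G v T x)) (at x)"
      using tame_derivative[OF base assms(1)] by metis
    then show ?case using tame_pbound[OF base] talg.base by metis
  next
    case (add f g)
    then obtain F G where FG: "\<And>v. F v \<in> talg U" "\<And>v. G v \<in> talg U"
      "\<And>T x. T \<ge> 1 \<Longrightarrow> x \<in> U \<Longrightarrow> (f T has_derivative (\<lambda>v. F v T x)) (at x)"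
      "\<And>T x. T \<ge> 1 \<Longrightarrow> x \<in> U \<Longrightarrow> (g T has_derivative (\<lambda>v. G v T x)) (at x)"
      by metis
    have "\<forall>v. (\<lambda>T x. F v T x + G v T x) \<in> talg U" using FG by (blast intro: talg.add)
    moreover have "\<forall>T\<ge>1. \<forall>x\<in>U. ((\<lambda>x. f T x + g T x) has_derivative (\<lambda>v. F v T x + G v T x)) (at x)"
      using FG by (auto intro!: has_derivative_add)
    ultimately show ?case using pbound_add[of U f g] add
      by (intro conjI exI[of _ "\<lambda>v T x. F v T x + G v T x"]) auto
  next
    case (mult f g)
    then obtain F G where FG: "\<And>v. F v \<in> talg U" "\<And>v. G v \<in> talg U"
      "\<And>T x. T \<ge> 1 \<Longrightarrow> x \<in> U \<Longrightarrow> (f T has_derivative (\<lambda>v. F v T x)) (at x)"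
      "\<And>T x. T \<ge> 1 \<Longrightarrow> x \<in> U \<Longrightarrow> (g T has_derivative (\<lambda>v. G v T x)) (at x)"
      by metis
    have "\<forall>v. (\<lambda>T x. f T x * G v T x + F v T x * g T x) \<in> talg U"
      by (intro allI talg.add talg.mult FG mult.hyps)
    moreover have "\<forall>T\<ge>1. \<forall>x\<in>U. ((\<lambda>x. f T x * g T x) has_derivative (\<lambda>v. f T x * G v T x + F v T x * g T x)) (at x)"
      using FG by (auto intro!: has_derivative_mult)
    ultimately show ?case using pbound_mult[of U f g] mult
      by (intro conjI exI[of _ "\<lambda>v T x. f T x * G v T x + F v T x * g T x"]) auto
  next
    case (comp f V h n)
    then obtain F where F: "\<And>v. F v \<in> talg U"
      "\<And>T x. T \<ge> 1 \<Longrightarrow> x \<in> U \<Longrightarrow> (f T has_derivative (\<lambda>v. F v T x)) (at x)"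
      by metis
    have "\<forall>v. (\<lambda>T x. h (Suc n) (f T x) * F v T x) \<in> talg U"
      by (intro allI talg.mult F(1) talg.comp[OF comp.hyps(1) _ comp.hyps(3)]) (rule comp.hyps(2))
    moreover have "((\<lambda>x. h n (f T x)) has_derivative (\<lambda>v. h (Suc n) (f T x) * F v T x)) (at x)"
      if "T \<ge> 1" "x \<in> U" for T x
    proof -
      have "(h n has_derivative (\<lambda>y. h (Suc n) (f T x) * y)) (at (f T x))"
        using comp.hyps that unfolding nice_def has_field_derivative_def by blast
      from has_derivative_compose[OF F(2)[OF that] this] show ?thesis .
    qed
    ultimately show ?case
      using pbound_comp[of U f V h n] comp
      by (intro conjI exI[of _ "\<lambda>v T x. h (Suc n) (f T x) * F v T x"]) auto
  qed
qed

lemma tame_add: "open U \<Longrightarrow> tame U f \<Longrightarrow> tame U g \<Longrightarrow> tame U (\<lambda>T x. f T x + g T x)"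
  by (rule talg_tame, assumption, rule talg.add; rule talg.base)

lemma tame_mult: "open U \<Longrightarrow> tame U f \<Longrightarrow> tame U g \<Longrightarrow> tame U (\<lambda>T x. f T x * g T x)"
  by (rule talg_tame, assumption, rule talg.mult; rule talg.base)

lemma tame_comp:
  assumes "open U" "tame U f" "\<And>T x. T \<ge> 1 \<Longrightarrow> x \<in> U \<Longrightarrow> f T x \<in> V" "nice V h"
  shows "tame U (\<lambda>T x. h n (f T x))"
  by (rule talg_tame[OF assms(1)], rule talg.comp[OF talg.base[OF assms(2)] assms(3,4)])

lemma tame_const: "tame U (\<lambda>T x. k)"
proof (rule tame_coinduct[where X = "range (\<lambda>k T x. k)"])
  show "(\<lambda>T x. k) \<in> range (\<lambda>k T x. k)" by blast
  fix g :: "real \<Rightarrow> 'a \<Rightarrow> real" assume "g \<in> range (\<lambda>k T x. k)"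
  then obtain k where g: "g = (\<lambda>T x. k)" by blast
  have "pbound U g" by (rule pboundI[where C = "\<bar>k\<bar>" and N = 0]) (simp add: g)
  then show "pbound U g \<and> (\<exists>G. (\<forall>v. G v \<in> range (\<lambda>k T x. k)) \<and>
      (\<forall>T\<ge>1. \<forall>x\<in>U. (g T has_derivative (\<lambda>v. G v T x)) (at x)))"
    by (intro conjI exI[of _ "\<lambda>v T x. 0"]) (auto simp: g)
qed

text \<open>Suits functions whose first derivative is already understood, such as linear maps, or
  \<open>ramp\<close> with derivative \<open>step\<close>.\<close>

lemma tame_of_derivative:
  assumes "pbound U f" "\<And>v. tame U (G v)" "open U"
    "\<And>T x. T \<ge> 1 \<Longrightarrow> x \<in> U \<Longrightarrow> (f T has_derivative (\<lambda>v. G v T x)) (at x)"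
  shows "tame U f"
proof (rule tame_coinduct[where X = "insert f (Collect (tame U))"])
  show "f \<in> insert f (Collect (tame U))" by blast
  fix g assume "g \<in> insert f (Collect (tame U))"
  then consider "g = f" | "tame U g" by blast
  then show "pbound U g \<and> (\<exists>G. (\<forall>v. G v \<in> insert f (Collect (tame U))) \<and>
      (\<forall>T\<ge>1. \<forall>x\<in>U. (g T has_derivative (\<lambda>v. G v T x)) (at x)))"
  proof cases
    case 1
    then show ?thesis using assms by (intro conjI exI[of _ G]) auto
  next
    case 2
    obtain H where "\<And>v. tame U (H v)"
      "\<And>T x. T \<ge> 1 \<Longrightarrow> x \<in> U \<Longrightarrow> (g T has_derivative (\<lambda>v. H v T x)) (at x)"
      using tame_derivative[OF 2 assms(3)] by metis
    then show ?thesis using tame_pbound[OF 2] by (intro conjI exI[of _ H]) auto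
  qed
qed

lemma tame_param: "open U \<Longrightarrow> tame U (\<lambda>T x. T)"
  by (rule tame_of_derivative[where G = "\<lambda>v T x. 0"])
     (auto intro!: tame_const pboundI[where C = 1 and N = 1])

lemma tame_linear:
  assumes "bounded_linear l" "open U"
  shows "tame U (\<lambda>T x. l x)"
proof (rule tame_of_derivative[where G = "\<lambda>v T x. l v"])
  obtain K where K: "\<And>x. norm (l x) \<le> norm x * K"
    using assms(1) bounded_linear.bounded by blast
  have "\<bar>l x\<bar> \<le> \<bar>K\<bar> * (T + norm x) ^ 1" if "T \<ge> 1" for T :: real and x
  proof -
    have "norm x * K \<le> norm x * \<bar>K\<bar>" by (intro mult_left_mono) auto
    also have "\<dots> \<le> \<bar>K\<bar> * (T + norm x)" using that by (simp add: algebra_simps)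
    finally show ?thesis using K[of x] by simp
  qed
  then show "pbound U (\<lambda>T. l)" by (intro pboundI)
qed (use assms in \<open>auto intro: tame_const bounded_linear_imp_has_derivative\<close>)

lemma tame_minus: "open U \<Longrightarrow> tame U f \<Longrightarrow> tame U g \<Longrightarrow> tame U (\<lambda>T x. f T x - g T x)"
  using tame_add[of U f "\<lambda>T x. -1 * g T x"] tame_mult[of U "\<lambda>T x. -1" g] tame_const[of U "-1"] by simp

section \<open>Maximum principle and pseudoconvexity\<close>

text \<open>This replaces plurisubharmonicity: touching from below by a pluriharmonic function is all the
  maximum principle needs, and it survives sums and convex monotone compositions without any
  Laplacian.\<close>
definition hol_support :: "(complex \<Rightarrow> real) \<Rightarrow> complex \<Rightarrow> bool" where
  "hol_support u z \<longleftrightarrow> (\<exists>s>0. \<exists>h. h holomorphic_on ball z s \<and> Re (h z) = u z \<and> (\<forall>w\<in>ball z s. Re (h w) \<le> u w))"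

lemma max_principle:
  fixes u :: "complex \<Rightarrow> real"
  assumes cont: "continuous_on (cball 0 1) u"
    and supp: "\<And>z. cmod z < 1 \<Longrightarrow> hol_support u z"
    and bd: "\<And>z. cmod z = 1 \<Longrightarrow> u z \<le> c"
  shows "u 0 \<le> c"
proof (rule ccontr)
  assume c: "\<not> u 0 \<le> c"
  txt \<open>Among the maximum points take one of largest modulus; near it u is again maximal.\<close>
  obtain m where m: "m \<in> cball 0 1" "\<And>z. z \<in> cball 0 1 \<Longrightarrow> u z \<le> u m"
    using continuous_attains_sup[OF compact_cball _ cont] by auto
  define K where "K = {z \<in> cball 0 1. u z = u m}"
  have "closedin (top_of_set (cball 0 1)) K"
    unfolding K_def using continuous_closedin_preimage_constant[OF cont] by simp
  then have "compact K" using closedin_compact compact_cball by blast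
  moreover have "K \<noteq> {}" using m K_def by auto
  moreover have "continuous_on K norm" by (intro continuous_intros)
  ultimately obtain z where z: "z \<in> K" "\<And>w. w \<in> K \<Longrightarrow> cmod w \<le> cmod z"
    using continuous_attains_sup[of K norm] by blast
  have uz: "u z = u m" "cmod z \<le> 1" using z(1) by (auto simp: K_def)
  have "u 0 \<le> u m" using m(2)[of 0] by simp
  then have "u z > c" using c uz(1) by simp
  then have z1: "cmod z < 1" using bd[of z] uz(2) by fastforce
  then obtain s h where s: "s > 0" and h: "h holomorphic_on ball z s" "Re (h z) = u z"
      "\<And>w. w \<in> ball z s \<Longrightarrow> Re (h w) \<le> u w"
    using supp unfolding hol_support_def by metis
  define r where "r = min s (1 - cmod z)"
  have r: "r > 0" "ball z r \<subseteq> ball z s" using s z1 by (auto simp: r_def)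
  have sub: "w \<in> cball 0 1" if "w \<in> ball z r" for w
  proof -
    have "cmod w \<le> cmod z + cmod (w - z)" by (metis add.commute diff_add_cancel norm_triangle_ineq)
    also have "cmod (w - z) < 1 - cmod z" using that by (simp add: r_def dist_norm norm_minus_commute)
    finally show ?thesis by simp
  qed
  \<comment> \<open>The modulus of \<open>exp (h w)\<close> is the exponential of
    \<open>Re (h w)\<close>, so a local maximum of the real part becomes a maximum of
    modulus.\<close>
  have "(\<lambda>w. exp (h w)) constant_on ball z r"
  proof (rule maximum_modulus_principle[where U = "ball z r" and \<xi> = z])
    show "(\<lambda>w. exp (h w)) holomorphic_on ball z r"
      using h(1) r(2) by (intro holomorphic_intros) (rule holomorphic_on_subset)
    fix w assume w: "w \<in> ball z r"
    have "Re (h w) \<le> Re (h z)" using h(2,3) m(2)[OF sub[OF w]] w r(2) uz(1) by force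
    then show "cmod (exp (h w)) \<le> cmod (exp (h z))" by simp
  qed (use r in auto)
  then obtain k where k: "\<And>w. w \<in> ball z r \<Longrightarrow> exp (h w) = k"
    unfolding constant_on_def by blast
  \<comment> \<open>The radial unit direction, with 1 as an arbitrary choice at the origin. Moving
    by r/2 along it yields a maximum point of larger modulus.\<close>
  define d where "d = (if z = 0 then 1 else z / of_real (cmod z))"
  have d: "cmod d = 1" by (simp add: d_def norm_divide)
  have zd: "z = of_real (cmod z) * d" by (simp add: d_def)
  define w where "w = z + of_real (r/2) * d"
  have w: "w \<in> ball z r" using r(1) d by (simp add: w_def dist_norm norm_mult)
  have "exp (h w) = exp (h z)" using k[OF w] k[of z] r(1) by simp
  then have "exp (Re (h w)) = exp (Re (h z))" by (metis norm_exp_eq_Re)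
  then have "u w \<ge> u m" using h(2,3) w r(2) uz(1) by force
  then have "w \<in> K" using m(2) sub[OF w] by (force simp: K_def)
  moreover have "cmod w > cmod z"
  proof -
    have "w = of_real (cmod z + r/2) * d" unfolding w_def by (subst zd) (simp add: algebra_simps)
    then have "cmod w = \<bar>cmod z + r/2\<bar>" using d by (simp only: norm_mult norm_of_real mult_1_right)
    then show ?thesis using r(1) by simp
  qed
  ultimately show False using z(2) by fastforce
qed

section \<open>Approximation on the unit circle by real parts of polynomials\<close>

inductive_set trig_sums :: "(complex \<Rightarrow> real) set" where
  monom: "(\<lambda>z. Re (c * z ^ n)) \<in> trig_sums"
| add: "f \<in> trig_sums \<Longrightarrow> g \<in> trig_sums \<Longrightarrow> (\<lambda>z. f z + g z) \<in> trig_sums"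

text \<open>On the circle \<open>cnj z\<close> is the inverse of \<open>z\<close>, so 2 Re a Re b =
  Re (a b) + Re (a cnj b) produces the exponents n + m and n - m; the assumption keeps the second
  one nonnegative.\<close>

lemma trig_sums_monom_mult:
  assumes "m \<le> n"
  shows "\<exists>h\<in>trig_sums. \<forall>z. cmod z = 1 \<longrightarrow> Re (c * z ^ n) * Re (d * z ^ m) = h z"
proof (intro bexI allI impI)
  fix z :: complex assume z: "cmod z = 1"
  have zz: "z * cnj z = 1" using z complex_norm_square[of z] by simp
  have *: "Re a * Re b = Re (a * b / 2) + Re (a * cnj b / 2)" for a b
    by (simp add: field_simps)
  have "z ^ n * cnj z ^ m = z ^ (n - m) * (z * cnj z) ^ m"
    using assms by (simp add: power_mult_distrib flip: power_add mult.assoc)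
  then have e: "c * z ^ n * cnj (d * z ^ m) = c * cnj d * z ^ (n - m)"
    using zz by (simp add: algebra_simps)
  show "Re (c * z ^ n) * Re (d * z ^ m) = Re ((c * d / 2) * z ^ (n + m)) + Re ((c * cnj d / 2) * z ^ (n - m))"
    by (subst *, subst e) (simp add: power_add algebra_simps)
qed (intro trig_sums.intros)

lemma trig_sums_mult:
  assumes "f \<in> trig_sums" "g \<in> trig_sums"
  shows "\<exists>h\<in>trig_sums. \<forall>z. cmod z = 1 \<longrightarrow> f z * g z = h z"
  using assms(1)
proof induction
  case (monom c n)
  show ?case using assms(2)
  proof induction
    case (monom d m)
    show ?case
      using trig_sums_monom_mult[of m n c d] trig_sums_monom_mult[of n m d c]
      by (cases "m \<le> n") (auto simp: mult.commute)
  next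
    case (add g1 g2)
    then obtain h1 h2 where "h1 \<in> trig_sums" "h2 \<in> trig_sums"
      "\<forall>z. cmod z = 1 \<longrightarrow> Re (c * z ^ n) * g1 z = h1 z" "\<forall>z. cmod z = 1 \<longrightarrow> Re (c * z ^ n) * g2 z = h2 z"
      by blast
    then show ?case
      by (intro bexI[of _ "\<lambda>z. h1 z + h2 z"]) (auto simp: distrib_left intro: trig_sums.add)
  qed
next
  case (add f1 f2)
  then obtain h1 h2 where "h1 \<in> trig_sums" "h2 \<in> trig_sums"
    "\<forall>z. cmod z = 1 \<longrightarrow> f1 z * g z = h1 z" "\<forall>z. cmod z = 1 \<longrightarrow> f2 z * g z = h2 z"
    by blast
  then show ?case
    by (intro bexI[of _ "\<lambda>z. h1 z + h2 z"]) (auto simp: distrib_right intro: trig_sums.add)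
qed

lemma trig_sums_holomorphic:
  "f \<in> trig_sums \<Longrightarrow> \<exists>p. p holomorphic_on UNIV \<and> (\<forall>z. f z = Re (p z))"
proof (induction rule: trig_sums.induct)
  case (monom c n)
  show ?case by (intro exI[of _ "\<lambda>z. c * z ^ n"] conjI holomorphic_intros) auto
next
  case (add f g)
  then obtain p q where "p holomorphic_on UNIV" "q holomorphic_on UNIV"
    "\<forall>z. f z = Re (p z)" "\<forall>z. g z = Re (q z)" by blast
  then show ?case by (intro exI[of _ "\<lambda>z. p z + q z"]) (auto intro: holomorphic_intros)
qed

lemma trig_sums_mean:
  "f \<in> trig_sums \<Longrightarrow> ((\<lambda>t. f (cis t)) has_integral 2 * pi * f 0) {0..2*pi}"
proof (induction rule: trig_sums.induct)
  case (monom c n)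
  show ?case
  proof (cases "n = 0")
    case True
    then show ?thesis using has_integral_const_real[of "Re c" 0 "2*pi"] by simp
  next
    case False
    define F where "F = (\<lambda>t::real. (Re c * sin (real n * t) + Im c * cos (real n * t)) / real n)"
    have "((\<lambda>t. Re (c * cis t ^ n)) has_integral (F (2*pi) - F 0)) {0..2*pi}"
    proof (rule fundamental_theorem_of_calculus)
      fix t :: real
      have "(F has_real_derivative Re (c * cis t ^ n)) (at t within {0..2*pi})"
        unfolding F_def using False
        by (auto intro!: derivative_eq_intros simp: Complex.DeMoivre field_simps)
      then show "(F has_vector_derivative Re (c * cis t ^ n)) (at t within {0..2*pi})"
        by (simp add: has_real_derivative_iff_has_vector_derivative)
    qed simp
    moreover have "F (2*pi) = F 0"
    proof -
      have "sin (real n * (2 * pi)) = 0" by (metis sin_2npi mult.assoc mult.commute)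
      moreover have "cos (real n * (2 * pi)) = 1" by (metis cos_2npi mult.assoc mult.commute)
      ultimately show ?thesis unfolding F_def by simp
    qed
    ultimately show ?thesis using False by (simp add: power_0_left)
  qed
next
  case (add f g)
  show ?case using has_integral_add[OF add.IH] by (simp add: distrib_left)
qed

text \<open>Stone-Weierstrass. Products of real parts of polynomials are again of this kind only on
  the circle, so the algebra \<open>R\<close> consists of functions that merely agree there with an
  element of \<open>trig_sums\<close>.\<close>

lemma circle_approx:
  fixes h :: "complex \<Rightarrow> real"
  assumes "continuous_on (sphere 0 1) h" "\<epsilon> > 0"
  obtains f where "f \<in> trig_sums" "\<And>z. cmod z = 1 \<Longrightarrow> \<bar>h z - f z\<bar> < \<epsilon>"
proof -
  define R where "R = {f. \<exists>g\<in>trig_sums. \<forall>z::complex. cmod z = 1 \<longrightarrow> f z = g z}"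
  have sub: "trig_sums \<subseteq> R" by (auto simp: R_def)
  interpret function_ring_on R "sphere 0 1"
  proof
    fix f assume "f \<in> R"
    then obtain g where g: "g \<in> trig_sums" "\<And>z. cmod z = 1 \<Longrightarrow> f z = g z" by (auto simp: R_def)
    then obtain p where p: "p holomorphic_on UNIV" "\<forall>z. g z = Re (p z)"
      using trig_sums_holomorphic by blast
    have "continuous_on (sphere 0 1) (\<lambda>z. Re (p z))"
      using holomorphic_on_imp_continuous_on[OF p(1)]
      by (intro continuous_intros) (rule continuous_on_subset, auto)
    then show "continuous_on (sphere 0 1) f"
      using g(2) p(2) by (subst continuous_on_cong[OF refl]) auto
  next
    fix f g assume "f \<in> R" "g \<in> R"
    then obtain f' g' where fg: "f' \<in> trig_sums" "g' \<in> trig_sums"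
      "\<And>z. cmod z = 1 \<Longrightarrow> f z = f' z" "\<And>z. cmod z = 1 \<Longrightarrow> g z = g' z" unfolding R_def by blast
    show "(\<lambda>x. f x + g x) \<in> R"
      unfolding R_def using fg by (auto intro!: bexI[of _ "\<lambda>x. f' x + g' x"] trig_sums.add)
    show "(\<lambda>x. f x * g x) \<in> R"
      unfolding R_def using trig_sums_mult[OF fg(1,2)] fg(3,4) by auto
  next
    show "(\<lambda>_. c) \<in> R" for c
      using trig_sums.monom[of "of_real c" 0] sub by auto
    fix x y :: complex assume "x \<noteq> y"
    then consider "Re x \<noteq> Re y" | "Im x \<noteq> Im y" using complex_eqI by blast
    then show "\<exists>f\<in>R. f x \<noteq> f y"
    proof cases
      case 1
      then show ?thesis using trig_sums.monom[of 1 1] sub by (intro bexI[of _ "\<lambda>z. Re (1 * z ^ 1)"]) auto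
    next
      case 2
      then show ?thesis using trig_sums.monom[of "\<i>" 1] sub by (intro bexI[of _ "\<lambda>z. Re (\<i> * z ^ 1)"]) auto
    qed
  qed simp
  obtain g where "g \<in> R" "\<And>z. z \<in> sphere 0 1 \<Longrightarrow> \<bar>h z - g z\<bar> < \<epsilon>"
    using Stone_Weierstrass_basic[OF assms] by blast
  then show thesis using that by (auto simp: R_def)
qed

lemma norm_smult_vec: "norm (c *s v) = cmod c * norm (v :: complex^'m)"
  by (simp add: norm_vec_def norm_mult L2_set_left_distrib[symmetric] L2_set_right_distrib)

text \<open>Discs defined on the whole plane are enough as test maps, since
  \<open>pseudoconvexI\<close> builds its discs from polynomials and exponentials.\<close>

definition hol_map :: "(complex \<Rightarrow> complex^'m) \<Rightarrow> bool" where
  "hol_map f \<longleftrightarrow> (\<forall>i. (\<lambda>z. f z $ i) holomorphic_on UNIV)"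

text \<open>The Kontinuitaetssatz with the discs \<open>a + z b + exp (- p z) v\<close>, where the real part of p
  approximates \<open>- ln bdist\<close> on the circle; bounding \<open>exp (- Re (p 0))\<close> by the distance at the
  centre is the mean value inequality.\<close>
lemma pseudoconvexI:
  fixes D :: "(complex^'m) set"
  assumes dom: "is_domain D" and nU: "D \<noteq> UNIV"
    and mp: "\<And>f. hol_map f \<Longrightarrow> (\<And>z. cmod z = 1 \<Longrightarrow> f z \<in> D) \<Longrightarrow> f 0 \<in> D"
  shows "pseudoconvex D"
  unfolding pseudoconvex_def
proof (intro conjI allI impI)
  show "is_domain D" by fact
  fix a b :: "complex^'m"
  assume disc: "\<forall>w. cmod w \<le> 1 \<longrightarrow> a + w *s b \<in> D"
  have opn: "open D" and ne: "- D \<noteq> {}" using dom nU by (auto simp: is_domain_def)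
  have pos: "bdist D z > 0" if "z \<in> D" for z
    using that opn ne in_closed_iff_infdist_zero[of "- D" z] infdist_nonneg[of z "- D"]
    unfolding bdist_def by (force simp: closed_Compl)
  define h where "h = (\<lambda>w. - ln (bdist D (a + w *s b)))"
  have cont_lin: "continuous_on S (\<lambda>w. a + w *s b)" for S
    unfolding vector_scalar_mult_def by (intro continuous_intros)
  have cont_h: "continuous_on (cball 0 1) h"
    unfolding h_def bdist_def
    using disc pos by (intro continuous_intros cont_lin) (force simp: bdist_def)
  have conth: "continuous_on {0..2*pi} (\<lambda>t. h (cis t))"
    by (rule continuous_on_compose2[OF cont_h]) (auto intro: continuous_intros)
  have inth: "(\<lambda>t. h (cis t)) integrable_on {0..2*pi}"
    by (rule integrable_continuous_real[OF conth])
  have "h 0 \<le> 1 / (2 * pi) * integral {0..2*pi} (\<lambda>t. h (cis t)) + e" if e: "e > 0" for e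
  proof -
    \<comment> \<open>The shift by e/2 makes the approximation one-sided: h < f < h + e on the
      circle.\<close>
    have "continuous_on (sphere 0 1) (\<lambda>z. h z + e/2)"
      by (intro continuous_intros continuous_on_subset[OF cont_h]) auto
    then obtain f where f: "f \<in> trig_sums" "\<And>z. cmod z = 1 \<Longrightarrow> \<bar>h z + e/2 - f z\<bar> < e/2"
      using circle_approx[of "\<lambda>z. h z + e/2" "e/2"] e by auto
    obtain p where p: "p holomorphic_on UNIV" "\<And>z. f z = Re (p z)"
      using trig_sums_holomorphic[OF f(1)] by blast
    have lower: "exp (- Re (p 0)) \<le> dist a y" if y: "y \<notin> D" for y
    proof (rule ccontr)
      assume "\<not> ?thesis"
      then have lt: "norm (y - a) < exp (- Re (p 0))" by (simp add: dist_norm norm_minus_commute)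
      \<comment> \<open>The factor \<open>exp (p 0)\<close> cancels at the centre, so the disc
        \<open>g\<close> passes through \<open>y\<close> there; \<open>lt\<close> says that
        \<open>v\<close> has norm at most 1, which keeps the boundary circle of \<open>g\<close> in
        \<open>D\<close>.\<close>
      define v where "v = exp (p 0) *s (y - a)"
      have "norm v = exp (Re (p 0)) * norm (y - a)"
        unfolding v_def by (simp only: norm_smult_vec norm_exp_eq_Re)
      also have "\<dots> \<le> exp (Re (p 0)) * exp (- Re (p 0))" using lt by (intro mult_left_mono) auto
      finally have v: "norm v \<le> 1" by (simp add: exp_minus)
      define g where "g = (\<lambda>z. a + z *s b + exp (- p z) *s v)"
      have "g 0 \<in> D"
      proof (rule mp)
        show "hol_map g" unfolding hol_map_def g_def using p(1)
          by (auto intro!: holomorphic_intros)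
        fix z :: complex assume z: "cmod z = 1"
        have zD: "a + z *s b \<in> D" using disc z by simp
        have "h z < f z" using f(2)[OF z] by linarith
        then have "exp (- f z) < exp (ln (bdist D (a + z *s b)))" by (simp add: h_def)
        then have lt: "exp (- f z) < bdist D (a + z *s b)" using pos[OF zD] by simp
        have "norm (exp (- p z) *s v) \<le> exp (- f z)"
          using v p(2)[of z] by (simp add: norm_smult_vec)
        with lt have lt': "norm (exp (- p z) *s v) < bdist D (a + z *s b)" by linarith
        show "g z \<in> D"
        proof (rule ccontr)
          assume "g z \<notin> D"
          then have "bdist D (a + z *s b) \<le> dist (a + z *s b) (g z)"
            unfolding bdist_def by (intro infdist_le) auto
          also have "\<dots> = norm (exp (- p z) *s v)" by (simp add: g_def dist_norm)
          finally show False using lt' by simp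
        qed
      qed
      moreover have "g 0 = y"
        by (simp add: g_def v_def vector_smult_assoc flip: exp_add)
      ultimately show False using y by simp
    qed
    have "exp (- Re (p 0)) \<le> bdist D a"
      unfolding bdist_def infdist_notempty[OF ne] using ne lower by (intro cINF_greatest) auto
    then have "- Re (p 0) \<le> ln (bdist D a)"
      using pos[of a] disc[rule_format, of 0] by (simp add: ln_ge_iff)
    then have "h 0 \<le> f 0" by (simp add: h_def p(2))
    also have "f 0 = 1 / (2 * pi) * integral {0..2*pi} (\<lambda>t. f (cis t))"
      using integral_unique[OF trig_sums_mean[OF f(1)]] by simp
    also have "\<dots> \<le> 1 / (2 * pi) * integral {0..2*pi} (\<lambda>t. h (cis t) + e)"
    proof (intro mult_left_mono integral_le)
      show "(\<lambda>t. f (cis t)) integrable_on {0..2*pi}"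
        using trig_sums_mean[OF f(1)] by blast
      show "(\<lambda>t. h (cis t) + e) integrable_on {0..2*pi}"
        by (intro integrable_add inth) auto
      show "f (cis t) \<le> h (cis t) + e" for t using f(2)[of "cis t"] by (simp add: abs_if split: if_splits)
    qed auto
    also have "\<dots> = 1 / (2 * pi) * integral {0..2*pi} (\<lambda>t. h (cis t)) + e"
      by (subst integral_add[OF inth]) (auto simp: field_simps)
    finally show ?thesis .
  qed
  then have "h 0 \<le> 1 / (2 * pi) * integral {0..2*pi} (\<lambda>t. h (cis t))"
    by (rule field_le_epsilon)
  then show "- ln (bdist D a) \<le> 1 / (2 * pi) * integral {0..2*pi} (\<lambda>t. - ln (bdist D (a + cis t *s b)))"
    by (simp add: h_def)
qed

section \<open>A smooth convex ramp\<close>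

text \<open>For the flat function \<open>exp (-1/x)\<close>, the n-th derivative is \<open>p (1/x) * exp (-1/x)\<close>
  with a polynomial p computed by this recursion.\<close>
primrec flat_poly :: "nat \<Rightarrow> real poly" where
  "flat_poly 0 = 1"
| "flat_poly (Suc n) = [:0, 0, 1:] * (flat_poly n - pderiv (flat_poly n))"

definition flat :: "nat \<Rightarrow> real \<Rightarrow> real" where
  "flat n x = (if x > 0 then poly (flat_poly n) (1 / x) * exp (- (1 / x)) else 0)"

lemma power_le_fact_exp:
  fixes y :: real
  assumes "y \<ge> 0"
  shows "y ^ n \<le> fact n * exp y"
proof -
  have "(\<Sum>k\<in>{n}. y ^ k /\<^sub>R fact k) \<le> (\<Sum>k. y ^ k /\<^sub>R fact k)"
    using assms by (intro sum_le_suminf summable_exp_generic) auto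
  then show ?thesis by (simp add: exp_def field_simps)
qed

lemma poly_exp_bounded: "\<exists>C. \<forall>y\<ge>0. \<bar>poly p y * exp (- y)\<bar> \<le> (C::real)"
proof (induction p)
  case 0
  then show ?case by (intro exI[of _ 0]) simp
next
  case (pCons a p)
  have mono: "\<exists>C. \<forall>y\<ge>0. \<bar>y ^ n * exp (- y)\<bar> \<le> (C::real)" for n
    using power_le_fact_exp[of _ n]
    by (intro exI[of _ "fact n"]) (simp add: exp_minus field_simps)
  obtain B where B: "\<And>n y. y \<ge> 0 \<Longrightarrow> \<bar>y ^ n * exp (- y)\<bar> \<le> (B n::real)"
    using mono by metis
  define q where "q = pCons a p"
  show ?case
  proof (intro exI allI impI)
    fix y :: real assume y: "y \<ge> 0"
    have "\<bar>poly q y * exp (- y)\<bar> = \<bar>\<Sum>i\<le>degree q. coeff q i * (y ^ i * exp (- y))\<bar>"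
      by (simp add: poly_altdef sum_distrib_right mult.assoc)
    also have "\<dots> \<le> (\<Sum>i\<le>degree q. \<bar>coeff q i * (y ^ i * exp (- y))\<bar>)" by (rule sum_abs)
    also have "\<dots> \<le> (\<Sum>i\<le>degree q. \<bar>coeff q i\<bar> * B i)"
      using B[OF y] by (intro sum_mono) (simp add: abs_mult mult_left_mono)
    finally show "\<bar>poly (pCons a p) y * exp (- y)\<bar> \<le> (\<Sum>i\<le>degree q. \<bar>coeff q i\<bar> * B i)"
      by (simp add: q_def)
  qed
qed

lemma flat_bounded: "\<exists>C. \<forall>x. \<bar>flat n x\<bar> \<le> C"
proof -
  obtain C where C: "\<forall>y\<ge>0. \<bar>poly (flat_poly n) y * exp (- y)\<bar> \<le> C"
    using poly_exp_bounded by blast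
  have "C \<ge> 0" using C[rule_format, of 0] by linarith
  then have "\<bar>flat n x\<bar> \<le> C" for x
    using C[rule_format, of "1/x"] by (simp add: flat_def)
  then show ?thesis by blast
qed

lemma flat_deriv: "(flat n has_real_derivative flat (Suc n) x) (at x)"
proof -
  consider "x > 0" | "x < 0" | "x = 0" by linarith
  then show ?thesis
  proof cases
    case 1
    have "((\<lambda>x. poly (flat_poly n) (1 / x) * exp (- (1 / x))) has_real_derivative flat (Suc n) x) (at x)"
      using 1 by (auto intro!: derivative_eq_intros simp: flat_def field_simps power2_eq_square)
    then show ?thesis
      by (rule DERIV_cong_ev[THEN iffD1, rotated 3])
         (use 1 eventually_nhds_in_open[of "{0<..}" x] in \<open>auto simp: flat_def elim: eventually_mono\<close>)
  next
    case 2
    have "((\<lambda>x. 0) has_real_derivative flat (Suc n) x) (at x)" using 2 by (simp add: flat_def)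
    then show ?thesis
      by (rule DERIV_cong_ev[THEN iffD1, rotated 3])
         (use 2 eventually_nhds_in_open[of "{..<0}" x] in \<open>auto simp: flat_def elim: eventually_mono\<close>)
  next
    case 3
    \<comment> \<open>Absorbing the factor 1/h^2 into the polynomial shows that
      \<open>flat n h\<close> is O(h^2), hence the derivative at 0 is 0.\<close>
    obtain C where C: "\<forall>y\<ge>0. \<bar>poly ([:0, 0, 1:] * flat_poly n) y * exp (- y)\<bar> \<le> C"
      using poly_exp_bounded by blast
    have C0: "C \<ge> 0" using C[rule_format, of 0] by linarith
    have bnd: "\<bar>flat n h\<bar> \<le> C * h^2" for h
    proof (cases "h > 0")
      case True
      then have "\<bar>(1/h)^2 * flat n h\<bar> \<le> C"
        using C[rule_format, of "1/h"] by (simp add: flat_def power2_eq_square mult.assoc)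
      then show ?thesis using True by (simp add: abs_mult field_simps)
    qed (use C0 in \<open>simp add: flat_def\<close>)
    have "((\<lambda>h. flat n h / h) \<longlongrightarrow> 0) (at 0)"
    proof (rule Lim_null_comparison)
      have "norm (flat n h / h) \<le> C * \<bar>h\<bar>" if "h \<noteq> 0" for h
        using bnd[of h] that by (simp add: field_simps power2_eq_square abs_if split: if_splits)
      then show "\<forall>\<^sub>F h in at 0. norm (flat n h / h) \<le> C * \<bar>h\<bar>"
        by (auto simp: eventually_at intro: exI[of _ 1])
      show "((\<lambda>h. C * \<bar>h\<bar>) \<longlongrightarrow> 0) (at 0)" by (auto intro!: tendsto_eq_intros)
    qed
    then show ?thesis using 3 by (simp add: DERIV_def flat_def)
  qed
qed

lemma nice_flat: "nice UNIV flat"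
  unfolding nice_def
proof (intro conjI allI ballI)
  show "\<exists>C N. \<forall>y\<in>UNIV. \<bar>flat n y\<bar> \<le> C * (1 + \<bar>y\<bar>) ^ N" for n
  proof -
    obtain C where "\<forall>x. \<bar>flat n x\<bar> \<le> C" using flat_bounded by blast
    then show ?thesis by (intro exI[of _ C] exI[of _ 0]) simp
  qed
qed (rule flat_deriv)

definition inv_deriv :: "nat \<Rightarrow> real \<Rightarrow> real" where
  "inv_deriv n y = (- 1) ^ n * fact n * inverse y ^ Suc n"

lemma nice_inv:
  assumes "c > 0"
  shows "nice {c<..} inv_deriv"
  unfolding nice_def
proof (intro conjI allI ballI)
  fix n and y :: real assume y: "y \<in> {c<..}"
  then have "y > 0" using assms by auto
  then show "(inv_deriv n has_real_derivative inv_deriv (Suc n) y) (at y)"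
    unfolding inv_deriv_def
    using DERIV_cmult[OF DERIV_power_Suc[OF DERIV_inverse[of y UNIV]], of "(- 1) ^ n * fact n" n]
    by (simp add: algebra_simps)
next
  fix n
  show "\<exists>C N. \<forall>y\<in>{c<..}. \<bar>inv_deriv n y\<bar> \<le> C * (1 + \<bar>y\<bar>) ^ N"
  proof (intro exI ballI)
    fix y :: real assume y: "y \<in> {c<..}"
    have "inverse y ^ Suc n \<le> inverse c ^ Suc n"
      using assms y by (intro power_mono) (auto intro: le_imp_inverse_le)
    then show "\<bar>inv_deriv n y\<bar> \<le> (fact n * inverse c ^ Suc n) * (1 + \<bar>y\<bar>) ^ 0"
      using assms y by (simp add: inv_deriv_def abs_mult)
  qed
qed

definition ln_deriv :: "nat \<Rightarrow> real \<Rightarrow> real" where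
  "ln_deriv n = (case n of 0 \<Rightarrow> ln | Suc k \<Rightarrow> inv_deriv k)"

lemma nice_ln: "nice {1<..} ln_deriv"
  unfolding nice_def
proof (intro conjI allI ballI)
  fix n and y :: real assume y: "y \<in> {1<..}"
  show "(ln_deriv n has_real_derivative ln_deriv (Suc n) y) (at y)"
    using y nice_inv[of 1] by (cases n)
      (auto simp: ln_deriv_def nice_def inv_deriv_def[of 0] inverse_eq_divide intro!: derivative_eq_intros)
next
  fix n
  show "\<exists>C N. \<forall>y\<in>{1<..}. \<bar>ln_deriv n y\<bar> \<le> C * (1 + \<bar>y\<bar>) ^ N"
  proof (cases n)
    case 0
    have "\<bar>ln_deriv n y\<bar> \<le> 1 * (1 + \<bar>y\<bar>) ^ 1" if "y > 1" for y
      using 0 ln_le_minus_one[of y] that by (simp add: ln_deriv_def)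
    then have "\<forall>y\<in>{1<..}. \<bar>ln_deriv n y\<bar> \<le> 1 * (1 + \<bar>y\<bar>) ^ 1" by auto
    then show ?thesis by blast
  next
    case (Suc k)
    then show ?thesis using nice_inv[of 1] by (auto simp: ln_deriv_def nice_def)
  qed
qed

text \<open>On the real line every direction is a multiple of 1, so lists of ones carry all the
  information. This makes \<open>ramp\<close> available as an outer function in
  \<open>tame_comp\<close>.\<close>

lemma tame_real_nice:
  fixes f :: "real \<Rightarrow> real"
  assumes "tame UNIV (\<lambda>T. f)"
  obtains h where "nice UNIV h" "h 0 = f"
proof -
  obtain F where F: "\<And>T x. T \<ge> 1 \<Longrightarrow> x \<in> UNIV \<Longrightarrow> F [] T x = f x"
     "\<And>vs T x. T \<ge> 1 \<Longrightarrow> x \<in> UNIV \<Longrightarrow> (F vs T has_derivative (\<lambda>v. F (v # vs) T x)) (at x)"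
     "\<And>vs. pbound UNIV (F vs)"
    using assms by (rule tameE) blast
  define h where "h = (\<lambda>n. F (replicate n 1) 1)"
  have "(h n has_real_derivative h (Suc n) x) (at x)" for n x
  proof -
    have d: "(h n has_derivative (\<lambda>v. F (v # replicate n 1) 1 x)) (at x)"
      using F(2)[of 1 x "replicate n 1"] by (simp add: h_def)
    then interpret bounded_linear "\<lambda>v. F (v # replicate n 1) 1 x" by (rule has_derivative_bounded_linear)
    have "(\<lambda>v. F (v # replicate n 1) 1 x) = (\<lambda>v. h (Suc n) x * v)"
    proof
      show "F (v # replicate n 1) 1 x = h (Suc n) x * v" for v
        using scaleR[of v 1] by (simp add: h_def mult.commute)
    qed
    with d show ?thesis by (simp add: has_field_derivative_def)
  qed
  moreover have "\<exists>C N. \<forall>y\<in>UNIV. \<bar>h n y\<bar> \<le> C * (1 + \<bar>y\<bar>) ^ N" for n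
  proof -
    obtain C N where "\<And>T x. T \<ge> 1 \<Longrightarrow> x \<in> UNIV \<Longrightarrow> \<bar>F (replicate n 1) T x\<bar> \<le> C * (T + norm x) ^ N"
      using F(3)[of "replicate n 1"] by (rule pboundE) blast
    from this[of 1] show ?thesis by (auto simp: h_def)
  qed
  ultimately have "nice UNIV h" by (auto simp: nice_def)
  moreover have "h 0 = f" using F(1)[of 1] by (auto simp: h_def)
  ultimately show thesis by (rule that)
qed

definition step :: "real \<Rightarrow> real" where
  "step x = flat 0 x * inverse (flat 0 x + flat 0 (1 - x))"

lemma flat_0_mono: "x \<le> y \<Longrightarrow> flat 0 x \<le> flat 0 y"
  by (auto simp: flat_def frac_le)

lemma flat_0_nonneg: "flat 0 x \<ge> 0"
  by (simp add: flat_def)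

text \<open>One of x and 1 - x is at least 1/2, and there \<open>flat 0\<close> is at least exp (-
  2). The smaller constant gives the strict inequality that the open half line in
  \<open>nice_inv\<close> asks for.\<close>

lemma step_denom: "flat 0 x + flat 0 (1 - x) > exp (- 3)"
proof -
  have *: "exp (-3) < flat 0 y" if "y \<ge> 1/2" for y
  proof -
    have "exp (-3::real) < flat 0 (1/2)" by (simp add: flat_def)
    also have "\<dots> \<le> flat 0 y" using that by (rule flat_0_mono)
    finally show ?thesis .
  qed
  have "x \<ge> 1/2 \<or> 1 - x \<ge> 1/2" by linarith
  then show ?thesis using *[of x] *[of "1 - x"] flat_0_nonneg[of x] flat_0_nonneg[of "1 - x"] by linarith
qed

lemma step_denom_pos: "flat 0 x + flat 0 (1 - x) > 0"
  using step_denom[of x] exp_gt_zero[of "-3::real"] by linarith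

lemma tame_step: "tame UNIV (\<lambda>T. step)"
proof -
  have 1: "tame UNIV (\<lambda>T x::real. flat 0 x)"
    by (rule tame_comp[where f = "\<lambda>T x. x", OF _ tame_linear _ nice_flat]) (auto simp: bounded_linear_ident)
  have 2: "tame UNIV (\<lambda>T x::real. flat 0 (1 - x))"
    by (rule tame_comp[where f = "\<lambda>T x. 1 - x", OF _ tame_minus[OF _ tame_const tame_linear] _ nice_flat])
       (auto simp: bounded_linear_ident)
  have 3: "tame UNIV (\<lambda>T x. inv_deriv 0 (flat 0 x + flat 0 (1 - x)))"
    by (rule tame_comp[OF _ tame_add[OF _ 1 2] _ nice_inv[of "exp (-3)"]]) (auto simp: step_denom)
  show ?thesis
    using tame_mult[OF _ 1 3] by (simp add: step_def[abs_def] inv_deriv_def)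
qed

lemma step_nonpos: "x \<le> 0 \<Longrightarrow> step x = 0"
  by (simp add: step_def flat_def)

lemma step_ge_1: "x \<ge> 1 \<Longrightarrow> step x = 1"
  by (simp add: step_def flat_def)

lemma step_bounds: "0 \<le> step x" "step x \<le> 1"
  using step_denom_pos[of x] flat_0_nonneg[of x] flat_0_nonneg[of "1 - x"]
  by (auto simp: step_def field_simps)

lemma step_mono: "x \<le> y \<Longrightarrow> step x \<le> step y"
proof -
  assume "x \<le> y"
  then have "flat 0 x * flat 0 (1 - y) \<le> flat 0 y * flat 0 (1 - x)"
    by (intro mult_mono flat_0_mono flat_0_nonneg) auto
  then show ?thesis
    using step_denom_pos[of x] step_denom_pos[of y] by (simp add: step_def field_simps)
qed

text \<open>As \<open>step\<close> vanishes on the negative axis, any negative lower limit gives the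
  same function; below -1 the interval is empty and the integral is 0, as it should be.\<close>

definition ramp :: "real \<Rightarrow> real" where
  "ramp x = integral {-1..x} step"

text \<open>The constant by which the ramp stays behind the identity beyond 1.\<close>

definition ramp_shift :: real where
  "ramp_shift = 1 - ramp 1"

lemma continuous_on_step: "continuous_on S step"
proof -
  obtain G where "\<And>v. tame UNIV (G v)"
      "\<And>T x. T \<ge> 1 \<Longrightarrow> x \<in> UNIV \<Longrightarrow> (step has_derivative (\<lambda>v. G v T x)) (at x)"
    by (rule tame_derivative[OF tame_step open_UNIV]) blast
  then have "(step has_derivative (\<lambda>v. G v 1 x)) (at x)" for x by simp
  then show ?thesis
    by (intro continuous_at_imp_continuous_on ballI has_derivative_continuous)
qed

lemma ramp_nonpos: "x \<le> 0 \<Longrightarrow> ramp x = 0"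
  unfolding ramp_def
  using integral_cong[of "{-1..x}" step "\<lambda>_. 0"] by (simp add: step_nonpos)

lemma ramp_deriv: "(ramp has_real_derivative step x) (at x)"
proof (cases "x < 0")
  case True
  have "((\<lambda>x. 0) has_real_derivative step x) (at x)" using True by (simp add: step_nonpos)
  then show ?thesis
    by (rule DERIV_cong_ev[THEN iffD1, rotated 3])
       (use True eventually_nhds_in_open[of "{..<0}" x] in \<open>auto simp: ramp_nonpos elim: eventually_mono\<close>)
next
  case False
  have "((\<lambda>u. integral {-1..u} step) has_real_derivative step x) (at x within {-1..x+1})"
    using False by (intro integral_has_real_derivative continuous_on_step) auto
  then have "(ramp has_real_derivative step x) (at x within {-1..x+1})"
    by (simp add: ramp_def[abs_def])
  then have "(ramp has_real_derivative step x) (at x within {-1<..<x+1})"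
    by (rule DERIV_subset) auto
  then show ?thesis using False by (subst (asm) at_within_open) auto
qed

text \<open>Convexity as the existence of supporting lines, from the monotonicity of the derivative
  \<open>step\<close>. In this form it turns minorants of \<open>u\<close> into minorants of
  \<open>ramp (u w)\<close>.\<close>

lemma ramp_tangent: "ramp y \<ge> ramp x + step x * (y - x)"
proof -
  consider "x < y" | "x = y" | "y < x" by linarith
  then show ?thesis
  proof cases
    case 1
    obtain z where "x < z" "z < y" "ramp y - ramp x = (y - x) * step z"
      using MVT2[OF 1, of ramp step] ramp_deriv by blast
    moreover have "(y - x) * step x \<le> (y - x) * step z"
      using step_mono[of x z] 1 \<open>x < z\<close> by (intro mult_left_mono) auto
    ultimately show ?thesis by (simp add: algebra_simps)
  next
    case 3
    obtain z where "y < z" "z < x" "ramp x - ramp y = (x - y) * step z"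
      using MVT2[OF 3, of ramp step] ramp_deriv by blast
    moreover have "(x - y) * step z \<le> (x - y) * step x"
      using step_mono[of z x] 3 \<open>z < x\<close> by (intro mult_left_mono) auto
    ultimately show ?thesis by (simp add: algebra_simps)
  qed simp
qed

lemma ramp_nonneg: "ramp x \<ge> 0"
proof (cases "x \<le> 0")
  case False
  then show ?thesis using ramp_tangent[of 0 x] by (simp add: ramp_nonpos step_nonpos)
qed (simp add: ramp_nonpos)

lemma ramp_le: "ramp x \<le> max 0 x"
proof (cases "x \<le> 0")
  case False
  then have "step x * x \<le> 1 * x" using step_bounds(2) by (intro mult_right_mono) auto
  moreover have "ramp x \<le> step x * x" using ramp_tangent[of x 0] by (simp add: ramp_nonpos)
  ultimately show ?thesis by linarith
qed (simp add: ramp_nonpos)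

lemma ramp_ge_1: "x \<ge> 1 \<Longrightarrow> ramp x = x - ramp_shift"
  using ramp_tangent[of x 1] ramp_tangent[of 1 x] by (simp add: step_ge_1 ramp_shift_def)

lemma ramp_shift_bounds: "0 \<le> ramp_shift" "ramp_shift \<le> 1"
  using ramp_le[of 1] ramp_nonneg[of 1] by (auto simp: ramp_shift_def)

lemma ramp_ge: "ramp x \<ge> x - 1"
  using ramp_tangent[of 1 x] ramp_nonneg[of 1] by (simp add: step_ge_1)

lemma nice_ramp:
  obtains h where "nice UNIV h" "h 0 = ramp"
proof -
  have "tame UNIV (\<lambda>T. ramp)"
  proof (rule tame_of_derivative[where G = "\<lambda>v T x. step x * v"])
    have "\<bar>ramp x\<bar> \<le> 1 * (T + norm x) ^ 1" if "T \<ge> 1" for T x :: real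
      using ramp_le[of x] ramp_nonneg[of x] that by auto
    then show "pbound UNIV (\<lambda>T. ramp)" by (intro pboundI)
    show "(ramp has_derivative (\<lambda>v. step x * v)) (at x)" for x
      using ramp_deriv[of x] by (simp add: has_field_derivative_def)
    show "tame UNIV (\<lambda>T x. step x * v)" for v
      by (rule tame_mult[OF _ tame_step tame_const]) simp
  qed auto
  then show thesis using tame_real_nice that by metis
qed

lemma tame_ramp:
  assumes "open U" "tame U f"
  shows "tame U (\<lambda>T x. ramp (f T x))"
proof -
  obtain h where "nice UNIV h" "h 0 = ramp" by (rule nice_ramp)
  then show ?thesis using tame_comp[OF assms, of UNIV h 0] by simp
qed

section \<open>A function along the cusp\<close>

lemma hol_support_cong:
  assumes "hol_support u z" "s > 0" "\<And>w. w \<in> ball z s \<Longrightarrow> u w = v w"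
  shows "hol_support v z"
proof -
  obtain r h where h: "r > 0" "h holomorphic_on ball z r" "Re (h z) = u z"
     "\<And>w. w \<in> ball z r \<Longrightarrow> Re (h w) \<le> u w"
    using assms(1) unfolding hol_support_def by metis
  show ?thesis unfolding hol_support_def
  proof (intro exI[of _ "min r s"] exI[of _ h] conjI ballI)
    show "h holomorphic_on ball z (min r s)" using h(2) by (rule holomorphic_on_subset) auto
    fix w assume "w \<in> ball z (min r s)"
    then show "Re (h w) \<le> v w" using h(4)[of w] assms(3)[of w] by simp
  next
    show "Re (h z) = v z" using h(3) assms(2,3) by simp
  qed (use h assms(2) in auto)
qed

lemma hol_support_Re:
  assumes "p holomorphic_on ball z s" "s > 0"
  shows "hol_support (\<lambda>w. Re (p w)) z"
  using assms unfolding hol_support_def by blast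

text \<open>It suffices that \<open>f\<close> lies above a nonnegative combination of
  \<open>u\<close> and \<open>v\<close> and touches it at \<open>z\<close>. With supporting lines as
  the combination, this yields all the convex compositions below.\<close>

lemma hol_support_minorant:
  assumes "hol_support u z" "hol_support v z" "a \<ge> 0" "b \<ge> 0"
    and "f z = a * u z + b * v z + c"
    and "\<And>w. f w \<ge> a * u w + b * v w + c"
  shows "hol_support f z"
proof -
  obtain r h where h: "r > 0" "h holomorphic_on ball z r" "Re (h z) = u z"
     "\<And>w. w \<in> ball z r \<Longrightarrow> Re (h w) \<le> u w"
    using assms(1) unfolding hol_support_def by metis
  obtain s k where k: "s > 0" "k holomorphic_on ball z s" "Re (k z) = v z"
     "\<And>w. w \<in> ball z s \<Longrightarrow> Re (k w) \<le> v w"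
    using assms(2) unfolding hol_support_def by metis
  show ?thesis unfolding hol_support_def
  proof (intro exI[of _ "min r s"] exI[of _ "\<lambda>w. of_real a * h w + of_real b * k w + of_real c"] conjI ballI)
    have "h holomorphic_on ball z (min r s)" "k holomorphic_on ball z (min r s)"
      by (rule holomorphic_on_subset[OF h(2)] holomorphic_on_subset[OF k(2)], force)+
    then show "(\<lambda>w. of_real a * h w + of_real b * k w + of_real c) holomorphic_on ball z (min r s)"
      by (intro holomorphic_intros)
    fix w assume w: "w \<in> ball z (min r s)"
    have "a * Re (h w) + b * Re (k w) + c \<le> a * u w + b * v w + c"
      using w h(4)[of w] k(4)[of w] assms(3,4) by (intro add_mono mult_left_mono) auto
    then show "Re (of_real a * h w + of_real b * k w + of_real c) \<le> f w"
      using assms(6)[of w] by simp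
  qed (use h k assms in auto)
qed

lemma hol_support_add:
  "hol_support u z \<Longrightarrow> hol_support v z \<Longrightarrow> hol_support (\<lambda>w. u w + v w) z"
  by (rule hol_support_minorant[where a = 1 and b = 1 and c = 0 and u = u and v = v]) auto

lemma hol_support_affine:
  "hol_support u z \<Longrightarrow> a \<ge> 0 \<Longrightarrow> hol_support (\<lambda>w. a * u w + c) z"
  by (rule hol_support_minorant[where a = a and b = 0 and c = c and u = u and v = u]) auto

lemma hol_support_const: "hol_support (\<lambda>w. c) z"
  using hol_support_Re[of "\<lambda>w. of_real c" z 1] by simp

lemma hol_support_sum:
  assumes "finite I" "\<And>i. i \<in> I \<Longrightarrow> hol_support (u i) z"
  shows "hol_support (\<lambda>w. \<Sum>i\<in>I. u i w) z"
  using assms by (induction I) (auto intro: hol_support_const hol_support_add)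

lemma hol_support_ramp:
  assumes "hol_support u z"
  shows "hol_support (\<lambda>w. ramp (u w)) z"
proof (rule hol_support_minorant[OF assms assms, of "step (u z)" 0 _ "ramp (u z) - step (u z) * u z"])
  show "step (u z) * u w + 0 * u w + (ramp (u z) - step (u z) * u z) \<le> ramp (u w)" for w
    using ramp_tangent[of "u z" "u w"] by (simp add: algebra_simps)
qed (auto simp: step_bounds)

text \<open>\<open>u + ramp (v - u)\<close> is a smooth version of the maximum of u and v.\<close>
lemma hol_support_ramp_join:
  assumes "hol_support u z" "hol_support v z"
  shows "hol_support (\<lambda>w. u w + ramp (v w - u w)) z"
proof -
  define d where "d = v z - u z"
  show ?thesis
  proof (rule hol_support_minorant[OF assms, of "1 - step d" "step d" _ "ramp d - step d * d"])
    show "(1 - step d) * u w + step d * v w + (ramp d - step d * d) \<le> u w + ramp (v w - u w)" for w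
      using ramp_tangent[of d "v w - u w"] by (simp add: algebra_simps)
  qed (auto simp: step_bounds d_def algebra_simps)
qed

text \<open>Expanding |p w - p z|^2 >= 0 gives a minorant that is the real part of an affine
  function of \<open>p w\<close>.\<close>

lemma hol_support_norm_sq:
  assumes "p holomorphic_on ball z s" "s > 0"
  shows "hol_support (\<lambda>w. (cmod (p w))\<^sup>2) z"
proof -
  have 1: "hol_support (\<lambda>w. Re (2 * cnj (p z) * p w)) z"
    using assms by (intro hol_support_Re[of _ _ s] holomorphic_intros) auto
  show ?thesis
  proof (rule hol_support_minorant[OF 1 1, of 1 0 _ "- (cmod (p z))\<^sup>2"])
    show "1 * Re (2 * cnj (p z) * p w) + 0 * Re (2 * cnj (p z) * p w) + - (cmod (p z))\<^sup>2 \<le> (cmod (p w))\<^sup>2" for w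
    proof -
      have "0 \<le> (cmod (p w - p z))\<^sup>2" by simp
      then show ?thesis by (simp add: cmod_power2 power2_diff algebra_simps)
    qed
    show "(cmod (p z))\<^sup>2 = 1 * Re (2 * cnj (p z) * p z) + 0 * Re (2 * cnj (p z) * p z) + - (cmod (p z))\<^sup>2"
      unfolding cmod_power2 by (simp add: power2_eq_square)
  qed auto
qed

text \<open>Dividing by \<open>p z\<close> moves the values near 1, where the principal branch
  \<open>Ln\<close> is holomorphic; the function is then locally the real part of a holomorphic
  one.\<close>

lemma hol_support_ln_norm:
  assumes p: "p holomorphic_on ball z s" and s: "s > 0" and nz: "p z \<noteq> 0"
  shows "hol_support (\<lambda>w. ln (cmod (p w))) z"
proof -
  define g where "g = (\<lambda>w. p w / p z)"
  have g: "g holomorphic_on ball z s" unfolding g_def using p nz by (intro holomorphic_intros) auto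
  have "isCont g z"
    using holomorphic_on_imp_continuous_on[OF g] s by (simp add: continuous_on_eq_continuous_at)
  moreover have "g z = 1" using nz by (simp add: g_def)
  ultimately obtain r where r: "r > 0" "\<And>w. dist w z < r \<Longrightarrow> dist (g w) 1 < 1"
    unfolding continuous_at_eps_delta by (metis zero_less_one)
  define m where "m = min r s"
  have m: "m > 0" using r s by (simp add: m_def)
  have g1: "cmod (1 - g w) < 1" if "w \<in> ball z m" for w
    using r(2)[of w] that by (simp add: m_def dist_norm norm_minus_commute)
  have gn: "g w \<notin> \<real>\<^sub>\<le>\<^sub>0" if "w \<in> ball z m" for w
  proof
    assume "g w \<in> \<real>\<^sub>\<le>\<^sub>0"
    then have "Re (g w) \<le> 0" by (auto simp: complex_nonpos_Reals_iff)
    moreover have "\<bar>Re (1 - g w)\<bar> < 1" using g1[OF that] abs_Re_le_cmod[of "1 - g w"] by linarith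
    ultimately show False by simp
  qed
  have "(\<lambda>w. Ln (g w) + of_real (ln (cmod (p z)))) holomorphic_on ball z m"
    using gn by (intro holomorphic_intros holomorphic_on_subset[OF g]) (auto simp: m_def)
  then have "hol_support (\<lambda>w. Re (Ln (g w) + of_real (ln (cmod (p z))))) z"
    using m by (rule hol_support_Re)
  then show ?thesis
  proof (rule hol_support_cong[OF _ m])
    fix w assume "w \<in> ball z m"
    then have "g w \<noteq> 0" using gn by force
    then show "Re (Ln (g w) + of_real (ln (cmod (p z)))) = ln (cmod (p w))"
      using nz by (simp add: g_def norm_divide ln_div)
  qed
qed

section \<open>The plurisubharmonic function attached to the cusp\<close>

definition cusp_poly :: "complex^3 \<Rightarrow> complex" where
  "cusp_poly x = (x $ 3)\<^sup>2 - (x $ 2) ^ 3"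

text \<open>The factor 6 is dictated by the region off the cusp: if |\<open>cusp_poly\<close>| >= 2
  r^3 with r > 1, the penalty is at least 6 (4 r^6 - 1) >= 18 r^6, while the curve part is at most
  16 r^6 there.\<close>

definition penalty :: "real \<Rightarrow> complex^3 \<Rightarrow> real" where
  "penalty T x = 6 * T * ((cmod (cusp_poly x))\<^sup>2 - 1)"

text \<open>The divisor 4 places the zero of the logarithm between 2 and 8. The coefficient is
  chosen so that 27 ln 2 >= 18 beats |Re s| <= 16 by more than 1.\<close>

definition ell :: "complex^3 \<Rightarrow> real" where
  "ell x = - Re (x $ 3 / x $ 2) + 27 * ln (cmod (x $ 3 / x $ 2) / 4)"

text \<open>The quotient x3/x2 is used only in a neighbourhood of the cusp that excludes 0. At the edge of
  that neighbourhood either the penalty exceeds the curve part by 1 or the curve part is 0, so that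
  the smooth maximum does not see where the curve part is switched off.\<close>
definition near_zone :: "(complex^3) set" where
  "near_zone = {x. 1/2 < cmod (x $ 2) \<and> (cmod (x $ 3))\<^sup>2 < 4 * cmod (x $ 2) ^ 3 \<and>
     cmod (x $ 2) < cmod (x $ 3) \<and> cmod (x $ 3) < 16 * cmod (x $ 2)}"

definition far_zone :: "(complex^3) set" where
  "far_zone = {x. 1/2 < cmod (x $ 2) \<and> (cmod (x $ 3))\<^sup>2 < 4 * cmod (x $ 2) ^ 3 \<and>
     8 * cmod (x $ 2) < cmod (x $ 3)}"

definition off_zone :: "(complex^3) set" where
  "off_zone = {x. 3 * cmod (x $ 2) ^ 3 < (cmod (x $ 3))\<^sup>2} \<union> {x. cmod (x $ 2) < 1} \<union>
     {x. cmod (x $ 3) < 2 * cmod (x $ 2)}"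

text \<open>A maximum with 0 at every s would lose the negative values needed for large Re s. It is
  taken only for |s| < 16; for 8 < |s| < 16 \<open>ell\<close> is at least 1, so
  \<open>ramp (ell x)\<close> is \<open>ell x - ramp_shift\<close> and the two formulas
  agree.\<close>

definition curve_part :: "complex^3 \<Rightarrow> real" where
  "curve_part x = (if x \<in> far_zone then ell x - ramp_shift
     else if x \<in> near_zone then ramp (ell x) else 0)"

definition cusp_fun :: "real \<Rightarrow> complex^3 \<Rightarrow> real" where
  "cusp_fun T x = curve_part x + ramp (penalty T x - curve_part x)"

lemma open_zones: "open near_zone" "open far_zone" "open off_zone"
  unfolding near_zone_def far_zone_def off_zone_def
  by (intro open_Un open_Collect_conj open_Collect_less continuous_intros)+

lemma zones_cover: "near_zone \<union> far_zone \<union> off_zone = UNIV"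
proof -
  have "x \<in> near_zone \<or> x \<in> far_zone" if "x \<notin> off_zone" for x :: "complex^3"
  proof -
    have 1: "(cmod (x $ 3))\<^sup>2 \<le> 3 * cmod (x $ 2) ^ 3" "1 \<le> cmod (x $ 2)" "2 * cmod (x $ 2) \<le> cmod (x $ 3)"
      using that by (auto simp: off_zone_def)
    have "cmod (x $ 2) ^ 3 > 0" using 1(2) by (intro zero_less_power) linarith
    then have "(cmod (x $ 3))\<^sup>2 < 4 * cmod (x $ 2) ^ 3" "cmod (x $ 2) < cmod (x $ 3)"
      "1/2 < cmod (x $ 2)" "8 * cmod (x $ 2) < cmod (x $ 3) \<or> cmod (x $ 3) < 16 * cmod (x $ 2)"
      using 1 by linarith+
    then show ?thesis by (auto simp: near_zone_def far_zone_def)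
  qed
  then show ?thesis by blast
qed

lemma ell_le_0:
  assumes "x $ 2 \<noteq> 0" "cmod (x $ 2) < cmod (x $ 3)" "cmod (x $ 3) \<le> 2 * cmod (x $ 2)"
  shows "ell x \<le> 0"
proof -
  have t: "cmod (x $ 3 / x $ 2) \<le> 2" "1 < cmod (x $ 3 / x $ 2)"
    using assms by (auto simp: norm_divide field_simps)
  have "ln (cmod (x $ 3 / x $ 2) / 4) \<le> ln (1/2)" using t by (subst ln_le_cancel_iff) auto
  also have "\<dots> \<le> - 2/3" using ln2_ge_two_thirds by (simp add: ln_div)
  finally show ?thesis
    using t(1) abs_Re_le_cmod[of "x $ 3 / x $ 2"] by (simp add: ell_def)
qed

lemma ell_ge_1:
  assumes "x $ 2 \<noteq> 0" "8 * cmod (x $ 2) < cmod (x $ 3)" "cmod (x $ 3) < 16 * cmod (x $ 2)"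
  shows "ell x \<ge> 1"
proof -
  have t: "8 < cmod (x $ 3 / x $ 2)" "cmod (x $ 3 / x $ 2) < 16"
    using assms by (auto simp: norm_divide field_simps)
  have "ln 2 \<le> ln (cmod (x $ 3 / x $ 2) / 4)" using t by (subst ln_le_cancel_iff) auto
  then have "2/3 \<le> ln (cmod (x $ 3 / x $ 2) / 4)" using ln2_ge_two_thirds by linarith
  then show ?thesis
    using t(2) abs_Re_le_cmod[of "x $ 3 / x $ 2"] by (simp add: ell_def)
qed

lemma curve_part_near:
  assumes "x \<in> near_zone"
  shows "curve_part x = ramp (ell x)"
proof (cases "x \<in> far_zone")
  case True
  then have "ell x \<ge> 1" using assms by (intro ell_ge_1) (auto simp: near_zone_def far_zone_def)
  then show ?thesis using True by (simp add: curve_part_def ramp_ge_1)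
qed (use assms in \<open>simp add: curve_part_def\<close>)

text \<open>For |s| <= 2 the curve part is 0. Otherwise \<open>off_zone\<close> keeps the point at a
  distance from the cusp, and the penalty, of order |x2|^6, exceeds the curve part, which is linear
  in |s| and hence in |x2|.\<close>

lemma cusp_fun_off:
  assumes "x \<in> off_zone" "T \<ge> 1"
  shows "cusp_fun T x = ramp (penalty T x)"
proof (cases "x \<in> near_zone \<or> x \<in> far_zone")
  case False
  then show ?thesis by (simp add: cusp_fun_def curve_part_def)
next
  case True
  have x: "1/2 < cmod (x $ 2)" "(cmod (x $ 3))\<^sup>2 < 4 * cmod (x $ 2) ^ 3" "cmod (x $ 2) < cmod (x $ 3)"
    using True by (auto simp: near_zone_def far_zone_def)
  have x0: "x $ 2 \<noteq> 0" using x(1) by auto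
  show ?thesis
  proof (cases "cmod (x $ 3) \<le> 2 * cmod (x $ 2)")
    case True
    then have "x \<notin> far_zone" by (auto simp: far_zone_def)
    moreover have "ell x \<le> 0" using x0 x(3) True by (rule ell_le_0)
    ultimately have "curve_part x = 0" by (simp add: curve_part_def ramp_nonpos)
    then show ?thesis by (simp add: cusp_fun_def)
  next
    case False
    define r where "r = cmod (x $ 2)"
    \<comment> \<open>From |s| > 2 and |s|^2 < 4 r follows r > 1, so of the three parts of
      \<open>off_zone\<close> only 3 |x2|^3 < |x3|^2 is left.\<close>
    have "(2 * r) ^ 2 < (cmod (x $ 3))\<^sup>2" using False by (intro power_strict_mono) (auto simp: r_def)
    then have "4 * r ^ 2 < 4 * r ^ 3" using x(2) by (simp add: r_def power_mult_distrib)
    then have r1: "r > 1"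
      using x(1) power_decreasing[of 2 3 r] by (force simp: r_def)
    then have "3 * r ^ 3 < (cmod (x $ 3))\<^sup>2"
      using assms(1) False by (auto simp: off_zone_def r_def)
    moreover have "(cmod (x $ 3))\<^sup>2 \<le> cmod (cusp_poly x) + r ^ 3"
      using norm_triangle_ineq[of "cusp_poly x" "(x $ 2) ^ 3"] by (simp add: cusp_poly_def r_def norm_power)
    ultimately have q: "2 * r ^ 3 \<le> cmod (cusp_poly x)" by linarith
    then have "(2 * r ^ 3) ^ 2 \<le> (cmod (cusp_poly x))\<^sup>2" using r1 by (intro power_mono) auto
    then have q2: "4 * r ^ 6 \<le> (cmod (cusp_poly x))\<^sup>2"
      by (simp add: power_mult_distrib flip: power_mult)
    define t where "t = cmod (x $ 3 / x $ 2)"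
    have tr: "t * r = cmod (x $ 3)" using x0 by (simp add: t_def r_def norm_divide)
    have "2 * r < t * r" using False tr by (simp add: r_def)
    then have t2: "t > 2" using r1 by (simp add: mult_less_cancel_right)
    have "(t * r)\<^sup>2 < 4 * r ^ 3" using tr x(2) by (simp add: r_def)
    then have "t\<^sup>2 * r\<^sup>2 < (4 * r) * r\<^sup>2"
      by (simp only: power_mult_distrib) (simp add: power2_eq_square power3_eq_cube)
    then have "t\<^sup>2 < 4 * r" using r1 by (simp add: mult_less_cancel_right)
    moreover have "t * 2 \<le> t * t" using t2 by (intro mult_left_mono) auto
    ultimately have t4: "t < 2 * r" by (simp add: power2_eq_square)
    have "ln (t / 4) \<le> t / 4 - 1" using t2 by (intro ln_le_minus_one) auto
    then have "ell x \<le> 8 * t"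
      using abs_Re_le_cmod[of "x $ 3 / x $ 2"] by (simp add: ell_def t_def)
    moreover have "t < 2 * r ^ 6"
    proof -
      have "r ^ 1 \<le> r ^ 6" using r1 by (intro power_increasing) auto
      with t4 show ?thesis by simp
    qed
    ultimately have e: "max 0 (ell x) \<le> 16 * r ^ 6" using r1 by auto
    have c: "curve_part x \<le> max 0 (ell x)"
      using ramp_shift_bounds ramp_le[of "ell x"] by (auto simp: curve_part_def)
    have r6: "1 \<le> r ^ 6" using r1 by simp
    show ?thesis
    proof -
      have "6 * T * (4 * r ^ 6 - 1) \<le> penalty T x"
        unfolding penalty_def using q2 assms(2) by (intro mult_left_mono) auto
      moreover have "6 * 1 * (4 * r ^ 6 - 1) \<le> 6 * T * (4 * r ^ 6 - 1)"
        using r6 assms(2) by (intro mult_right_mono) auto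
      ultimately have "6 * 1 * (4 * r ^ 6 - 1) \<le> penalty T x" by (rule order_trans[rotated])
      then have "18 * r ^ 6 \<le> penalty T x" using r6 by argo
      \<comment> \<open>Both ramps are evaluated beyond 1, so both sides are
        \<open>penalty T x - ramp_shift\<close>.\<close>
      then have "1 \<le> penalty T x" "1 \<le> penalty T x - curve_part x" using c e r6 by linarith+
      then show ?thesis by (simp add: cusp_fun_def ramp_ge_1)
    qed
  qed
qed

definition ctame :: "'a::euclidean_space set \<Rightarrow> ('a \<Rightarrow> complex) \<Rightarrow> bool" where
  "ctame U f \<longleftrightarrow> tame U (\<lambda>T x. Re (f x)) \<and> tame U (\<lambda>T x. Im (f x))"

lemma ctame_component: "open U \<Longrightarrow> ctame U (\<lambda>x::complex^3. x $ i)"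
  unfolding ctame_def
  by (auto intro!: tame_linear bounded_linear_compose[OF bounded_linear_Re] bounded_linear_compose[OF bounded_linear_Im]
      bounded_linear_vec_nth)

lemma ctame_mult: "open U \<Longrightarrow> ctame U f \<Longrightarrow> ctame U g \<Longrightarrow> ctame U (\<lambda>x. f x * g x)"
  unfolding ctame_def by (auto intro!: tame_add tame_minus tame_mult)

lemma ctame_diff: "open U \<Longrightarrow> ctame U f \<Longrightarrow> ctame U g \<Longrightarrow> ctame U (\<lambda>x. f x - g x)"
  unfolding ctame_def by (auto intro!: tame_minus)

lemma tame_norm_sq:
  assumes "open U" "ctame U f"
  shows "tame U (\<lambda>T x. (cmod (f x))\<^sup>2)"
proof -
  have "tame U (\<lambda>T x. Re (f x) * Re (f x) + Im (f x) * Im (f x))"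
    using assms unfolding ctame_def by (intro tame_add tame_mult) auto
  then show ?thesis by (simp add: cmod_power2 flip: power2_eq_square)
qed

lemma tame_penalty:
  assumes "open U"
  shows "tame U penalty"
proof -
  have "ctame U cusp_poly"
    unfolding cusp_poly_def[abs_def] power2_eq_square power3_eq_cube
    using assms by (intro ctame_diff ctame_mult ctame_component)
  then have "tame U (\<lambda>T x. 6 * T * ((cmod (cusp_poly x))\<^sup>2 - 1))"
    using assms by (intro tame_mult tame_minus tame_norm_sq tame_const tame_param)
  then show ?thesis by (simp add: penalty_def[abs_def])
qed

text \<open>Squared moduli are polynomials in the real coordinates, so \<open>ell\<close> is
  rewritten in terms of them. The two inequalities keep |x2|^2 away from 0 and the ratio
  |x3|^2/|x2|^2 inside the half line of \<open>nice_ln\<close>.\<close>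

lemma tame_ell:
  assumes U: "open U" and x: "\<And>x. x \<in> U \<Longrightarrow> 1/2 < cmod (x $ 2) \<and> cmod (x $ 2) < cmod (x $ 3)"
  shows "tame U (\<lambda>T. ell)"
proof -
  have sq: "(cmod (x $ 2))\<^sup>2 > 1/4" if "x \<in> U" for x
  proof -
    have "(1/2)\<^sup>2 < (cmod (x $ 2))\<^sup>2" using x[OF that] by (intro power_strict_mono) auto
    then show ?thesis by (simp add: power2_eq_square)
  qed
  have "tame U (\<lambda>T x. inv_deriv 0 ((cmod (x $ 2))\<^sup>2))"
    using U sq by (intro tame_comp[OF _ _ _ nice_inv[of "1/4"]] tame_norm_sq ctame_component) auto
  then have inv: "tame U (\<lambda>T x. inverse ((cmod (x $ 2))\<^sup>2))" by (simp add: inv_deriv_def)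
  have gt: "(cmod (x $ 3))\<^sup>2 * inverse ((cmod (x $ 2))\<^sup>2) > 1" if "x \<in> U" for x
  proof -
    have "(cmod (x $ 2))\<^sup>2 < (cmod (x $ 3))\<^sup>2" using x[OF that] by (intro power_strict_mono) auto
    moreover have "0 < (cmod (x $ 2))\<^sup>2" using sq[OF that] by linarith
    ultimately show ?thesis by (simp only: divide_inverse[symmetric] less_divide_eq_1_pos)
  qed
  have "tame U (\<lambda>T x. ln_deriv 0 ((cmod (x $ 3))\<^sup>2 * inverse ((cmod (x $ 2))\<^sup>2)))"
    using U gt by (intro tame_comp[OF _ _ _ nice_ln] tame_mult inv tame_norm_sq ctame_component) auto
  then have ln: "tame U (\<lambda>T x. ln ((cmod (x $ 3))\<^sup>2 * inverse ((cmod (x $ 2))\<^sup>2)))" by (simp add: ln_deriv_def)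
  have re: "tame U (\<lambda>T x. Re (x $ 3) * Re (x $ 2) + Im (x $ 3) * Im (x $ 2))"
    using ctame_component[OF U, of 2] ctame_component[OF U, of 3] U unfolding ctame_def
    by (intro tame_add tame_mult) auto
  have "tame U (\<lambda>T x. (- 1) * ((Re (x $ 3) * Re (x $ 2) + Im (x $ 3) * Im (x $ 2)) * inverse ((cmod (x $ 2))\<^sup>2))
     + (27/2 * ln ((cmod (x $ 3))\<^sup>2 * inverse ((cmod (x $ 2))\<^sup>2)) - 27 * ln 4))"
    by (rule tame_add[OF U tame_mult[OF U tame_const tame_mult[OF U re inv]]
          tame_minus[OF U tame_mult[OF U tame_const ln] tame_const]])
  then show ?thesis
  proof (rule tame_cong[rotated])
    fix T :: real and y assume y: "y \<in> U"
    have nz: "y $ 2 \<noteq> 0" "y $ 3 \<noteq> 0" using x[OF y] by auto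
    have "ln ((cmod (y $ 3))\<^sup>2 * inverse ((cmod (y $ 2))\<^sup>2)) = ln ((cmod (y $ 3 / y $ 2))\<^sup>2)"
      by (simp only: norm_divide power_divide) (simp only: divide_inverse)
    also have "\<dots> = 2 * ln (cmod (y $ 3 / y $ 2))" using nz by (subst ln_realpow) auto
    finally have "ln ((cmod (y $ 3))\<^sup>2 * inverse ((cmod (y $ 2))\<^sup>2)) = 2 * ln (cmod (y $ 3 / y $ 2))" .
    moreover have "ln (cmod (y $ 3 / y $ 2) / 4) = ln (cmod (y $ 3 / y $ 2)) - ln 4"
      using nz by (subst ln_div) auto
    moreover have "Re (y $ 3 / y $ 2) = (Re (y $ 3) * Re (y $ 2) + Im (y $ 3) * Im (y $ 2)) * inverse ((cmod (y $ 2))\<^sup>2)"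
      by (simp only: Re_divide cmod_power2) (simp only: divide_inverse)
    ultimately show "(- 1) * ((Re (y $ 3) * Re (y $ 2) + Im (y $ 3) * Im (y $ 2)) * inverse ((cmod (y $ 2))\<^sup>2))
     + (27/2 * ln ((cmod (y $ 3))\<^sup>2 * inverse ((cmod (y $ 2))\<^sup>2)) - 27 * ln 4) = ell y"
      by (simp add: ell_def)
  qed
qed

text \<open>Each of the three open zones has a formula of its own without case distinction;
  \<open>tame_Un\<close> glues them.\<close>

lemma tame_cusp_fun: "tame UNIV cusp_fun"
proof -
  have en: "tame near_zone (\<lambda>T. ell)" and ef: "tame far_zone (\<lambda>T. ell)"
    by (intro tame_ell open_zones, force simp: near_zone_def far_zone_def)+
  have "tame near_zone (\<lambda>T x. ramp (ell x) + ramp (penalty T x - ramp (ell x)))"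
    by (intro tame_add tame_ramp tame_minus tame_penalty open_zones en)
  then have 1: "tame near_zone cusp_fun"
    by (rule tame_cong[rotated]) (simp add: cusp_fun_def curve_part_near)
  have "tame far_zone (\<lambda>T x. (ell x - ramp_shift) + ramp (penalty T x - (ell x - ramp_shift)))"
    by (intro tame_add tame_ramp tame_minus tame_penalty tame_const open_zones ef)
  then have 2: "tame far_zone cusp_fun"
    by (rule tame_cong[rotated]) (simp add: cusp_fun_def curve_part_def)
  have "tame off_zone (\<lambda>T x. ramp (penalty T x))"
    by (intro tame_ramp tame_penalty open_zones)
  then have 3: "tame off_zone cusp_fun"
    by (rule tame_cong[rotated]) (simp add: cusp_fun_off)
  show ?thesis
    using tame_Un[OF _ _ tame_Un[OF _ _ 1 2] 3] open_zones zones_cover by (simp add: open_Un)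
qed

lemma hol_map_continuous: "hol_map f \<Longrightarrow> continuous_on UNIV f"
  unfolding hol_map_def
  using continuous_on_vec_lambda[of UNIV "\<lambda>i z. f z $ i"] holomorphic_on_imp_continuous_on by force

lemma hol_map_ball:
  assumes "hol_map f" "open S" "f z \<in> S"
  obtains s where "s > 0" "\<And>w. w \<in> ball z s \<Longrightarrow> f w \<in> S"
proof -
  have "open (f -` S)" using hol_map_continuous[OF assms(1)] assms(2) by (simp add: open_vimage)
  then show thesis using that assms(3) openE by (metis subsetD vimage_eq)
qed

lemma hol_map_component: "hol_map f \<Longrightarrow> (\<lambda>z. f z $ i) holomorphic_on S"
  unfolding hol_map_def by (auto intro: holomorphic_on_subset)

lemma hol_support_penalty:
  assumes "hol_map f" "T \<ge> 1"
  shows "hol_support (\<lambda>z. penalty T (f z)) z"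
proof -
  have "hol_support (\<lambda>z. (cmod (cusp_poly (f z)))\<^sup>2) z"
    unfolding cusp_poly_def
    by (rule hol_support_norm_sq[where s = 1]) (auto intro!: holomorphic_intros hol_map_component assms)
  from hol_support_affine[OF this, of "6 * T" "- 6 * T"] show ?thesis
    using assms(2) by (simp add: penalty_def algebra_simps)
qed

lemma hol_support_ell:
  assumes f: "hol_map f" and z: "f z $ 2 \<noteq> 0" "f z $ 3 \<noteq> 0"
  shows "hol_support (\<lambda>z. ell (f z)) z"
proof -
  have "open {x :: complex^3. x $ 2 \<noteq> 0}"
    by (intro open_Collect_neq continuous_intros)
  then obtain s where s: "s > 0" "\<And>w. w \<in> ball z s \<Longrightarrow> f w \<in> {x. x $ 2 \<noteq> 0}"
    using hol_map_ball[OF f, of _ z] z(1) by blast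
  have hol: "(\<lambda>w. f w $ 3 / f w $ 2) holomorphic_on ball z s"
    using s(2) by (auto intro!: holomorphic_intros hol_map_component f)
  have "hol_support (\<lambda>w. Re (- (f w $ 3 / f w $ 2))) z"
    using s(1) by (intro hol_support_Re[where s = s] holomorphic_on_minus hol)
  moreover have "hol_support (\<lambda>w. ln (cmod (f w $ 3 / f w $ 2 / 4))) z"
    using s z by (intro hol_support_ln_norm[where s = s] holomorphic_on_divide[OF hol] holomorphic_on_const) auto
  ultimately have "hol_support (\<lambda>w. Re (- (f w $ 3 / f w $ 2)) + (27 * ln (cmod (f w $ 3 / f w $ 2 / 4)) + 0)) z"
    by (intro hol_support_add hol_support_affine) auto
  then show ?thesis by (simp add: ell_def norm_divide)
qed

lemma hol_support_cusp_fun: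
  assumes f: "hol_map f" and T: "T \<ge> 1"
  shows "hol_support (\<lambda>z. cusp_fun T (f z)) z"
proof -
  consider "f z \<in> near_zone" | "f z \<in> far_zone" | "f z \<in> off_zone" using zones_cover by blast
  then show ?thesis
  proof cases
    case 1
    then have "hol_support (\<lambda>z. ell (f z)) z"
      by (intro hol_support_ell f) (auto simp: near_zone_def)
    then have *: "hol_support (\<lambda>z. ramp (ell (f z)) + ramp (penalty T (f z) - ramp (ell (f z)))) z"
      by (intro hol_support_ramp_join hol_support_ramp hol_support_penalty f T)
    obtain s where "s > 0" "\<And>w. w \<in> ball z s \<Longrightarrow> f w \<in> near_zone"
      by (rule hol_map_ball[OF f open_zones(1) 1]) blast
    then show ?thesis
      by (intro hol_support_cong[OF *]) (auto simp: cusp_fun_def curve_part_near)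
  next
    case 2
    then have "hol_support (\<lambda>z. ell (f z)) z"
      by (intro hol_support_ell f) (auto simp: far_zone_def)
    from hol_support_affine[OF this, of 1 "- ramp_shift"]
    have "hol_support (\<lambda>z. ell (f z) - ramp_shift) z" by simp
    then have *: "hol_support (\<lambda>z. (ell (f z) - ramp_shift) + ramp (penalty T (f z) - (ell (f z) - ramp_shift))) z"
      by (intro hol_support_ramp_join hol_support_penalty f T)
    obtain s where "s > 0" "\<And>w. w \<in> ball z s \<Longrightarrow> f w \<in> far_zone"
      by (rule hol_map_ball[OF f open_zones(2) 2]) blast
    then show ?thesis
      by (intro hol_support_cong[OF *]) (auto simp: cusp_fun_def curve_part_def)
  next
    case 3
    have *: "hol_support (\<lambda>z. ramp (penalty T (f z))) z"
      by (intro hol_support_ramp hol_support_penalty f T)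
    obtain s where "s > 0" "\<And>w. w \<in> ball z s \<Longrightarrow> f w \<in> off_zone"
      by (rule hol_map_ball[OF f open_zones(3) 3]) blast
    then show ?thesis
      by (intro hol_support_cong[OF *]) (auto simp: cusp_fun_off T)
  qed
qed

text \<open>As \<open>ramp y \<ge> y - 1\<close>, the smooth maximum is at least the penalty minus
  1, and the penalty never falls below - 6 T.\<close>

lemma cusp_fun_ge:
  assumes "T \<ge> 1"
  shows "cusp_fun T x \<ge> - 6 * T - 1"
proof -
  have "6 * T * (- 1) \<le> penalty T x" unfolding penalty_def using assms by (intro mult_left_mono) auto
  then show ?thesis using ramp_ge[of "penalty T x - curve_part x"] by (simp add: cusp_fun_def)
qed

text \<open>Near 0 the penalty is nonpositive because |\<open>cusp_poly\<close>| <= 1. This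
  vanishing makes earlier levels invisible to a disc and leaves the boundary to first order
  unchanged at 0.\<close>

lemma cusp_fun_zero:
  assumes x: "cmod (x $ 2) \<le> 1/2" "cmod (x $ 3) \<le> 1/2" and "T \<ge> 1"
  shows "cusp_fun T x = 0"
proof -
  have "cmod (cusp_poly x) \<le> cmod (x $ 3) ^ 2 + cmod (x $ 2) ^ 3"
    unfolding cusp_poly_def using norm_triangle_ineq4[of "(x $ 3)\<^sup>2" "(x $ 2) ^ 3"] by (simp add: norm_power)
  also have "\<dots> \<le> (1/2) ^ 2 + (1/2) ^ 3" using x by (intro add_mono power_mono) auto
  also have "\<dots> \<le> (1::real)" by (simp add: power2_eq_square power3_eq_cube)
  finally have "(cmod (cusp_poly x))\<^sup>2 \<le> 1" by (simp add: abs_square_le_1)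
  then have "penalty T x \<le> 0" unfolding penalty_def using assms(3) by (intro mult_nonneg_nonpos) auto
  moreover have "x \<in> off_zone" using x by (auto simp: off_zone_def)
  ultimately show ?thesis using assms(3) by (simp add: cusp_fun_off ramp_nonpos)
qed

text \<open>On the cusp the penalty is - 6 T, below the bound because |z| <= T, so only the curve
  part counts. The summand 16 keeps the bound nonnegative wherever a maximum with 0 is taken, since
  |z| < 16 there.\<close>

lemma cusp_fun_curve:
  assumes T: "T \<ge> 1" and z: "cmod z \<le> T" and x: "x $ 2 = z\<^sup>2" "x $ 3 = z ^ 3"
  shows "cusp_fun T x \<le> - Re z + 27 * ln T + 16"
proof -
  have lnT: "ln T \<ge> 0" using T by simp
  have re: "\<bar>Re z\<bar> \<le> cmod z" by (rule abs_Re_le_cmod)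
  have "cusp_poly x = 0" by (simp add: cusp_poly_def x flip: power_mult)
  then have "penalty T x = - 6 * T" by (simp add: penalty_def)
  then have pen: "penalty T x \<le> - Re z + 27 * ln T + 16" using T z re lnT by linarith
  have ell: "ell x \<le> - Re z + 27 * ln T" if "z \<noteq> 0"
  proof -
    have "x $ 3 / x $ 2 = z" using that by (simp add: x power2_eq_square power3_eq_cube)
    moreover have "ln (cmod z / 4) \<le> ln T" using that z T by (subst ln_le_cancel_iff) auto
    ultimately show ?thesis by (simp add: ell_def)
  qed
  have nx: "cmod (x $ 2) = (cmod z)\<^sup>2" "cmod (x $ 3) = (cmod z)\<^sup>2 * cmod z"
    by (simp_all add: x norm_power power2_eq_square power3_eq_cube norm_mult)
  have "curve_part x \<le> - Re z + 27 * ln T + 16"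
  proof (cases "z = 0")
    case True
    then show ?thesis using lnT by (simp add: curve_part_def far_zone_def near_zone_def x)
  next
    case z0: False
    consider "x \<in> far_zone" | "x \<notin> far_zone" "x \<in> near_zone" | "x \<notin> far_zone" "x \<notin> near_zone" by blast
    then show ?thesis
    proof cases
      case 1
      then show ?thesis using ell[OF z0] ramp_shift_bounds by (simp add: curve_part_def)
    next
      case 2
      then have "cmod z * (cmod z)\<^sup>2 < 16 * (cmod z)\<^sup>2" by (simp add: near_zone_def nx mult.commute)
      then have "cmod z < 16" using z0 by (simp add: mult_less_cancel_right)
      then have "0 \<le> - Re z + 27 * ln T + 16" using re lnT by linarith
      then show ?thesis using 2 ell[OF z0] ramp_le[of "ell x"] by (simp add: curve_part_def)
    next
      case 3
      have "cmod z \<le> 1"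
      proof (rule ccontr)
        assume z1: "\<not> cmod z \<le> 1"
        have "1 < (cmod z)\<^sup>2" using z1 by (simp add: one_less_power)
        moreover have "((cmod z)\<^sup>2 * cmod z)\<^sup>2 < 4 * ((cmod z)\<^sup>2) ^ 3"
          using z0 by (simp add: power_mult_distrib power2_eq_square power3_eq_cube)
        moreover have "(cmod z)\<^sup>2 * 1 < (cmod z)\<^sup>2 * cmod z"
          using z1 by (intro mult_strict_left_mono) auto
        moreover have "8 * (cmod z)\<^sup>2 < (cmod z)\<^sup>2 * cmod z \<or> (cmod z)\<^sup>2 * cmod z < 16 * (cmod z)\<^sup>2"
          using calculation(1) by linarith
        ultimately show False using 3 by (auto simp: far_zone_def near_zone_def nx)
      qed
      then have "0 \<le> - Re z + 27 * ln T + 16" using re lnT by linarith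
      then show ?thesis using 3 by (simp add: curve_part_def)
    qed
  qed
  then show ?thesis using pen ramp_le[of "penalty T x - curve_part x"] by (simp add: cusp_fun_def)
qed

section \<open>Rapidly decaying series\<close>

text \<open>Half of the exponential decay absorbs powers of L; the other half remains for the
  summation.\<close>

lemma power_exp_half: "\<exists>C\<ge>0. \<forall>L\<ge>(0::real). L ^ n * exp (- L) \<le> C * exp (- (L / 2))"
proof (intro exI[of _ "2 ^ n * fact n"] conjI allI impI)
  fix L :: real assume "L \<ge> 0"
  then have "(L / 2) ^ n \<le> fact n * exp (L / 2)" by (intro power_le_fact_exp) auto
  then have "L ^ n \<le> 2 ^ n * fact n * exp (L / 2)" by (simp add: power_divide field_simps)
  then have "L ^ n * exp (- L) \<le> 2 ^ n * fact n * exp (L / 2) * exp (- L)"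
    by (intro mult_right_mono) auto
  also have "\<dots> = 2 ^ n * fact n * exp (- (L / 2))"
    by (simp add: mult.assoc flip: exp_add)
  finally show "L ^ n * exp (- L) \<le> 2 ^ n * fact n * exp (- (L / 2))" .
qed simp

definition rapid_family :: "('a::euclidean_space list \<Rightarrow> real \<Rightarrow> 'a \<Rightarrow> real) \<Rightarrow> bool" where
  "rapid_family F \<longleftrightarrow>
     (\<forall>vs. \<forall>L\<ge>1. \<forall>x. (F vs L has_derivative (\<lambda>v. F (v # vs) L x)) (at x)) \<and>
     (\<forall>vs B. \<exists>C\<ge>0. \<forall>L\<ge>1. \<forall>x. norm x \<le> B \<longrightarrow> \<bar>F vs L x\<bar> \<le> C * exp (- (L / 2)))"

lemma rapid_family_linear:
  assumes "rapid_family F" "L \<ge> 1"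
  shows "bounded_linear (\<lambda>v. F (v # vs) L x)"
  using assms unfolding rapid_family_def by (blast intro: has_derivative_bounded_linear)

text \<open>Linearity in the newest direction and the finite basis give one constant for all
  \<open>h\<close>, as uniform convergence of the differentials requires.\<close>

lemma rapid_family_bound_derivative:
  fixes F :: "'a::euclidean_space list \<Rightarrow> real \<Rightarrow> 'a \<Rightarrow> real"
  assumes F: "rapid_family F"
  obtains C where "C \<ge> 0"
    "\<And>L x h. L \<ge> 1 \<Longrightarrow> norm x \<le> B \<Longrightarrow> \<bar>F (h # vs) L x\<bar> \<le> C * norm h * exp (- (L / 2))"
proof -
  have "\<forall>b. \<exists>C\<ge>0. \<forall>L\<ge>1. \<forall>x. norm x \<le> B \<longrightarrow> \<bar>F (b # vs) L x\<bar> \<le> C * exp (- (L / 2))"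
    using F unfolding rapid_family_def by blast
  then obtain C where C: "\<And>b. C b \<ge> 0"
    "\<And>b L x. L \<ge> 1 \<Longrightarrow> norm x \<le> B \<Longrightarrow> \<bar>F (b # vs) L x\<bar> \<le> C b * exp (- (L / 2))"
    by metis
  show thesis
  proof (rule that)
    show "(\<Sum>b\<in>Basis. C b) \<ge> 0" using C by (intro sum_nonneg) auto
    fix L :: real and x h :: 'a assume L: "L \<ge> 1" and x: "norm x \<le> B"
    interpret bounded_linear "\<lambda>v. F (v # vs) L x" by (rule rapid_family_linear[OF F L])
    have "F (h # vs) L x = F ((\<Sum>b\<in>Basis. (h \<bullet> b) *\<^sub>R b) # vs) L x"
      by (simp add: euclidean_representation)
    also have "\<dots> = (\<Sum>b\<in>Basis. (h \<bullet> b) * F (b # vs) L x)"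
      by (simp add: sum scale)
    finally have "\<bar>F (h # vs) L x\<bar> \<le> (\<Sum>b\<in>Basis. \<bar>(h \<bullet> b) * F (b # vs) L x\<bar>)"
      by (simp add: sum_abs)
    also have "\<dots> \<le> (\<Sum>b\<in>Basis. norm h * (C b * exp (- (L / 2))))"
      unfolding abs_mult using L x C by (intro sum_mono mult_mono Basis_le_norm) auto
    also have "\<dots> = (\<Sum>b\<in>Basis. C b) * norm h * exp (- (L / 2))"
      by (simp add: sum_distrib_left sum_distrib_right algebra_simps)
    finally show "\<bar>F (h # vs) L x\<bar> \<le> (\<Sum>b\<in>Basis. C b) * norm h * exp (- (L / 2))" .
  qed
qed

text \<open>A gap of 2 contributes a factor exp (- 1) <= 1/2, so a geometric series dominates and
  the first term controls the sum.\<close>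

lemma exp_gap_sum:
  fixes L :: "nat \<Rightarrow> real"
  assumes gap: "\<And>n. L n + 2 \<le> L (Suc n)"
  shows "summable (\<lambda>n. exp (- (L n / 2)))" "(\<Sum>n. exp (- (L n / 2))) \<le> 2 * exp (- (L 0 / 2))"
proof -
  have e1: "exp (- 1) \<le> (1/2::real)"
    using exp_ge_add_one_self[of 1] by (simp add: exp_minus field_simps)
  have le: "exp (- (L n / 2)) \<le> exp (- (L 0 / 2)) * (1/2) ^ n" for n
  proof (induction n)
    case (Suc n)
    have "exp (- (L (Suc n) / 2)) \<le> exp (- (L n / 2) + - 1)" using gap[of n] by simp
    also have "\<dots> = exp (- (L n / 2)) * exp (- 1)" by (rule exp_add)
    also have "\<dots> \<le> (exp (- (L 0 / 2)) * (1/2) ^ n) * (1/2)" using Suc e1 by (intro mult_mono) auto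
    finally show ?case by simp
  qed simp
  have s: "summable (\<lambda>n. exp (- (L 0 / 2)) * (1/2::real) ^ n)"
    by (intro summable_mult summable_geometric) simp
  show 1: "summable (\<lambda>n. exp (- (L n / 2)))"
    by (rule summable_comparison_test'[OF s]) (use le in auto)
  have "(\<Sum>n. exp (- (L n / 2))) \<le> (\<Sum>n. exp (- (L 0 / 2)) * (1/2::real) ^ n)"
    by (rule suminf_le[OF le 1 s])
  also have "\<dots> = 2 * exp (- (L 0 / 2))"
    by (subst suminf_mult) (auto simp: suminf_geometric)
  finally show "(\<Sum>n. exp (- (L n / 2))) \<le> 2 * exp (- (L 0 / 2))" .
qed

lemma suminf_abs_le_weights:
  fixes f w :: "nat \<Rightarrow> real"
  assumes "\<And>n. \<bar>f n\<bar> \<le> C * w n" "summable w"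
  shows "summable f" "\<bar>\<Sum>n. f n\<bar> \<le> C * (\<Sum>n. w n)"
proof -
  have s: "summable (\<lambda>n. C * w n)" using assms(2) by (rule summable_mult)
  have sa: "summable (\<lambda>n. \<bar>f n\<bar>)"
    by (rule summable_comparison_test'[OF s]) (use assms(1) in auto)
  show "summable f" using sa by (rule summable_rabs_cancel)
  have "\<bar>\<Sum>n. f n\<bar> \<le> (\<Sum>n. \<bar>f n\<bar>)" by (rule summable_rabs[OF sa])
  also have "\<dots> \<le> (\<Sum>n. C * w n)" by (rule suminf_le[OF assms(1) sa s])
  also have "\<dots> = C * (\<Sum>n. w n)" using assms(2) by (rule suminf_mult)
  finally show "\<bar>\<Sum>n. f n\<bar> \<le> C * (\<Sum>n. w n)" .
qed

text \<open>For one list \<open>vs\<close> this is differentiation term by term on a ball around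
  \<open>x\<close>; used for all lists, it makes the sum smooth.\<close>

lemma rapid_family_series:
  fixes F :: "'a::euclidean_space list \<Rightarrow> real \<Rightarrow> 'a \<Rightarrow> real" and L :: "nat \<Rightarrow> real"
  assumes F: "rapid_family F" and L1: "\<And>n. L n \<ge> 1" and gap: "\<And>n. L n + 2 \<le> L (Suc n)"
  shows "summable (\<lambda>n. F vs (L n) x)"
    and "((\<lambda>x. \<Sum>n. F vs (L n) x) has_derivative (\<lambda>v. \<Sum>n. F (v # vs) (L n) x)) (at x)"
proof -
  have w: "summable (\<lambda>n. exp (- (L n / 2)))" using gap by (rule exp_gap_sum)
  have summ: "summable (\<lambda>n. F vs (L n) x)" for vs x
  proof -
    obtain C where "\<forall>L\<ge>1. \<forall>y. norm y \<le> norm x \<longrightarrow> \<bar>F vs L y\<bar> \<le> C * exp (- (L / 2))"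
      using F unfolding rapid_family_def by metis
    then show ?thesis
      using L1 by (intro suminf_abs_le_weights(1)[OF _ w, of _ C]) auto
  qed
  then show "summable (\<lambda>n. F vs (L n) x)" .
  define B where "B = norm x + 1"
  obtain C where C: "C \<ge> 0"
    "\<And>L x h. L \<ge> 1 \<Longrightarrow> norm x \<le> B \<Longrightarrow> \<bar>F (h # vs) L x\<bar> \<le> C * norm h * exp (- (L / 2))"
    by (rule rapid_family_bound_derivative[OF F, of B vs]) blast
  have "\<exists>g. \<forall>x\<in>ball 0 B. (\<lambda>n. F vs (L n) x) sums g x \<and>
      (g has_derivative (\<lambda>v. \<Sum>n. F (v # vs) (L n) x)) (at x within ball 0 B)"
  proof (rule has_derivative_series[where f' = "\<lambda>n x v. F (v # vs) (L n) x"])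
    show "x \<in> ball 0 B" by (simp add: B_def)
    show "(\<lambda>n. F vs (L n) x) sums (\<Sum>n. F vs (L n) x)" using summ by (rule summable_sums)
    show "(F vs (L n) has_derivative (\<lambda>v. F (v # vs) (L n) y)) (at y within ball 0 B)" for n y
      using F L1 unfolding rapid_family_def by (blast intro: has_derivative_at_withinI)
    fix e :: real assume e: "e > 0"
    \<comment> \<open>Dividing by C + 1 instead of C covers the case C = 0.\<close>
    obtain N where N: "\<And>n. n \<ge> N \<Longrightarrow> norm (\<Sum>i. exp (- (L (i + n) / 2))) < e / (C + 1)"
      using suminf_exist_split[OF _ w, of "e / (C + 1)"] e C(1) by auto
    show "\<forall>\<^sub>F n in sequentially. \<forall>y\<in>ball 0 B. \<forall>h.
        norm ((\<Sum>i<n. F (h # vs) (L i) y) - (\<Sum>n. F (h # vs) (L n) y)) \<le> e * norm h"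
      unfolding eventually_sequentially
    proof (intro exI[of _ N] allI impI ballI)
      fix n y h assume n: "N \<le> n" and y: "y \<in> ball (0::'a) B"
      have ws: "summable (\<lambda>i. exp (- (L (i + n) / 2)))"
        using w by (subst summable_iff_shift)
      have "(\<Sum>i<n. F (h # vs) (L i) y) - (\<Sum>n. F (h # vs) (L n) y) = - (\<Sum>i. F (h # vs) (L (i + n)) y)"
        using suminf_split_initial_segment[OF summ[of "h # vs" y], of n] by simp
      moreover have "\<bar>\<Sum>i. F (h # vs) (L (i + n)) y\<bar> \<le> (C * norm h) * (\<Sum>i. exp (- (L (i + n) / 2)))"
        using C(2) L1 y by (intro suminf_abs_le_weights(2)[OF _ ws]) auto
      moreover have "(C * norm h) * (\<Sum>i. exp (- (L (i + n) / 2))) \<le> (C * norm h) * (e / (C + 1))"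
        using N[OF n] C(1) by (intro mult_left_mono) auto
      moreover have "C * (e / (C + 1)) \<le> e" using C(1) e by (simp add: field_simps)
      then have "norm h * (C * (e / (C + 1))) \<le> norm h * e" by (rule mult_left_mono) simp
      ultimately show "norm ((\<Sum>i<n. F (h # vs) (L i) y) - (\<Sum>n. F (h # vs) (L n) y)) \<le> e * norm h"
        by (simp add: algebra_simps)
    qed
  qed simp
  then obtain g where g: "\<And>y. y \<in> ball 0 B \<Longrightarrow> (\<lambda>n. F vs (L n) y) sums g y"
    "\<And>y. y \<in> ball 0 B \<Longrightarrow> (g has_derivative (\<lambda>v. \<Sum>n. F (v # vs) (L n) y)) (at y within ball 0 B)"
    by blast
  have x: "x \<in> ball 0 B" by (simp add: B_def)
  have "(g has_derivative (\<lambda>v. \<Sum>n. F (v # vs) (L n) x)) (at x)"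
    using g(2)[OF x] at_within_open[OF x open_ball] by simp
  then show "((\<lambda>x. \<Sum>n. F vs (L n) x) has_derivative (\<lambda>v. \<Sum>n. F (v # vs) (L n) x)) (at x)"
    by (rule has_derivative_transform_within_open[OF _ open_ball x]) (use g(1) in \<open>simp add: sums_iff\<close>)
qed

text \<open>With \<delta> = exp (- L) and T = L^m the weight is \<delta> L^\<alpha> / T. The
  coordinates of the piece |s| <= T of the cusp are at most T^3; the scale T^4 shrinks them to at
  most 1/T, where the cutoff term of \<open>base_fun\<close> and the bumps of earlier levels
  vanish.\<close>

definition bump :: "real \<Rightarrow> nat \<Rightarrow> real \<Rightarrow> complex^3 \<Rightarrow> real" where
  "bump \<alpha> m L x = exp (- L) * L powr (\<alpha> - real m) * cusp_fun (L ^ m) (L ^ (4 * m) *\<^sub>R x)"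

lemma bump_weight:
  assumes "\<alpha> \<le> real m" "L \<ge> 1"
  shows "L powr (\<alpha> - real m) \<le> 1"
  using assms powr_mono[of "\<alpha> - real m" 0 L] by simp

text \<open>Every derivative costs one factor \<open>L ^ (4 * m)\<close>, and the bounds on
  \<open>cusp_fun\<close> are polynomial in L; exp (- L) outweighs both.\<close>

lemma bump_rapid:
  assumes am: "\<alpha> \<le> real m"
  obtains F where "rapid_family F" "\<And>L x. L \<ge> 1 \<Longrightarrow> F [] L x = bump \<alpha> m L x"
proof -
  obtain G where G: "\<And>T x. T \<ge> 1 \<Longrightarrow> x \<in> UNIV \<Longrightarrow> G [] T x = cusp_fun T x"
     "\<And>vs T x. T \<ge> 1 \<Longrightarrow> x \<in> UNIV \<Longrightarrow> (G vs T has_derivative (\<lambda>v. G (v # vs) T x)) (at x)"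
     "\<And>vs. pbound UNIV (G vs)"
    using tame_cusp_fun by (rule tameE) blast
  define F where "F = (\<lambda>(vs :: (complex^3) list) L (x :: complex^3). exp (- L) * L powr (\<alpha> - real m) * (L ^ (4 * m)) ^ length vs
    * G vs (L ^ m) (L ^ (4 * m) *\<^sub>R x))"
  have "rapid_family F"
    unfolding rapid_family_def
  proof (intro conjI allI impI)
    fix vs :: "(complex^3) list" and L :: real and x :: "complex^3" assume L: "1 \<le> L"
    define k where "k = L ^ (4 * m)"
    define c where "c = exp (- L) * L powr (\<alpha> - real m) * k ^ length vs"
    have "1 \<le> L ^ m" using L by simp
    then have d: "(G vs (L ^ m) has_derivative (\<lambda>v. G (v # vs) (L ^ m) (k *\<^sub>R x))) (at (k *\<^sub>R x))"
      using G(2) by simp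
    have "((\<lambda>x. c * G vs (L ^ m) (k *\<^sub>R x)) has_derivative (\<lambda>v. c * G ((k *\<^sub>R v) # vs) (L ^ m) (k *\<^sub>R x))) (at x)"
      by (intro has_derivative_mult_right
          has_derivative_compose[where f = "\<lambda>x. k *\<^sub>R x" and g = "G vs (L ^ m)", OF _ d])
        (auto intro!: derivative_eq_intros)
    moreover have "G ((k *\<^sub>R v) # vs) (L ^ m) (k *\<^sub>R x) = k * G (v # vs) (L ^ m) (k *\<^sub>R x)" for v
      using linear_cmul[OF has_derivative_linear[OF d], of k v] by simp
    ultimately show "(F vs L has_derivative (\<lambda>v. F (v # vs) L x)) (at x)"
      unfolding F_def c_def by (simp add: k_def mult_ac)
  next
    fix vs :: "(complex^3) list" and B :: real
    obtain C N where C: "C \<ge> 0" "\<And>T x. T \<ge> 1 \<Longrightarrow> x \<in> UNIV \<Longrightarrow> \<bar>G vs T x\<bar> \<le> C * (T + norm x) ^ N"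
      using G(3)[of vs] by (rule pboundE) blast
    define M where "M = 4 * m * length vs + 4 * m * N"
    obtain K where K: "K \<ge> 0" "\<And>L. L \<ge> (0::real) \<Longrightarrow> L ^ M * exp (- L) \<le> K * exp (- (L / 2))"
      using power_exp_half[of M] by blast
    show "\<exists>C\<ge>0. \<forall>L\<ge>1. \<forall>x. norm x \<le> B \<longrightarrow> \<bar>F vs L x\<bar> \<le> C * exp (- (L / 2))"
    proof (intro exI[of _ "C * (1 + \<bar>B\<bar>) ^ N * K"] conjI allI impI)
      show "0 \<le> C * (1 + \<bar>B\<bar>) ^ N * K" using C K by simp
      fix L :: real and x :: "complex^3" assume L: "1 \<le> L" and x: "norm x \<le> B"
      have k0: "0 < L ^ (4 * m)" and T: "1 \<le> L ^ m" using L by auto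
      have "L ^ m + norm (L ^ (4 * m) *\<^sub>R x) \<le> L ^ (4 * m) + L ^ (4 * m) * \<bar>B\<bar>"
        using L x k0 by (intro add_mono power_increasing) (auto intro!: mult_left_mono)
      then have "(L ^ m + norm (L ^ (4 * m) *\<^sub>R x)) ^ N \<le> ((1 + \<bar>B\<bar>) * L ^ (4 * m)) ^ N"
        using L by (intro power_mono) (auto simp: algebra_simps)
      then have "\<bar>G vs (L ^ m) (L ^ (4 * m) *\<^sub>R x)\<bar> \<le> C * ((1 + \<bar>B\<bar>) * L ^ (4 * m)) ^ N"
        using C(2)[OF T, of "L ^ (4 * m) *\<^sub>R x"] C(1) mult_left_mono by fastforce
      then have g: "\<bar>G vs (L ^ m) (L ^ (4 * m) *\<^sub>R x)\<bar> \<le> C * (1 + \<bar>B\<bar>) ^ N * L ^ (4 * m * N)"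
        by (simp add: power_mult_distrib power_mult mult.assoc)
      have "\<bar>F vs L x\<bar> = exp (- L) * L powr (\<alpha> - real m) * L ^ (4 * m * length vs)
          * \<bar>G vs (L ^ m) (L ^ (4 * m) *\<^sub>R x)\<bar>"
        using L by (simp add: F_def abs_mult power_mult)
      also have "\<dots> \<le> exp (- L) * 1 * L ^ (4 * m * length vs) * (C * (1 + \<bar>B\<bar>) ^ N * L ^ (4 * m * N))"
        using g L bump_weight[OF am L] C by (intro mult_mono) auto
      also have "\<dots> = C * (1 + \<bar>B\<bar>) ^ N * (L ^ M * exp (- L))"
        by (simp add: M_def power_add mult_ac)
      also have "\<dots> \<le> C * (1 + \<bar>B\<bar>) ^ N * (K * exp (- (L / 2)))"
        using K(2)[of L] L C by (intro mult_left_mono) auto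
      finally show "\<bar>F vs L x\<bar> \<le> C * (1 + \<bar>B\<bar>) ^ N * K * exp (- (L / 2))" by (simp add: mult.assoc)
    qed
  qed
  moreover have "F [] L x = bump \<alpha> m L x" if "L \<ge> 1" for L x
    using G(1)[of "L ^ m"] that by (simp add: F_def bump_def)
  ultimately show thesis by (rule that)
qed

text \<open>Unlike the bounds of \<open>rapid_family\<close>, this one is global in
  \<open>x\<close>: it enters the proof that the domain is bounded.\<close>

lemma bump_ge:
  assumes am: "\<alpha> \<le> real m"
  obtains C where "C \<ge> 0" "\<And>L x. L \<ge> 1 \<Longrightarrow> bump \<alpha> m L x \<ge> - (C * exp (- (L / 2)))"
proof -
  obtain K where K: "K \<ge> 0" "\<And>L. L \<ge> (0::real) \<Longrightarrow> L ^ m * exp (- L) \<le> K * exp (- (L / 2))"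
    using power_exp_half[of m] by blast
  have "bump \<alpha> m L x \<ge> - (7 * K * exp (- (L / 2)))" if L: "L \<ge> 1" for L x
  proof -
    have T: "1 \<le> L ^ m" using L by simp
    define c where "c = exp (- L) * L powr (\<alpha> - real m)"
    have c: "0 \<le> c" "c \<le> exp (- L)" using bump_weight[OF am L] by (simp_all add: c_def)
    have "c * (7 * L ^ m) \<le> exp (- L) * (7 * L ^ m)" using c T by (intro mult_right_mono) auto
    also have "\<dots> \<le> 7 * K * exp (- (L / 2))" using K(2)[of L] L by (simp add: mult_ac)
    finally have "c * (7 * L ^ m) \<le> 7 * K * exp (- (L / 2))" .
    moreover have "c * (- (7 * L ^ m)) \<le> c * cusp_fun (L ^ m) (L ^ (4 * m) *\<^sub>R x)"
      using cusp_fun_ge[OF T, of "L ^ (4 * m) *\<^sub>R x"] T c by (intro mult_left_mono) auto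
    ultimately show ?thesis by (simp add: bump_def c_def)
  qed
  then show thesis using that[of "7 * K"] K(1) by simp
qed

lemma bump_zero:
  assumes "cmod (x $ 2) \<le> r" "cmod (x $ 3) \<le> r" "L ^ (4 * m) * r \<le> 1/2" "L \<ge> 1"
  shows "bump \<alpha> m L x = 0"
proof -
  have "L ^ (4 * m) * cmod (x $ i) \<le> 1/2" if "cmod (x $ i) \<le> r" for i
  proof -
    have "L ^ (4 * m) * cmod (x $ i) \<le> L ^ (4 * m) * r" using that assms(4) by (intro mult_left_mono) auto
    with assms(3) show ?thesis by (rule order_trans[rotated])
  qed
  then have "cusp_fun (L ^ m) (L ^ (4 * m) *\<^sub>R x) = 0"
    using assms by (intro cusp_fun_zero) (auto simp: vector_scaleR_component)
  then show ?thesis by (simp add: bump_def)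
qed

lemma hol_support_bump:
  assumes "hol_map f" "L \<ge> 1"
  shows "hol_support (\<lambda>z. bump \<alpha> m L (f z)) z"
proof -
  have "hol_map (\<lambda>z. L ^ (4 * m) *\<^sub>R f z)"
    using assms(1) unfolding hol_map_def vector_scaleR_component
    by (simp add: scaleR_conv_of_real holomorphic_on_mult holomorphic_on_const)
  from hol_support_affine[OF hol_support_cusp_fun[OF this], of "L ^ m" "exp (- L) * L powr (\<alpha> - real m)" 0]
  show ?thesis using assms(2) by (simp add: bump_def)
qed

text \<open>This is \<open>cusp_fun_curve\<close> for s = L^m z: the weight turns - Re s into -
  \<delta> L^\<alpha> Re z. The error 27 ln T + 16 is at most L/4, and m >= \<alpha> + 1 makes the
  weight times L at most \<delta>.\<close>

lemma bump_curve:
  assumes am: "\<alpha> + 1 \<le> real m" and L: "L \<ge> 1" and z: "cmod z < 1"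
    and small: "27 * real m * ln L + 16 \<le> L / 4"
    and x: "x $ 2 = of_real (L ^ m) ^ 2 * z ^ 2 / of_real (L ^ (4 * m))"
      "x $ 3 = of_real (L ^ m) ^ 3 * z ^ 3 / of_real (L ^ (4 * m))"
  shows "bump \<alpha> m L x \<le> - (exp (- L) * L powr \<alpha> * Re z) + exp (- L) / 4"
proof -
  have T: "1 \<le> L ^ m" using L by simp
  define c where "c = exp (- L) * L powr (\<alpha> - real m)"
  have c0: "0 \<le> c" by (simp add: c_def)
  have "cusp_fun (L ^ m) (L ^ (4 * m) *\<^sub>R x) \<le> - Re (of_real (L ^ m) * z) + 27 * ln (L ^ m) + 16"
  proof (rule cusp_fun_curve[OF T])
    have "L ^ m * cmod z \<le> L ^ m * 1" using z L by (intro mult_left_mono) auto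
    then show "cmod (of_real (L ^ m) * z) \<le> L ^ m" using L by (simp add: norm_mult norm_power)
  qed (use L in \<open>simp_all only: x vector_scaleR_component\<close>,
      use L in \<open>simp_all add: scaleR_conv_of_real power_mult_distrib\<close>)
  also have "ln (L ^ m) = real m * ln L" using L by (simp add: ln_realpow)
  finally have "cusp_fun (L ^ m) (L ^ (4 * m) *\<^sub>R x) \<le> - (L ^ m * Re z) + L / 4"
    using small by simp
  then have "bump \<alpha> m L x \<le> c * (- (L ^ m * Re z) + L / 4)"
    unfolding bump_def c_def[symmetric] using c0 by (rule mult_left_mono)
  also have "\<dots> = - (c * L ^ m * Re z) + c * L / 4" by (simp add: algebra_simps)
  also have "c * L ^ m = exp (- L) * L powr \<alpha>"
    using L by (simp add: c_def powr_diff powr_realpow)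
  also have "c * L \<le> exp (- L)"
  proof -
    have "L powr (\<alpha> - real m) * L = L powr (\<alpha> - real m + 1)" using L by (simp add: powr_add)
    also have "\<dots> \<le> L powr 0" using am L by (intro powr_mono) auto
    finally show ?thesis using L by (simp add: c_def mult.assoc)
  qed
  finally show ?thesis by simp
qed

section \<open>The domain\<close>

lemma C_infinity_on_tame:
  assumes "tame UNIV (\<lambda>T. f)"
  shows "C_infinity_on UNIV f"
proof -
  obtain F where F: "\<And>T x. T \<ge> 1 \<Longrightarrow> x \<in> UNIV \<Longrightarrow> F [] T x = f x"
     "\<And>vs T x. T \<ge> 1 \<Longrightarrow> x \<in> UNIV \<Longrightarrow> (F vs T has_derivative (\<lambda>v. F (v # vs) T x)) (at x)"
     "\<And>vs. pbound UNIV (F vs)"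
    using assms by (rule tameE) blast
  show ?thesis unfolding C_infinity_on_def
  proof (intro exI[of _ "\<lambda>vs. F vs 1"] conjI allI ballI)
    show "F [] 1 = f" using F(1)[of 1] by auto
    show "\<exists>L. (F vs 1 has_derivative L) (at x) \<and> (\<forall>v. L v = F (v # vs) 1 x)" for vs x
      using F(2)[of 1 x vs] by (intro exI[of _ "\<lambda>v. F (v # vs) 1 x"]) simp
  qed
qed

lemma C_infinity_on_add:
  assumes "C_infinity_on U f" "C_infinity_on U g"
  shows "C_infinity_on U (\<lambda>x. f x + g x)"
proof -
  obtain F where F: "F [] = f"
    "\<forall>vs. \<forall>x\<in>U. \<exists>L. (F vs has_derivative L) (at x) \<and> (\<forall>v. L v = F (v # vs) x)"
    using assms(1) unfolding C_infinity_on_def by blast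
  obtain G where G: "G [] = g"
    "\<forall>vs. \<forall>x\<in>U. \<exists>L. (G vs has_derivative L) (at x) \<and> (\<forall>v. L v = G (v # vs) x)"
    using assms(2) unfolding C_infinity_on_def by blast
  show ?thesis unfolding C_infinity_on_def
  proof (intro exI[of _ "\<lambda>vs x. F vs x + G vs x"] conjI allI ballI)
    show "(\<lambda>x. F [] x + G [] x) = (\<lambda>x. f x + g x)" using F(1) G(1) by simp
    fix vs x assume x: "x \<in> U"
    obtain L M where "(F vs has_derivative L) (at x)" "\<forall>v. L v = F (v # vs) x"
      "(G vs has_derivative M) (at x)" "\<forall>v. M v = G (v # vs) x"
      using F(2) G(2) x by blast
    then show "\<exists>L. ((\<lambda>x. F vs x + G vs x) has_derivative L) (at x) \<and> (\<forall>v. L v = F (v # vs) x + G (v # vs) x)"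
      using has_derivative_add[of "F vs" L _ "G vs" M] by (intro exI[of _ "\<lambda>v. L v + M v"]) simp
  qed
qed

lemma norm_axis: "norm (axis i c :: 'a::real_inner^'n) = norm c"
  by (simp add: norm_eq_sqrt_inner inner_axis_axis)

text \<open>Completing the square in the first coordinate centres the domain at (-1/2, 0, 0). The
  ramp vanishes for |z|^2 <= 1/2, so near 0 the unperturbed boundary is flat in the z-directions and
  a disc pays nothing for moving there.\<close>

definition base_fun :: "complex^3 \<Rightarrow> real" where
  "base_fun x = Re (x $ 1) + (cmod (x $ 1))\<^sup>2 + ramp (8 * ((cmod (x $ 2))\<^sup>2 + (cmod (x $ 3))\<^sup>2) - 4)"

definition base_deriv :: "complex^3 \<Rightarrow> complex^3 \<Rightarrow> real" where
  "base_deriv x v = Re (v $ 1) + 2 * (x $ 1 \<bullet> v $ 1) +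
     step (8 * ((cmod (x $ 2))\<^sup>2 + (cmod (x $ 3))\<^sup>2) - 4) * (16 * (x $ 2 \<bullet> v $ 2 + x $ 3 \<bullet> v $ 3))"

lemma base_fun_derivative: "(base_fun has_derivative base_deriv x) (at x)"
proof -
  have nth: "((\<lambda>x :: complex^3. x $ i) has_derivative (\<lambda>v. v $ i)) (at x)" for i
    by (rule bounded_linear_imp_has_derivative[OF bounded_linear_vec_nth])
  have sq: "((\<lambda>x :: complex^3. x $ i \<bullet> x $ i) has_derivative (\<lambda>v. 2 * (x $ i \<bullet> v $ i))) (at x)" for i
    by (rule has_derivative_eq_rhs[OF has_derivative_inner[OF nth nth]]) (simp add: inner_commute)
  have arg: "((\<lambda>x :: complex^3. 8 * (x $ 2 \<bullet> x $ 2 + x $ 3 \<bullet> x $ 3) - 4) has_derivative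
      (\<lambda>v. 16 * (x $ 2 \<bullet> v $ 2 + x $ 3 \<bullet> v $ 3))) (at x)"
    by (rule has_derivative_eq_rhs[OF has_derivative_diff[OF
          has_derivative_mult_right[OF has_derivative_add[OF sq sq]] has_derivative_const]])
      (simp add: algebra_simps)
  have "((\<lambda>x :: complex^3. Re (x $ 1) + x $ 1 \<bullet> x $ 1 + ramp (8 * (x $ 2 \<bullet> x $ 2 + x $ 3 \<bullet> x $ 3) - 4)) has_derivative
      (\<lambda>v. Re (v $ 1) + 2 * (x $ 1 \<bullet> v $ 1) +
        16 * (x $ 2 \<bullet> v $ 2 + x $ 3 \<bullet> v $ 3) * step (8 * (x $ 2 \<bullet> x $ 2 + x $ 3 \<bullet> x $ 3) - 4))) (at x)"
    by (intro has_derivative_add has_derivative_Re nth sq DERIV_compose_FDERIV[OF ramp_deriv arg])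
  then show ?thesis
    by (simp add: base_fun_def[abs_def] base_deriv_def[abs_def] power2_norm_eq_inner mult.commute)
qed

lemma tame_base_fun: "tame UNIV (\<lambda>T. base_fun)"
proof -
  have re: "tame UNIV (\<lambda>T x::complex^3. Re (x $ 1))"
    using ctame_component[of UNIV 1] by (simp add: ctame_def)
  show ?thesis
    unfolding base_fun_def[abs_def]
    by (intro tame_add tame_ramp tame_minus tame_mult tame_const re tame_norm_sq ctame_component open_UNIV)
qed

lemma hol_support_base_fun:
  assumes f: "hol_map f"
  shows "hol_support (\<lambda>z. base_fun (f z)) z"
proof -
  have "hol_support (\<lambda>z. Re (f z $ 1)) z"
    by (intro hol_support_Re[of _ _ 1] hol_map_component f) simp
  moreover have sq: "hol_support (\<lambda>z. (cmod (f z $ i))\<^sup>2) z" for i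
    by (intro hol_support_norm_sq[of _ _ 1] hol_map_component f) simp
  moreover have "hol_support (\<lambda>z. ramp (8 * ((cmod (f z $ 2))\<^sup>2 + (cmod (f z $ 3))\<^sup>2) + - 4)) z"
    by (intro hol_support_ramp hol_support_affine hol_support_add sq) simp
  ultimately show ?thesis
    unfolding base_fun_def by (intro hol_support_add) simp_all
qed

lemma norm_sq_3: "(norm x)\<^sup>2 = (cmod (x $ 1))\<^sup>2 + (cmod (x $ 2))\<^sup>2 + (cmod (x $ 3))\<^sup>2" for x :: "complex^3"
  by (simp add: power2_norm_eq_inner inner_vec_def sum_3)

definition centre :: "complex^3" where
  "centre = axis 1 (- 1 / 2)"

lemma centre_nth: "centre $ 1 = - 1 / 2" "centre $ 2 = 0" "centre $ 3 = 0"
  by (simp_all add: centre_def axis_def)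

lemma base_fun_centre: "base_fun (centre + v) =
    (cmod (v $ 1))\<^sup>2 - 1/4 + ramp (8 * ((cmod (v $ 2))\<^sup>2 + (cmod (v $ 3))\<^sup>2) - 4)"
  unfolding base_fun_def
  by (simp add: centre_nth cmod_power2) (simp add: power2_eq_square field_simps)

lemma base_deriv_centre: "base_deriv (centre + v) v =
    2 * (cmod (v $ 1))\<^sup>2 + step (8 * ((cmod (v $ 2))\<^sup>2 + (cmod (v $ 3))\<^sup>2) - 4)
      * (16 * ((cmod (v $ 2))\<^sup>2 + (cmod (v $ 3))\<^sup>2))"
proof -
  have "Re (v $ 1) + 2 * ((- 1 / 2 + v $ 1) \<bullet> v $ 1) = 2 * (cmod (v $ 1))\<^sup>2"
    by (simp add: inner_complex_def cmod_power2) (simp add: power2_eq_square algebra_simps)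
  then show ?thesis
    by (simp add: base_deriv_def centre_nth power2_norm_eq_inner[symmetric])
qed

lemma norm_centre: "norm centre = 1/2"
proof -
  have "(norm centre)\<^sup>2 = (1/2)\<^sup>2" by (simp add: norm_sq_3 centre_nth)
  then show ?thesis by (subst (asm) power2_eq_iff_nonneg) auto
qed

text \<open>The \<rho>s stand for partial sums of a series \<rho>. A holomorphic minorant need not
  survive a limit, so the maximum principle is applied to them, and \<open>approx\<close> transfers
  the conclusion. The constants 1/16 are what the radial estimates can afford.\<close>

locale perturbed_domain =
  fixes \<rho> :: "complex^3 \<Rightarrow> real" and \<rho>s :: "nat \<Rightarrow> complex^3 \<Rightarrow> real" and \<rho>d :: "complex^3 \<Rightarrow> complex^3 \<Rightarrow> real"
  assumes smooth: "C_infinity_on UNIV \<rho>"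
    and lower: "- 1/16 \<le> \<rho> x"
    and small: "norm x \<le> 2 \<Longrightarrow> \<rho> x \<le> 1/16"
    and derivative: "(\<rho> has_derivative \<rho>d x) (at x)"
    and derivative_small: "norm x \<le> 2 \<Longrightarrow> \<bar>\<rho>d x v\<bar> \<le> norm v / 16"
    and at_0: "\<rho> 0 = 0" "\<rho>d 0 v = 0"
    and approx_support: "hol_map f \<Longrightarrow> hol_support (\<lambda>z. \<rho>s n (f z)) z"
    and approx_continuous: "continuous_on UNIV (\<rho>s n)"
    and approx: "e > 0 \<Longrightarrow> \<exists>n. \<forall>x. norm x \<le> B \<longrightarrow> \<bar>\<rho>s n x - \<rho> x\<bar> \<le> e"
begin

definition defining :: "complex^3 \<Rightarrow> real" where
  "defining x = base_fun x + \<rho> x"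

definition region :: "(complex^3) set" where
  "region = {x. defining x < 0}"

lemma defining_derivative: "(defining has_derivative (\<lambda>v. base_deriv x v + \<rho>d x v)) (at x)"
  unfolding defining_def[abs_def] by (intro has_derivative_add base_fun_derivative derivative)

lemma continuous_defining: "continuous_on S defining"
  by (intro continuous_at_imp_continuous_on ballI has_derivative_continuous[OF defining_derivative])

lemma open_region: "open region"
  unfolding region_def by (intro open_Collect_less continuous_defining continuous_on_const)

lemma defining_along:
  "((\<lambda>t. defining (a + t *\<^sub>R v)) has_real_derivative base_deriv (a + t *\<^sub>R v) v + \<rho>d (a + t *\<^sub>R v) v) (at t)"
proof -
  have "((\<lambda>t. a + t *\<^sub>R v) has_derivative (\<lambda>s. s *\<^sub>R v)) (at t)"
    by (auto intro!: derivative_eq_intros)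
  from has_derivative_compose[OF this defining_derivative]
  have d: "((\<lambda>t. defining (a + t *\<^sub>R v)) has_derivative
      (\<lambda>s. base_deriv (a + t *\<^sub>R v) (s *\<^sub>R v) + \<rho>d (a + t *\<^sub>R v) (s *\<^sub>R v))) (at t)" .
  have "base_deriv (a + t *\<^sub>R v) (s *\<^sub>R v) + \<rho>d (a + t *\<^sub>R v) (s *\<^sub>R v)
      = (base_deriv (a + t *\<^sub>R v) v + \<rho>d (a + t *\<^sub>R v) v) * s" for s
    using linear_cmul[OF has_derivative_linear[OF defining_derivative], of "a + t *\<^sub>R v" s v] by (simp add: mult.commute)
  with d show ?thesis by (simp add: has_field_derivative_def)
qed

text \<open>If |v1|^2 >= 1/16, the first coordinate contributes at least 1/8. Otherwise the ramp is
  at least 1/4 - 1/16 - 1/16 = 1/8, and by convexity its radial derivative is at least its value.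
  Either way \<rho> can take away only 1/16.\<close>

lemma radial_derivative_pos:
  assumes v: "norm v \<le> 1" and r: "defining (centre + v) \<ge> 0"
  shows "base_deriv (centre + v) v + \<rho>d (centre + v) v > 0"
proof -
  define s where "s = (cmod (v $ 2))\<^sup>2 + (cmod (v $ 3))\<^sup>2"
  have s0: "s \<ge> 0" by (simp add: s_def)
  have nv: "(cmod (v $ 1))\<^sup>2 + s = (norm v)\<^sup>2" by (simp add: s_def norm_sq_3)
  have "(norm v)\<^sup>2 \<le> 1" using v by (simp add: abs_square_le_1)
  then have s1: "s \<le> 1" using nv zero_le_power2[of "cmod (v $ 1)"] by linarith
  have n2: "norm (centre + v) \<le> 2" using norm_triangle_ineq[of centre v] norm_centre v by linarith
  have \<rho>d: "\<rho>d (centre + v) v \<ge> - 1/16" using derivative_small[OF n2, of v] v by linarith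
  have \<rho>: "\<rho> (centre + v) \<le> 1/16" using small[OF n2] .
  have r': "(cmod (v $ 1))\<^sup>2 - 1/4 + ramp (8 * s - 4) + \<rho> (centre + v) \<ge> 0"
    using r by (simp add: defining_def base_fun_centre s_def)
  have bd: "base_deriv (centre + v) v = 2 * (cmod (v $ 1))\<^sup>2 + step (8 * s - 4) * (16 * s)"
    by (simp add: base_deriv_centre s_def)
  have st: "step (8 * s - 4) * (16 * s) \<ge> 0" using step_bounds s0 by simp
  show ?thesis
  proof (cases "(cmod (v $ 1))\<^sup>2 \<ge> 1/16")
    case True
    then show ?thesis using bd st \<rho>d by linarith
  next
    case False
    then have ramp: "ramp (8 * s - 4) \<ge> 1/8" using r' \<rho> by linarith
    then have pos: "8 * s - 4 > 0" using ramp_nonpos[of "8 * s - 4"] by fastforce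
    have "0 \<ge> ramp (8 * s - 4) + step (8 * s - 4) * (0 - (8 * s - 4))"
      using ramp_tangent[of "8 * s - 4" 0] by (simp add: ramp_nonpos)
    then have "step (8 * s - 4) * (8 * s - 4) \<ge> 1/8" using ramp by (simp add: algebra_simps)
    moreover have "step (8 * s - 4) * (8 * s - 4) \<le> step (8 * s - 4) * (16 * s)"
      using step_bounds(1) s0 by (intro mult_left_mono) auto
    ultimately show ?thesis using bd \<rho>d zero_le_power2[of "cmod (v $ 1)"] by linarith
  qed
qed

lemma region_near_centre:
  assumes "x \<in> region"
  shows "norm (x - centre) \<le> 1"
proof -
  define v where "v = x - centre"
  have "defining (centre + v) < 0" using assms by (simp add: region_def v_def)
  define s where "s = (cmod (v $ 2))\<^sup>2 + (cmod (v $ 3))\<^sup>2"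
  define a where "a = (cmod (v $ 1))\<^sup>2"
  have "a - 1/4 + ramp (8 * s - 4) < 1/16"
    using \<open>defining (centre + v) < 0\<close> lower[of "centre + v"]
    by (simp add: defining_def base_fun_centre s_def a_def)
  moreover have "(norm v)\<^sup>2 = a + s" by (simp add: norm_sq_3 s_def a_def)
  moreover have "a \<ge> 0" by (simp add: a_def)
  ultimately have "(norm v)\<^sup>2 \<le> 1"
    using ramp_nonneg[of "8 * s - 4"] ramp_ge[of "8 * s - 4"] by argo
  then show ?thesis by (simp add: v_def abs_square_le_1)
qed

lemma bounded_region: "bounded region"
  using region_near_centre by (intro bounded_subset[OF bounded_cball[of centre 1]]) (auto simp: dist_norm norm_minus_commute)

lemma centre_in_region: "centre \<in> region"
proof -
  have "\<rho> centre \<le> 1/16" by (rule small) (simp add: norm_centre)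
  then show ?thesis
    using base_fun_centre[of 0] by (simp add: region_def defining_def ramp_nonpos)
qed

text \<open>If \<open>defining\<close> were nonnegative at some point of the segment, its maximum
  from there on would be nonnegative and attained before the end, but at such a point
  \<open>defining\<close> still increases strictly outwards.\<close>

lemma starlike_region:
  assumes x: "x \<in> region"
  shows "closed_segment centre x \<subseteq> region"
proof (rule ccontr)
  define v where "v = x - centre"
  define h where "h = (\<lambda>t. defining (centre + t *\<^sub>R v))"
  have nv: "norm v \<le> 1" using region_near_centre[OF x] by (simp add: v_def)
  assume "\<not> ?thesis"
  then obtain t where t: "0 \<le> t" "t \<le> 1" "h t \<ge> 0"
  proof -
    obtain y where y: "y \<in> closed_segment centre x" "y \<notin> region" using \<open>\<not> closed_segment centre x \<subseteq> region\<close> by blast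
    then obtain u where u: "0 \<le> u" "u \<le> 1" "y = (1 - u) *\<^sub>R centre + u *\<^sub>R x"
      by (auto simp: closed_segment_def)
    have "y = centre + u *\<^sub>R v" by (simp add: u(3) v_def algebra_simps)
    then show thesis using that[of u] u(1,2) y(2) by (simp add: h_def region_def)
  qed
  have h0: "h 0 < 0" using centre_in_region by (simp add: h_def region_def)
  have h1: "h 1 < 0" using x by (simp add: h_def v_def region_def)
  have deriv: "(h has_real_derivative base_deriv (centre + t *\<^sub>R v) v + \<rho>d (centre + t *\<^sub>R v) v) (at t)" for t
    unfolding h_def by (rule defining_along)
  have "continuous_on {t..1} h"
    by (intro continuous_at_imp_continuous_on ballI DERIV_isCont[OF deriv])
  then obtain m where m: "m \<in> {t..1}" "\<And>s. s \<in> {t..1} \<Longrightarrow> h s \<le> h m"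
    using continuous_attains_sup[of "{t..1}" h] t by auto
  have hm: "h m \<ge> 0" using m(2)[of t] t by simp
  then have m01: "0 < m" "m < 1" using h0 h1 t m(1) by (auto simp: less_le)
  have "norm (m *\<^sub>R v) \<le> 1" using nv m01 by (simp add: mult_le_one)
  then have "base_deriv (centre + m *\<^sub>R v) (m *\<^sub>R v) + \<rho>d (centre + m *\<^sub>R v) (m *\<^sub>R v) > 0"
    using hm by (intro radial_derivative_pos) (auto simp: h_def)
  then have "m * (base_deriv (centre + m *\<^sub>R v) v + \<rho>d (centre + m *\<^sub>R v) v) > 0"
    using linear_cmul[OF has_derivative_linear[OF defining_derivative], of "centre + m *\<^sub>R v" m v] by simp
  then have "base_deriv (centre + m *\<^sub>R v) v + \<rho>d (centre + m *\<^sub>R v) v > 0"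
    using m01 by (simp add: zero_less_mult_iff)
  from DERIV_pos_inc_right[OF deriv this] obtain d where d: "d > 0" "\<And>s. s > 0 \<Longrightarrow> s < d \<Longrightarrow> h m < h (m + s)"
    by blast
  define s where "s = min (d / 2) (1 - m)"
  have "s > 0" "s < d" "m + s \<in> {t..1}" using d(1) m01 m(1) by (auto simp: s_def min_def)
  then show False using d(2)[of s] m(2)[of "m + s"] by simp
qed

lemma is_domain_region: "is_domain region"
  unfolding is_domain_def
proof (intro conjI open_region)
  show "connected region"
    using starlike_region centre_in_region by (intro starlike_imp_connected) (auto simp: starlike_def)
  show "region \<noteq> {}" using centre_in_region by blast
qed

lemma frontier_region:
  assumes "x \<in> frontier region"
  shows "defining x = 0" "norm (x - centre) \<le> 1"
proof -
  have cl: "x \<in> closure region" and nd: "x \<notin> region"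
    using assms open_region by (auto simp: frontier_def interior_open)
  have "closed {x. defining x \<le> 0}"
    by (intro closed_Collect_le continuous_defining continuous_on_const)
  then have "closure region \<subseteq> {x. defining x \<le> 0}"
    by (intro closure_minimal) (auto simp: region_def)
  then show "defining x = 0" using cl nd by (fastforce simp: region_def)
  have "closure region \<subseteq> cball centre 1"
    using region_near_centre by (intro closure_minimal) (auto simp: dist_norm norm_minus_commute)
  then show "norm (x - centre) \<le> 1" using cl by (auto simp: dist_norm norm_minus_commute)
qed

lemma smooth_boundary_region: "smooth_boundary region"
  unfolding smooth_boundary_def
proof (rule exI[of _ UNIV], rule exI[of _ defining], intro conjI ballI)
  show "C_infinity_on UNIV defining"
    unfolding defining_def[abs_def] by (intro C_infinity_on_add C_infinity_on_tame tame_base_fun smooth)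
  fix x assume "x \<in> frontier region"
  then have "base_deriv x (x - centre) + \<rho>d x (x - centre) > 0"
    using radial_derivative_pos[of "x - centre"] frontier_region[of x] by simp
  then have "(\<lambda>v. base_deriv x v + \<rho>d x v) \<noteq> (\<lambda>_. 0)" by (metis less_irrefl)
  then show "\<exists>L. (defining has_derivative L) (at x) \<and> L \<noteq> (\<lambda>_. 0)"
    using defining_derivative by blast
qed (auto simp: region_def)

lemma pseudoconvex_region: "pseudoconvex region"
proof (rule pseudoconvexI[OF is_domain_region])
  show "region \<noteq> UNIV" using bounded_region not_bounded_UNIV by metis
  fix f :: "complex \<Rightarrow> complex^3" assume f: "hol_map f" and circle: "\<And>z. cmod z = 1 \<Longrightarrow> f z \<in> region"
  have cf: "continuous_on S f" for S
    using hol_map_continuous[OF f] by (rule continuous_on_subset) simp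
  have "compact (f ` cball 0 1)" by (intro compact_continuous_image cf compact_cball)
  then obtain B where B: "\<And>z. z \<in> cball 0 1 \<Longrightarrow> norm (f z) \<le> B"
    using compact_imp_bounded bounded_iff by (metis imageI)
  have "continuous_on (sphere 0 1) (\<lambda>z. defining (f z))"
    by (rule continuous_on_compose2[OF continuous_defining[of UNIV] cf]) simp
  then obtain m where m: "cmod m = 1" "\<And>z. cmod z = 1 \<Longrightarrow> defining (f z) \<le> defining (f m)"
    using continuous_attains_sup[of "sphere (0::complex) 1" "\<lambda>z. defining (f z)"] by auto
  \<comment> \<open>A quarter of the margin on the circle: replacing \<rho> by \<rho>s costs e on
    the circle, going back costs e at the centre, and - 2 e is left.\<close>
  define e where "e = - defining (f m) / 4"
  have em: "defining (f m) = - 4 * e" by (simp add: e_def)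
  have e: "e > 0" using circle[OF m(1)] by (simp add: e_def region_def)
  then obtain n where n: "\<And>x. norm x \<le> B \<Longrightarrow> \<bar>\<rho>s n x - \<rho> x\<bar> \<le> e" using approx by blast
  have cb: "continuous_on UNIV base_fun"
    by (intro continuous_at_imp_continuous_on ballI has_derivative_continuous[OF base_fun_derivative])
  have "base_fun (f 0) + \<rho>s n (f 0) \<le> - 3 * e"
  proof (rule max_principle[where u = "\<lambda>z. base_fun (f z) + \<rho>s n (f z)"])
    show "continuous_on (cball 0 1) (\<lambda>z. base_fun (f z) + \<rho>s n (f z))"
      by (intro continuous_intros continuous_on_compose2[OF cb cf]
          continuous_on_compose2[OF approx_continuous cf]) auto
    show "hol_support (\<lambda>z. base_fun (f z) + \<rho>s n (f z)) z" for z
      by (intro hol_support_add hol_support_base_fun approx_support f)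
    fix z :: complex assume z: "cmod z = 1"
    then have "\<bar>\<rho>s n (f z) - \<rho> (f z)\<bar> \<le> e" by (intro n B) simp
    then show "base_fun (f z) + \<rho>s n (f z) \<le> - 3 * e"
      using m(2)[OF z] em unfolding defining_def by linarith
  qed
  moreover have "\<bar>\<rho>s n (f 0) - \<rho> (f 0)\<bar> \<le> e" by (intro n B) simp
  ultimately show "f 0 \<in> region" using e by (simp add: region_def defining_def)
qed

section \<open>The boundary point 0 and its normal\<close>

lemma base_deriv_0: "base_deriv 0 v = Re (v $ 1)"
  by (simp add: base_deriv_def)

lemma defining_0: "defining 0 = 0"
  by (simp add: defining_def base_fun_def at_0 ramp_nonpos)

lemma inward_in_region:
  assumes "Re (v $ 1) < 0"
  obtains d where "d > 0" "\<And>t. 0 < t \<Longrightarrow> t < d \<Longrightarrow> t *\<^sub>R v \<in> region"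
proof -
  have "((\<lambda>t. defining (0 + t *\<^sub>R v)) has_real_derivative Re (v $ 1)) (at 0)"
    using defining_along[of 0 v 0] by (simp add: base_deriv_0 at_0)
  from DERIV_neg_dec_right[OF this assms] show thesis
    using that defining_0 by (auto simp: region_def)
qed

lemma zero_in_frontier: "0 \<in> frontier region"
proof -
  obtain d where d: "d > 0" "\<And>t. 0 < t \<Longrightarrow> t < d \<Longrightarrow> t *\<^sub>R axis 1 (- 1) \<in> region"
    by (rule inward_in_region[of "axis 1 (- 1)"]) auto
  have "0 \<in> closure region"
    unfolding closure_approachable
  proof (intro allI impI)
    fix e :: real assume "e > 0"
    then have "min (d/2) (e/2) > 0" "min (d/2) (e/2) < d" "min (d/2) (e/2) < e" using d(1) by auto
    then show "\<exists>y\<in>region. dist y 0 < e"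
      by (intro bexI[OF _ d(2)[of "min (d/2) (e/2)"]]) (auto simp: norm_axis)
  qed
  moreover have "0 \<notin> region" using defining_0 by (simp add: region_def)
  ultimately show ?thesis using open_region by (simp add: frontier_def interior_open)
qed

text \<open>The definition admits any local function r that is differentiable at 0. Every direction
  v with Re (v $ 1) < 0 enters the domain, so r cannot increase along it and
  \<open>g \<bullet> v \<le> 0\<close>; a vector with this property for a whole open half space is a
  nonnegative multiple of its outer normal.\<close>

lemma outward_unit_normal_0:
  assumes "outward_unit_normal region 0 n"
  shows "n = axis 1 1"
proof -
  obtain U r g where U: "open U" "0 \<in> U" "\<And>z. z \<in> U \<Longrightarrow> z \<in> region \<longleftrightarrow> r z < 0"
    and r: "(r has_derivative (\<lambda>h. g \<bullet> h)) (at 0)" and g: "g \<noteq> 0" "n = (1 / norm g) *\<^sub>R g"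
    using assms unfolding outward_unit_normal_def by blast
  define e :: "complex^3" where "e = axis 1 1"
  have e: "e \<bullet> v = Re (v $ 1)" "v \<bullet> e = Re (v $ 1)" for v
    by (simp_all add: e_def inner_axis inner_axis' inner_commute[of _ "1::complex"] inner_complex_def)
  have ee: "e \<bullet> e = 1" "norm e = 1" by (simp_all add: e_def norm_axis)
  have r0: "r 0 \<ge> 0" using U(2,3) defining_0 by (force simp: region_def)
  have neg: "g \<bullet> v \<le> 0" if v: "Re (v $ 1) < 0" for v
  proof (rule ccontr)
    assume "\<not> g \<bullet> v \<le> 0"
    then have pos: "g \<bullet> v > 0" by simp
    have "((\<lambda>t. t *\<^sub>R v) has_derivative (\<lambda>s. s *\<^sub>R v)) (at 0)" by (auto intro!: derivative_eq_intros)
    from has_derivative_compose[OF this, of r "\<lambda>h. g \<bullet> h"] r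
    have "((\<lambda>t. r (t *\<^sub>R v)) has_real_derivative g \<bullet> v) (at 0)"
      by (simp add: has_field_derivative_def mult_commute_abs)
    from DERIV_pos_inc_right[OF this pos] obtain d1 where
      d1: "d1 > 0" "\<And>s. 0 < s \<Longrightarrow> s < d1 \<Longrightarrow> r 0 < r (s *\<^sub>R v)" by auto
    obtain d2 where d2: "d2 > 0" "\<And>t. 0 < t \<Longrightarrow> t < d2 \<Longrightarrow> t *\<^sub>R v \<in> region"
      by (rule inward_in_region[OF v]) blast
    have "open ((\<lambda>t. t *\<^sub>R v) -` U)" by (intro open_vimage U(1) continuous_intros)
    then obtain d3 where d3: "d3 > 0" "\<And>t. dist t 0 < d3 \<Longrightarrow> t *\<^sub>R v \<in> U"
      using U(2) unfolding open_dist by (metis (no_types, lifting) scaleR_zero_left vimage_eq)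
    define t where "t = min d1 (min d2 d3) / 2"
    have t: "0 < t" "t < d1" "t < d2" "t < d3" using d1(1) d2(1) d3(1) by (auto simp: t_def min_def)
    have "r (t *\<^sub>R v) < 0" using U(3)[of "t *\<^sub>R v"] d2(2) d3(2)[of t] t by simp
    then show False using d1(2)[of t] t r0 by linarith
  qed
  define \<gamma> where "\<gamma> = g \<bullet> e"
  define k where "k = g - \<gamma> *\<^sub>R e"
  have ke: "k \<bullet> e = 0" using ee by (simp add: k_def \<gamma>_def inner_diff_left)
  have gk: "g \<bullet> k = k \<bullet> k" using ke by (simp add: k_def inner_diff_left inner_commute)
  have \<gamma>0: "\<gamma> \<ge> 0" using neg[of "- e"] ee e(2)[of "- e"] by (simp add: \<gamma>_def)
  \<comment> \<open>The vector k - \<eta> e points slightly inward along the tangential part k of g;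
    letting \<eta> be small forces k = 0.\<close>
  have le: "k \<bullet> k \<le> \<eta> * \<gamma>" if "\<eta> > 0" for \<eta>
  proof -
    have "Re ((k - \<eta> *\<^sub>R e) $ 1) = (k - \<eta> *\<^sub>R e) \<bullet> e" by (simp only: e)
    also have "\<dots> = - \<eta>" using ke ee by (simp add: inner_diff_left)
    finally have "g \<bullet> (k - \<eta> *\<^sub>R e) \<le> 0" using that by (intro neg) simp
    then show ?thesis using gk by (simp add: inner_diff_right \<gamma>_def)
  qed
  have "k \<bullet> k \<le> 0"
  proof (rule ccontr)
    assume "\<not> ?thesis"
    then have "k \<bullet> k > 0" by (simp only: not_le)
    with le[of "k \<bullet> k / (\<gamma> + 1)"] \<gamma>0 show False by (simp add: field_simps)
  qed
  then have "k = 0" using inner_ge_zero[of k] by (metis inner_eq_zero_iff order_antisym)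
  then have ge: "g = \<gamma> *\<^sub>R e" by (simp add: k_def)
  then have "\<gamma> > 0" using g(1) \<gamma>0 by (cases "\<gamma> = 0") auto
  then have "n = e" using g(2) ge ee by simp
  then show ?thesis by (simp add: e_def)
qed

end

section \<open>The analytic discs\<close>

lemma eventually_exp_half_le:
  assumes "e > 0"
  shows "\<forall>\<^sub>F L in at_top. K * exp (- (L / 2)) \<le> (e::real)"
proof -
  have "((\<lambda>L::real. exp (- (L / 2))) \<longlongrightarrow> 0) at_top"
  proof (rule filterlim_compose[OF exp_at_bot])
    have "\<forall>\<^sub>F L in at_top. Z \<le> L / (2::real)" for Z
      using eventually_ge_at_top[of "2 * Z"] by eventually_elim simp
    then show "filterlim (\<lambda>L::real. - (L / 2)) at_bot at_top"
      by (simp add: filterlim_uminus_at_bot filterlim_at_top)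
  qed
  then have "((\<lambda>L. K * exp (- (L / 2))) \<longlongrightarrow> 0) at_top"
    using tendsto_mult_right_zero by blast
  then have "\<forall>\<^sub>F L in at_top. K * exp (- (L / 2)) < e" using assms by (rule order_tendstoD(2))
  then show ?thesis by (rule eventually_mono) simp
qed

lemma eventually_ln_le:
  "\<forall>\<^sub>F L in at_top. a * ln L + b \<le> L / (4::real)"
proof -
  have "((\<lambda>L. a * (ln L / L) + b * inverse L) \<longlongrightarrow> a * 0 + b * 0) at_top"
    by (intro tendsto_intros ln_x_over_x_tendsto_0 tendsto_inverse_0_at_top filterlim_ident)
  then have "\<forall>\<^sub>F L in at_top. a * (ln L / L) + b * inverse L < 1/4"
    by (rule order_tendstoD(2)) simp
  then show ?thesis
    using eventually_gt_at_top[of 0] by eventually_elim (simp add: field_simps)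
qed

text \<open>With this growth the disc attached to a level stays, after scaling, where the bumps of all
  earlier levels vanish.\<close>
primrec levels :: "real \<Rightarrow> nat \<Rightarrow> real" where
  "levels \<Lambda> 0 = \<Lambda>"
| "levels \<Lambda> (Suc n) = 4 * levels \<Lambda> n ^ 4"

context
  fixes \<Lambda> :: real
  assumes \<Lambda>: "\<Lambda> \<ge> 2"
begin

lemma levels_ge_2: "levels \<Lambda> n \<ge> 2"
proof (induction n)
  case (Suc n)
  have "levels \<Lambda> n ^ 1 \<le> levels \<Lambda> n ^ 4" using Suc by (intro power_increasing) auto
  then show ?case using Suc by simp
qed (use \<Lambda> in simp)

lemma levels_gap: "levels \<Lambda> n + 2 \<le> levels \<Lambda> (Suc n)"
proof -
  have "levels \<Lambda> n ^ 1 \<le> levels \<Lambda> n ^ 4" using levels_ge_2[of n] by (intro power_increasing) auto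
  then show ?thesis using levels_ge_2[of n] by simp
qed

lemma levels_mono: "i \<le> j \<Longrightarrow> levels \<Lambda> i \<le> levels \<Lambda> j"
proof (rule lift_Suc_mono_le)
  show "levels \<Lambda> n \<le> levels \<Lambda> (Suc n)" for n using levels_gap[of n] by linarith
qed

lemma levels_ge: "\<Lambda> \<le> levels \<Lambda> n"
  using levels_mono[of 0 n] by simp

lemma levels_ge_nat: "real n \<le> levels \<Lambda> n"
proof (induction n)
  case 0
  then show ?case using \<Lambda> by simp
next
  case (Suc n)
  then show ?case using levels_gap[of n] by simp
qed

lemma levels_at_top: "filterlim (levels \<Lambda>) at_top sequentially"
  by (rule filterlim_at_top_mono[OF filterlim_real_sequentially]) (simp add: levels_ge_nat)

lemma levels_tail_sum:
  assumes "\<And>n. \<bar>f (levels \<Lambda> n)\<bar> \<le> C * exp (- (levels \<Lambda> n / 2))" "C \<ge> 0"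
  shows "summable (\<lambda>n. f (levels \<Lambda> n))"
    and "\<bar>\<Sum>i. f (levels \<Lambda> (i + N))\<bar> \<le> 2 * C * exp (- (levels \<Lambda> N / 2))"
proof -
  have gap: "levels \<Lambda> (n + N) + 2 \<le> levels \<Lambda> (Suc n + N)" for n N using levels_gap by simp
  have s: "summable (\<lambda>n. exp (- (levels \<Lambda> (n + N) / 2)))" for N
    using exp_gap_sum(1)[of "\<lambda>n. levels \<Lambda> (n + N)"] gap by blast
  show "summable (\<lambda>n. f (levels \<Lambda> n))"
    using suminf_abs_le_weights(1)[OF assms(1)] s[of 0] by simp
  have "\<bar>\<Sum>i. f (levels \<Lambda> (i + N))\<bar> \<le> C * (\<Sum>n. exp (- (levels \<Lambda> (n + N) / 2)))"
    by (rule suminf_abs_le_weights(2)[OF assms(1) s])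
  also have "\<dots> \<le> C * (2 * exp (- (levels \<Lambda> (0 + N) / 2)))"
    using exp_gap_sum(2)[of "\<lambda>n. levels \<Lambda> (n + N)"] gap assms(2) by (intro mult_left_mono) blast+
  finally show "\<bar>\<Sum>i. f (levels \<Lambda> (i + N))\<bar> \<le> 2 * C * exp (- (levels \<Lambda> N / 2))" by simp
qed

end

text \<open>All constants belong to the family of bumps and are fixed before any level is chosen.
  Each requirement holds for large L, so one starting level \<Lambda> meets them all.\<close>

lemma exists_perturbed_domain:
  fixes \<alpha> :: real
  assumes \<alpha>: "\<alpha> > 0"
  obtains m C \<Lambda> \<rho> \<rho>s \<rho>d where
    "\<alpha> + 1 \<le> real m" "\<Lambda> \<ge> 2" "perturbed_domain \<rho> \<rho>s \<rho>d"
    "\<And>x. \<rho> x = (\<Sum>n. bump \<alpha> m (levels \<Lambda> n) x)"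
    "\<And>L x. L \<ge> 1 \<Longrightarrow> norm x \<le> 2 \<Longrightarrow> \<bar>bump \<alpha> m L x\<bar> \<le> C * exp (- (L / 2))"
    "C \<ge> 0"
    "\<And>L. L \<ge> \<Lambda> \<Longrightarrow> 27 * real m * ln L + 16 \<le> L / 4"
    "\<And>L. L \<ge> \<Lambda> \<Longrightarrow> 8 * C * exp (- L) \<le> 1"
    "\<And>L. L \<ge> \<Lambda> \<Longrightarrow> 16 * (exp (- L) * (L powr \<alpha>)\<^sup>2) \<le> 1"
proof -
  define m where "m = nat \<lceil>\<alpha>\<rceil> + 1"
  have m: "\<alpha> + 1 \<le> real m" using \<alpha> by (simp add: m_def)
  then have am: "\<alpha> \<le> real m" by simp
  obtain F where F: "rapid_family F" "\<And>L x. L \<ge> 1 \<Longrightarrow> F [] L x = bump \<alpha> m L x"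
    using bump_rapid[OF am] by blast
  have bnd: "\<exists>C\<ge>0. \<forall>L\<ge>1. \<forall>x. norm x \<le> B \<longrightarrow> \<bar>bump \<alpha> m L x\<bar> \<le> C * exp (- (L / 2))" for B
  proof -
    obtain C where "C \<ge> 0" "\<forall>L\<ge>1. \<forall>x. norm x \<le> B \<longrightarrow> \<bar>F [] L x\<bar> \<le> C * exp (- (L / 2))"
      using F(1) unfolding rapid_family_def by blast
    then show ?thesis using F(2) by (intro exI[of _ C]) simp
  qed
  obtain C where C: "C \<ge> 0"
    "\<And>L x. L \<ge> 1 \<Longrightarrow> norm x \<le> 2 \<Longrightarrow> \<bar>bump \<alpha> m L x\<bar> \<le> C * exp (- (L / 2))"
    using bnd[of 2] by blast
  obtain C1 where C1: "C1 \<ge> 0"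
    "\<And>L x h. L \<ge> 1 \<Longrightarrow> norm x \<le> 2 \<Longrightarrow> \<bar>F [h] L x\<bar> \<le> C1 * norm h * exp (- (L / 2))"
    by (rule rapid_family_bound_derivative[OF F(1), of 2 "[]"]) blast
  obtain C2 where C2: "C2 \<ge> 0" "\<And>L x. L \<ge> 1 \<Longrightarrow> bump \<alpha> m L x \<ge> - (C2 * exp (- (L / 2)))"
    by (rule bump_ge[OF am]) blast
  obtain K where K: "K \<ge> 0" "\<And>L. L \<ge> (0::real) \<Longrightarrow> L ^ (2 * m) * exp (- L) \<le> K * exp (- (L / 2))"
    using power_exp_half[of "2 * m"] by blast
  \<comment> \<open>In this order: error of a bump on its own disc, later levels on that disc, upper
    bound of \<rho>, bound of its derivative, lower bound of \<rho>, and |w|^2 on the disc.\<close>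
  obtain \<Lambda>0 where \<Lambda>0: "\<And>L. L \<ge> \<Lambda>0 \<Longrightarrow> 27 * real m * ln L + 16 \<le> L / 4 \<and> 8 * C * exp (- (L / 2)) \<le> 1 \<and>
      2 * C * exp (- (L / 2)) \<le> 1/16 \<and> 2 * C1 * exp (- (L / 2)) \<le> 1/16 \<and>
      2 * C2 * exp (- (L / 2)) \<le> 1/16 \<and> 16 * K * exp (- (L / 2)) \<le> 1"
  proof -
    have "\<forall>\<^sub>F L in at_top. 27 * real m * ln L + 16 \<le> L / 4 \<and> 8 * C * exp (- (L / 2)) \<le> 1 \<and>
      2 * C * exp (- (L / 2)) \<le> 1/16 \<and> 2 * C1 * exp (- (L / 2)) \<le> 1/16 \<and>
      2 * C2 * exp (- (L / 2)) \<le> 1/16 \<and> 16 * K * exp (- (L / 2)) \<le> 1"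
      by (intro eventually_conj eventually_exp_half_le eventually_ln_le) auto
    then show thesis using that unfolding eventually_at_top_linorder by blast
  qed
  define \<Lambda> where "\<Lambda> = max 2 \<Lambda>0"
  have \<Lambda>: "\<Lambda> \<ge> 2" by (simp add: \<Lambda>_def)
  have \<Lambda>0\<Lambda>: "\<Lambda>0 \<le> \<Lambda>" by (simp add: \<Lambda>_def)
  define L where "L = levels \<Lambda>"
  have L1: "L n \<ge> 1" for n using levels_ge_2[OF \<Lambda>, of n] by (simp add: L_def)
  have gap: "L n + 2 \<le> L (Suc n)" for n using levels_gap[OF \<Lambda>, of n] by (simp add: L_def)
  have L0: "L 0 = \<Lambda>" by (simp add: L_def)
  define \<rho> where "\<rho> = (\<lambda>x. \<Sum>n. bump \<alpha> m (L n) x)"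
  define \<rho>s where "\<rho>s = (\<lambda>N x. \<Sum>n<N. bump \<alpha> m (L n) x)"
  define \<rho>d where "\<rho>d = (\<lambda>x v. \<Sum>n. F [v] (L n) x)"
  have \<rho>F: "\<rho> = (\<lambda>x. \<Sum>n. F [] (L n) x)" using F(2)[OF L1] by (simp add: \<rho>_def)
  have bsum: "summable (\<lambda>n. bump \<alpha> m (L n) x)" for x
    using rapid_family_series(1)[where L = L, OF F(1) L1 gap, where vs = "[]" and x = x] F(2)[OF L1] by simp
  have bd: "(bump \<alpha> m l has_derivative (\<lambda>v. F [v] l x)) (at x)" if "l \<ge> 1" for l x
  proof -
    have "F [] l = bump \<alpha> m l" using F(2)[OF that] by auto
    moreover have "(F [] l has_derivative (\<lambda>v. F [v] l x)) (at x)"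
      using F(1) that unfolding rapid_family_def by blast
    ultimately show ?thesis by simp
  qed
  have "perturbed_domain \<rho> \<rho>s \<rho>d"
  proof
    show "C_infinity_on UNIV \<rho>"
      unfolding C_infinity_on_def
    proof (intro exI[of _ "\<lambda>vs x. \<Sum>n. F vs (L n) x"] conjI allI ballI)
      show "(\<lambda>x. \<Sum>n. F [] (L n) x) = \<rho>" by (simp add: \<rho>F)
      show "\<exists>D. ((\<lambda>x. \<Sum>n. F vs (L n) x) has_derivative D) (at x) \<and> (\<forall>v. D v = (\<Sum>n. F (v # vs) (L n) x))" for vs x
        using rapid_family_series(2)[where L = L, OF F(1) L1 gap, where vs = vs and x = x] by blast
    qed
    fix x :: "complex^3"
    show "- 1/16 \<le> \<rho> x"
    proof -
      have w: "summable (\<lambda>n. exp (- (L n / 2)))" using exp_gap_sum(1)[of L] gap by blast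
      have "(\<Sum>n. - C2 * exp (- (L n / 2))) \<le> \<rho> x"
        unfolding \<rho>_def using C2(2)[OF L1] by (intro suminf_le bsum summable_mult w) simp
      moreover have "(\<Sum>n. - C2 * exp (- (L n / 2))) = - (C2 * (\<Sum>n. exp (- (L n / 2))))"
        using suminf_mult[OF w, of "- C2"] by simp
      moreover have "C2 * (\<Sum>n. exp (- (L n / 2))) \<le> C2 * (2 * exp (- (L 0 / 2)))"
        using exp_gap_sum(2)[of L] gap C2(1) by (intro mult_left_mono) blast+
      moreover have "2 * C2 * exp (- (\<Lambda> / 2)) \<le> 1/16" using \<Lambda>0[OF \<Lambda>0\<Lambda>] by blast
      ultimately show ?thesis by (simp add: L0)
    qed
    show "\<rho> x \<le> 1/16" if "norm x \<le> 2"
    proof -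
      have "\<bar>\<Sum>i. bump \<alpha> m (levels \<Lambda> (i + 0)) x\<bar> \<le> 2 * C * exp (- (levels \<Lambda> 0 / 2))"
        by (rule levels_tail_sum(2)[OF \<Lambda>, of "\<lambda>l. bump \<alpha> m l x"])
           (use C that L1 in \<open>auto simp: L_def\<close>)
      moreover have "2 * C * exp (- (\<Lambda> / 2)) \<le> 1/16" using \<Lambda>0[OF \<Lambda>0\<Lambda>] by blast
      ultimately show ?thesis by (simp add: \<rho>_def L_def)
    qed
    show "(\<rho> has_derivative \<rho>d x) (at x)"
      unfolding \<rho>F \<rho>d_def by (rule rapid_family_series(2)[where L = L, OF F(1) L1 gap])
    show "\<bar>\<rho>d x v\<bar> \<le> norm v / 16" if "norm x \<le> 2" for v
    proof -
      have "\<bar>\<Sum>i. F [v] (levels \<Lambda> (i + 0)) x\<bar> \<le> 2 * (C1 * norm v) * exp (- (levels \<Lambda> 0 / 2))"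
        by (rule levels_tail_sum(2)[OF \<Lambda>, of "\<lambda>l. F [v] l x"])
           (use C1 that L1 in \<open>auto simp: L_def\<close>)
      moreover have "2 * C1 * exp (- (\<Lambda> / 2)) \<le> 1/16" using \<Lambda>0[OF \<Lambda>0\<Lambda>] by blast
      then have "norm v * (2 * C1 * exp (- (\<Lambda> / 2))) \<le> norm v * (1/16)" by (intro mult_left_mono) auto
      ultimately show ?thesis by (simp add: \<rho>d_def L_def mult_ac)
    qed
    show "\<rho> 0 = 0" using bump_zero[of 0 0, OF _ _ _ L1] by (simp add: \<rho>_def)
    show "\<rho>d 0 v = 0" for v
    proof -
      \<comment> \<open>The ball on which a bump vanishes shrinks with \<open>l\<close>, so the
        derivative at 0 is computed term by term.\<close>
      have "F [v] l 0 = 0" if l: "l \<ge> 1" for l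
      proof -
        have pos: "l ^ (4 * m) > 0" using l by simp
        have "((\<lambda>x. 0) has_derivative (\<lambda>v. F [v] l 0)) (at 0)"
        proof (rule has_derivative_transform_within_open[OF bd[OF l] open_ball])
          show "(0::complex^3) \<in> ball 0 (1 / (2 * l ^ (4 * m)))" using pos by simp
          fix x :: "complex^3" assume x: "x \<in> ball 0 (1 / (2 * l ^ (4 * m)))"
          have "l ^ (4 * m) * norm x \<le> 1/2" using x pos by (simp add: field_simps)
          then show "bump \<alpha> m l x = 0"
            by (intro bump_zero[OF Finite_Cartesian_Product.norm_nth_le Finite_Cartesian_Product.norm_nth_le _ l])
        qed
        then have "(\<lambda>v. F [v] l 0) = (\<lambda>v. 0)" by (rule has_derivative_unique) (rule has_derivative_const)
        then show ?thesis by metis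
      qed
      then show ?thesis using L1 by (simp add: \<rho>d_def)
    qed
    show "hol_support (\<lambda>z. \<rho>s n (f z)) z" if "hol_map f" for f n z
      unfolding \<rho>s_def using that L1 by (intro hol_support_sum hol_support_bump) auto
    show "continuous_on UNIV (\<rho>s n)" for n
      unfolding \<rho>s_def
      by (intro continuous_on_sum continuous_at_imp_continuous_on ballI has_derivative_continuous[OF bd] L1)
    show "\<exists>n. \<forall>x. norm x \<le> B \<longrightarrow> \<bar>\<rho>s n x - \<rho> x\<bar> \<le> e" if e: "e > 0" for e B
    proof -
      obtain K' where K': "K' \<ge> 0"
        "\<And>L x. L \<ge> 1 \<Longrightarrow> norm x \<le> B \<Longrightarrow> \<bar>bump \<alpha> m L x\<bar> \<le> K' * exp (- (L / 2))"
        using bnd[of B] by blast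
      have "\<forall>\<^sub>F n in sequentially. 2 * K' * exp (- (levels \<Lambda> n / 2)) \<le> e"
        by (rule eventually_compose_filterlim[OF eventually_exp_half_le[OF e] levels_at_top[OF \<Lambda>]])
      then obtain n where n: "2 * K' * exp (- (levels \<Lambda> n / 2)) \<le> e"
        using eventually_happens by force
      have "\<bar>\<rho>s n x - \<rho> x\<bar> \<le> e" if "norm x \<le> B" for x
      proof -
        have "\<bar>\<Sum>i. bump \<alpha> m (levels \<Lambda> (i + n)) x\<bar> \<le> 2 * K' * exp (- (levels \<Lambda> n / 2))"
          by (rule levels_tail_sum(2)[OF \<Lambda>, of "\<lambda>l. bump \<alpha> m l x"])
             (use K' that L1 in \<open>auto simp: L_def\<close>)
        moreover have "\<rho> x = (\<Sum>i. bump \<alpha> m (L (i + n)) x) + \<rho>s n x"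
          unfolding \<rho>_def \<rho>s_def by (rule suminf_split_initial_segment[OF bsum])
        ultimately show ?thesis using n by (simp add: L_def)
      qed
      then show ?thesis by blast
    qed
  qed
  moreover have "27 * real m * ln l + 16 \<le> l / 4" if "l \<ge> \<Lambda>" for l
    using \<Lambda>0[of l] that \<Lambda>0\<Lambda> by simp
  moreover have "8 * C * exp (- l) \<le> 1" if "l \<ge> \<Lambda>" for l
  proof -
    have "8 * C * exp (- l) \<le> 8 * C * exp (- (l / 2))" using C(1) that \<Lambda> by (intro mult_left_mono) auto
    then show ?thesis using \<Lambda>0[of l] that \<Lambda>0\<Lambda> by linarith
  qed
  moreover have "16 * (exp (- l) * (l powr \<alpha>)\<^sup>2) \<le> 1" if l: "l \<ge> \<Lambda>" for l
  proof -
    have "l powr \<alpha> \<le> l powr real m" using l \<Lambda> am by (intro powr_mono) auto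
    then have "l powr \<alpha> \<le> l ^ m" using l \<Lambda> by (simp add: powr_realpow)
    then have "(l powr \<alpha>)\<^sup>2 \<le> (l ^ m)\<^sup>2" by (intro power_mono) auto
    then have "(l powr \<alpha>)\<^sup>2 \<le> l ^ (2 * m)" by (simp add: power_mult[symmetric] mult.commute)
    then have "exp (- l) * (l powr \<alpha>)\<^sup>2 \<le> exp (- l) * l ^ (2 * m)" by (intro mult_left_mono) auto
    also have "\<dots> \<le> K * exp (- (l / 2))" using K(2)[of l] l \<Lambda> by (simp add: mult.commute)
    finally show ?thesis using \<Lambda>0[of l] l \<Lambda>0\<Lambda> by simp
  qed
  ultimately show thesis
    using that[of m \<Lambda> \<rho> \<rho>s \<rho>d C] m \<Lambda> C by (simp add: \<rho>_def L_def)
qed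

theorem theorem3:
  fixes \<alpha> :: real
  assumes "\<alpha> > 0"
  shows "\<exists>(D :: (complex^3) set) P (\<delta> :: nat \<Rightarrow> real).
           bounded D \<and> pseudoconvex D \<and> smooth_boundary D \<and> P \<in> frontier D \<and>
           (\<forall>\<nu>. 0 < \<delta> \<nu> \<and> \<delta> \<nu> < 1 \<and> \<delta> (Suc \<nu>) < \<delta> \<nu>) \<and> \<delta> \<longlonglongrightarrow> 0 \<and>
           (\<forall>n. outward_unit_normal D P n \<longrightarrow>
              (\<forall>\<nu>. P - \<delta> \<nu> *\<^sub>R n \<in> D \<and>
                   kobayashi_royden D (P - \<delta> \<nu> *\<^sub>R n) n
                     \<le> 1 / (\<delta> \<nu> * (- ln (\<delta> \<nu>)) powr \<alpha>)))"
proof -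
  obtain m C \<Lambda> \<rho> \<rho>s \<rho>d where m: "\<alpha> + 1 \<le> real m" and \<Lambda>: "\<Lambda> \<ge> 2" and pd: "perturbed_domain \<rho> \<rho>s \<rho>d"
    and \<rho>: "\<And>x. \<rho> x = (\<Sum>n. bump \<alpha> m (levels \<Lambda> n) x)"
    and C: "\<And>L x. L \<ge> 1 \<Longrightarrow> norm x \<le> 2 \<Longrightarrow> \<bar>bump \<alpha> m L x\<bar> \<le> C * exp (- (L / 2))" "C \<ge> 0"
    and l1: "\<And>L. L \<ge> \<Lambda> \<Longrightarrow> 27 * real m * ln L + 16 \<le> L / 4"
    and l2: "\<And>L. L \<ge> \<Lambda> \<Longrightarrow> 8 * C * exp (- L) \<le> 1"
    and l3: "\<And>L. L \<ge> \<Lambda> \<Longrightarrow> 16 * (exp (- L) * (L powr \<alpha>)\<^sup>2) \<le> 1"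
    by (rule exists_perturbed_domain[OF assms], rule that; assumption)
  interpret perturbed_domain \<rho> \<rho>s \<rho>d by (rule pd)
  define l where "l = levels \<Lambda>"
  define e :: "complex^3" where "e = axis 1 1"
  have e_nth: "e $ 1 = 1" "e $ 2 = 0" "e $ 3 = 0" by (simp_all add: e_def axis_def)
  define R where "R = (\<lambda>\<nu>. exp (- l \<nu>) * l \<nu> powr \<alpha>)"
  \<comment> \<open>The curve parameter is s = l^m z, and the normal speed is R = \<delta>
    l^\<alpha>. The other coordinates begin with z^2 and z^3, so the velocity at the centre is
    purely normal.\<close>
  define disc where "disc = (\<lambda>\<nu> z. vector [of_real (- exp (- l \<nu>)) + of_real (R \<nu>) * z,
     of_real (l \<nu> ^ m) ^ 2 * z ^ 2 / of_real (l \<nu> ^ (4 * m)),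
     of_real (l \<nu> ^ m) ^ 3 * z ^ 3 / of_real (l \<nu> ^ (4 * m))] :: complex^3)"
  have m1: "m \<ge> 1" using m assms by linarith
  have l_ge: "l \<nu> \<ge> 2" "l \<nu> \<ge> \<Lambda>" for \<nu>
    using levels_ge_2[OF \<Lambda>] levels_ge[OF \<Lambda>] by (simp_all add: l_def)
  have R: "R \<nu> > 0" "exp (- l \<nu>) \<le> R \<nu>" "4 * (R \<nu>)\<^sup>2 \<le> exp (- l \<nu>) / 4" for \<nu>
  proof -
    have "1 \<le> l \<nu> powr \<alpha>" using l_ge(1)[of \<nu>] assms by (intro ge_one_powr_ge_zero) auto
    then show "exp (- l \<nu>) \<le> R \<nu>" by (simp add: R_def)
    show "R \<nu> > 0" using l_ge(1)[of \<nu>] by (simp add: R_def)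
    have "16 * (R \<nu>)\<^sup>2 = exp (- l \<nu>) * (16 * (exp (- l \<nu>) * (l \<nu> powr \<alpha>)\<^sup>2))"
      by (simp add: R_def power2_eq_square)
    also have "\<dots> \<le> exp (- l \<nu>) * 1" using l3[OF l_ge(2)] by (intro mult_left_mono) auto
    finally show "4 * (R \<nu>)\<^sup>2 \<le> exp (- l \<nu>) / 4" by simp
  qed
  \<comment> \<open>The terms R Re z from w and - R Re z from the bump cancel. Out of - d, each of
    |w|^2, the error of the bump and the later levels uses d/4, which leaves - d/4.\<close>
  have disc_in: "disc \<nu> z \<in> region" if z: "cmod z < 1" for \<nu> z
  proof -
    define x where "x = disc \<nu> z"
    define t where "t = l \<nu> ^ m"
    define d where "d = exp (- l \<nu>)"
    have d1: "d \<le> 1" "d > 0" using l_ge(1)[of \<nu>] by (simp_all add: d_def)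
    have x_nth: "x $ 1 = of_real (- d) + of_real (R \<nu>) * z"
        "x $ 2 = of_real (l \<nu> ^ m) ^ 2 * z ^ 2 / of_real (l \<nu> ^ (4 * m))"
        "x $ 3 = of_real (l \<nu> ^ m) ^ 3 * z ^ 3 / of_real (l \<nu> ^ (4 * m))"
      by (simp_all add: x_def disc_def d_def)
    have "(2::real) ^ 1 \<le> 2 ^ m" using m1 by (intro power_increasing) auto
    also have "2 ^ m \<le> t" unfolding t_def using l_ge(1) by (intro power_mono) auto
    finally have t2: "t \<ge> 2" by simp
    have t4: "l \<nu> ^ (4 * m) = t ^ 4" by (simp add: t_def power_mult[symmetric] mult.commute)
    have zp: "cmod z ^ k \<le> 1" for k using z by (intro power_le_one) auto
    have "cmod (x $ 2) = t ^ 2 * cmod z ^ 2 / t ^ 4"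
      using t2 by (simp add: x_nth t4 norm_mult norm_divide norm_power flip: t_def)
    also have "\<dots> \<le> t ^ 2 * 1 / t ^ 4" using zp t2 by (intro divide_right_mono mult_left_mono) auto
    also have "\<dots> \<le> 1 / t"
      using t2 power_increasing[of 3 4 t] by (simp add: field_simps power_add[symmetric] power2_eq_square power3_eq_cube)
    finally have x2: "cmod (x $ 2) \<le> 1 / t" .
    have "cmod (x $ 3) = t ^ 3 * cmod z ^ 3 / t ^ 4"
      using t2 by (simp add: x_nth t4 norm_mult norm_divide norm_power flip: t_def)
    also have "\<dots> \<le> t ^ 3 * 1 / t ^ 4" using zp t2 by (intro divide_right_mono mult_left_mono) auto
    also have "\<dots> = 1 / t" using t2 by (simp add: field_simps power4_eq_xxxx power3_eq_cube)
    finally have x3: "cmod (x $ 3) \<le> 1 / t" .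
    have t_half: "1 / t \<le> 1 / 2" using t2 by (simp add: field_simps)
    have sq: "(cmod (x $ 2))\<^sup>2 \<le> 1/4" "(cmod (x $ 3))\<^sup>2 \<le> 1/4"
      using power_mono[of "cmod (x $ 2)" "1/2" 2] power_mono[of "cmod (x $ 3)" "1/2" 2] x2 x3 t_half
      by (auto simp: power2_eq_square)
    have "cmod (x $ 1) \<le> d + R \<nu> * cmod z"
      using norm_triangle_ineq[of "of_real (- d)" "of_real (R \<nu>) * z"] d1 R(1)[of \<nu>] by (simp add: x_nth norm_mult)
    also have "\<dots> \<le> R \<nu> + R \<nu> * 1"
      using R(1,2)[of \<nu>] z by (intro add_mono mult_left_mono) (auto simp: d_def)
    finally have "(cmod (x $ 1))\<^sup>2 \<le> (2 * R \<nu>)\<^sup>2" by (intro power_mono) auto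
    then have w: "(cmod (x $ 1))\<^sup>2 \<le> d / 4" using R(3)[of \<nu>] by (simp add: power_mult_distrib d_def)
    have "(norm x)\<^sup>2 \<le> 2\<^sup>2" using w sq d1 by (simp add: norm_sq_3)
    then have nx: "norm x \<le> 2" by (rule power2_le_imp_le) simp
    have "ramp (8 * ((cmod (x $ 2))\<^sup>2 + (cmod (x $ 3))\<^sup>2) - 4) = 0"
      using sq by (intro ramp_nonpos) simp
    then have base: "base_fun x \<le> - d + R \<nu> * Re z + d / 4"
      using w by (simp add: base_fun_def x_nth(1))
    have early: "bump \<alpha> m (l i) x = 0" if i: "i < \<nu>" for i
    proof (rule bump_zero[OF x2 x3])
      show "1 \<le> l i" using l_ge(1)[of i] by simp
      \<comment> \<open>The recursion for \<open>levels\<close> matches the dilation: its m-th power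
        compares \<open>l i ^ (4 * m)\<close> with t, and 1/t bounds the z-coordinates of the
        disc.\<close>
      have "4 * l i ^ 4 \<le> l \<nu>" using levels_mono[OF \<Lambda>, of "Suc i" \<nu>] i by (simp add: l_def)
      then have "(4 * l i ^ 4) ^ m \<le> t" unfolding t_def using l_ge(1)[of i] by (intro power_mono) auto
      then have "4 ^ m * l i ^ (4 * m) \<le> t" by (simp add: power_mult_distrib power_mult)
      moreover have "(4::real) ^ 1 \<le> 4 ^ m" using m1 by (intro power_increasing) auto
      then have "4 * l i ^ (4 * m) \<le> 4 ^ m * l i ^ (4 * m)" using l_ge(1)[of i] by (intro mult_right_mono) auto
      moreover have "l i ^ (4 * m) > 0" using l_ge(1)[of i] by simp
      ultimately have "2 * l i ^ (4 * m) \<le> t" by linarith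
      then show "l i ^ (4 * m) * (1 / t) \<le> 1 / 2" using t2 by (simp add: field_simps)
    qed
    have own: "bump \<alpha> m (l \<nu>) x \<le> - (R \<nu> * Re z) + d / 4"
      unfolding R_def d_def
      by (rule bump_curve[OF m _ z l1[OF l_ge(2)] x_nth(2,3)]) (use l_ge(1)[of \<nu>] in simp)
    have Cl: "\<bar>bump \<alpha> m (levels \<Lambda> n) x\<bar> \<le> C * exp (- (levels \<Lambda> n / 2))" for n
      using C(1)[OF _ nx] levels_ge_2[OF \<Lambda>, of n] by simp
    have summ: "summable (\<lambda>n. bump \<alpha> m (l n) x)"
      unfolding l_def using levels_tail_sum(1)[OF \<Lambda>, of "\<lambda>L. bump \<alpha> m L x", OF Cl C(2)] .
    have "\<bar>\<Sum>i. bump \<alpha> m (l (i + Suc \<nu>)) x\<bar> \<le> 2 * C * exp (- (l (Suc \<nu>) / 2))"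
      unfolding l_def using levels_tail_sum(2)[OF \<Lambda>, of "\<lambda>L. bump \<alpha> m L x", OF Cl C(2)] .
    \<comment> \<open>The next level is at least four times this one, so half of it still gives the
      square of d; one factor d then absorbs C.\<close>
    also have "\<dots> \<le> 2 * C * (d * d)"
    proof -
      have "l \<nu> ^ 1 \<le> l \<nu> ^ 4" using l_ge(1)[of \<nu>] by (intro power_increasing) auto
      then have "exp (- (l (Suc \<nu>) / 2)) \<le> exp (- l \<nu> + - l \<nu>)" by (simp add: l_def)
      also have "\<dots> = d * d" unfolding d_def by (rule exp_add)
      finally show ?thesis using C(2) by (intro mult_left_mono) auto
    qed
    also have "\<dots> = (8 * C * exp (- l \<nu>)) * d / 4" by (simp add: d_def)
    also have "\<dots> \<le> 1 * d / 4" using l2[OF l_ge(2), of \<nu>] d1 by (intro divide_right_mono mult_right_mono) auto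
    finally have late: "\<bar>\<Sum>i. bump \<alpha> m (l (i + Suc \<nu>)) x\<bar> \<le> d / 4" by simp
    have "\<rho> x = (\<Sum>i. bump \<alpha> m (l (i + Suc \<nu>)) x) + (\<Sum>i<Suc \<nu>. bump \<alpha> m (l i) x)"
      unfolding \<rho> l_def by (rule suminf_split_initial_segment[OF summ[unfolded l_def]])
    also have "(\<Sum>i<Suc \<nu>. bump \<alpha> m (l i) x) = bump \<alpha> m (l \<nu>) x" using early by simp
    finally have "\<rho> x \<le> - (R \<nu> * Re z) + d / 2" using own late by linarith
    then show ?thesis using base d1 by (simp add: region_def defining_def flip: x_def)
  qed
  have disc_0: "disc \<nu> 0 = 0 - exp (- l \<nu>) *\<^sub>R e" for \<nu>
    by (simp add: vec_eq_iff forall_3 disc_def e_nth scaleR_conv_of_real[where 'a = complex])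
  have disc_d: "disc_deriv0 (disc \<nu>) = R \<nu> *\<^sub>R e" for \<nu>
  proof -
    have "deriv (\<lambda>z. of_real (- exp (- l \<nu>)) + of_real (R \<nu>) * z) 0 = of_real (R \<nu>)"
      by (rule DERIV_imp_deriv) (auto intro!: derivative_eq_intros)
    moreover have "deriv (\<lambda>z::complex. a * z ^ k / b) 0 = 0" if "k \<ge> 2" "b \<noteq> 0" for a b k
      by (rule DERIV_imp_deriv) (use that in \<open>auto intro!: derivative_eq_intros\<close>)
    moreover have "l \<nu> \<noteq> 0" using l_ge(1)[of \<nu>] by simp
    ultimately show ?thesis
      by (simp add: disc_deriv0_def vec_eq_iff forall_3 disc_def e_nth scaleR_conv_of_real[where 'a = complex])
  qed
  have holo: "holo_disc (disc \<nu>) region" for \<nu>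
    unfolding holo_disc_def
  proof (intro conjI)
    show "\<forall>i. (\<lambda>w. disc \<nu> w $ i) holomorphic_on ball 0 1"
      unfolding forall_3 disc_def using l_ge(1)[of \<nu>] by (auto intro!: holomorphic_intros)
    show "disc \<nu> ` ball 0 1 \<subseteq> region" using disc_in by auto
  qed
  have kob: "kobayashi_royden region (0 - exp (- l \<nu>) *\<^sub>R e) e \<le> 1 / (exp (- l \<nu>) * l \<nu> powr \<alpha>)" for \<nu>
    unfolding kobayashi_royden_def
  proof (rule cInf_lower)
    show "1 / (exp (- l \<nu>) * l \<nu> powr \<alpha>) \<in> {a. 0 < a \<and> (\<exists>f. holo_disc f region \<and>
        f 0 = 0 - exp (- l \<nu>) *\<^sub>R e \<and> a *\<^sub>R disc_deriv0 f = e)}"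
      using holo[of \<nu>] disc_0[of \<nu>] disc_d[of \<nu>] R(1)[of \<nu>] unfolding R_def
      by (intro CollectI conjI exI[of _ "disc \<nu>"]) auto
  qed (auto intro!: bdd_belowI[of _ 0])
  show ?thesis
  proof (intro exI[of _ region] exI[of _ 0] exI[of _ "\<lambda>\<nu>. exp (- l \<nu>)"] conjI allI impI
      bounded_region pseudoconvex_region smooth_boundary_region zero_in_frontier)
    fix \<nu>
    show "exp (- l \<nu>) < 1" using l_ge(1)[of \<nu>] by simp
    show "exp (- l (Suc \<nu>)) < exp (- l \<nu>)" using levels_gap[OF \<Lambda>, of \<nu>] by (simp add: l_def)
  next
    show "(\<lambda>\<nu>. exp (- l \<nu>)) \<longlonglongrightarrow> 0"
      by (rule filterlim_compose[OF exp_at_bot])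
         (simp add: filterlim_uminus_at_bot l_def levels_at_top[OF \<Lambda>])
  next
    fix n \<nu> assume "outward_unit_normal region 0 n"
    then have n: "n = e" unfolding e_def by (rule outward_unit_normal_0)
    show "0 - exp (- l \<nu>) *\<^sub>R n \<in> region" using disc_in[of 0 \<nu>] by (simp add: n disc_0)
    show "kobayashi_royden region (0 - exp (- l \<nu>) *\<^sub>R n) n
        \<le> 1 / (exp (- l \<nu>) * (- ln (exp (- l \<nu>))) powr \<alpha>)"
      using kob[of \<nu>] by (simp add: n)
  qed simp
qed

end
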